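(* Let $U \subset \mathbb{R}^2$ be open, $f : U \to \mathbb{R}^2$ continuous, and $p \in U$ a fixed point of $f$ such that $\{p\}$ is an isolated invariant set and $p$ is neither a sink nor a source. Then there exist a finite non-empty set $F \subset \mathbb{N}$ and positive integers $a_k$ ($k \in F$) such that $$\{i(f^n, p)\}_{n \ge 1} = \sigma^1 - \sum_{k \in F} a_k \sigma^k,$$ that is, $i(f^n,p) = 1 - \sum_{k \in F,\ k \mid n} k\, a_k$ for every $n \ge 1$. Equivalently, there is a map $\varphi : J \to J$ of a finite non-empty set $J$ with $i(f^n,p) = 1 - \#\mathrm{Fix}(\varphi^n)$ for all $n\ge 1$.
   Context: $i(g,p)$ denotes the fixed point index of $g$ at an isolated fixed point $p$. For $k \ge 1$, $\sigma^k = \{\sigma^k_n\}_{n\ge1}$ is the integer sequence with $\sigma^k_n = k$ if $k \mid n$ and $\sigma^k_n = 0$ otherwise. A solution through $x$ is a sequence $(x_n)_{n\in\mathbb{Z}}$ with $x_0 = x$ and $f(x_n) = x_{n+1}$ for all $n$. For $N \subset U$, $\mathrm{Inv}(f,N)$ is the set of $x \in N$ admitting a solution through $x$ entirely contained in $N$. A compact set $N \subset U$ is an isolating neighborhood if $\mathrm{Inv}(f,N) \subset \mathrm{int}(N)$; a compact invariant set $X$ ($f(X)=X$) is isolated (an isolated invariant set) if $X = \mathrm{Inv}(f,N)$ for some isolating neighborhood $N$. A fixed point $p$ is a sink if $\{p\}$ is isolated and has an isolating neighborhood $N$ with $\mathrm{Inv}(f,N)=\{p\}$ and $f(N) \subset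 N$. A fixed point $p$ is a source if $\{p\}$ is isolated and has an isolating neighborhood $N$ with $\mathrm{Inv}(f,N)=\{p\}$ such that (i) $f(\partial N) \cap \mathrm{int}(N) = \emptyset$ and (ii) the forward orbit of every $x \in N \setminus \{p\}$ eventually leaves $N$. *)

theory Defs
  imports "HOL-Analysis.Analysis"
begin

text \<open>The plane R^2 is identified with the type complex.\<close>

definition wind :: "(real \<Rightarrow> complex) \<Rightarrow> int" where
  "wind \<gamma> = (THE w::int. \<exists>\<theta>::real \<Rightarrow> real. continuous_on {0..1} \<theta> \<and>
      (\<forall>t\<in>{0..1}. \<gamma> t = complex_of_real (norm (\<gamma> t)) * cis (\<theta> t)) \<and>
      \<theta> 1 - \<theta> 0 = 2 * pi * real_of_int w)"

definition fp_index :: "(complex \<Rightarrow> complex) \<Rightarrow> complex \<Rightarrow> int" where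
  "fp_index g p = (THE k::int. \<exists>e>0. \<forall>r. 0 < r \<and> r < e \<longrightarrow>
      wind (\<lambda>t. (p + complex_of_real r * cis (2 * pi * t)) - g (p + complex_of_real r * cis (2 * pi * t))) = k)"

definition Inv :: "(complex \<Rightarrow> complex) \<Rightarrow> complex set \<Rightarrow> complex set" where
  "Inv f N = {x \<in> N. \<exists>s::int \<Rightarrow> complex. s 0 = x \<and> (\<forall>n. s n \<in> N \<and> f (s n) = s (n + 1))}"

definition isolating_nbhd :: "(complex \<Rightarrow> complex) \<Rightarrow> complex set \<Rightarrow> complex set \<Rightarrow> bool" where
  "isolating_nbhd f U N \<longleftrightarrow> compact N \<and> N \<subseteq> U \<and> Inv f N \<subseteq> interior N"

definition isolated_inv :: "(complex \<Rightarrow> complex) \<Rightarrow> complex set \<Rightarrow> complex set \<Rightarrow> bool" where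
  "isolated_inv f U X \<longleftrightarrow> compact X \<and> f ` X = X \<and>
      (\<exists>N. isolating_nbhd f U N \<and> X = Inv f N)"

definition is_sink :: "(complex \<Rightarrow> complex) \<Rightarrow> complex set \<Rightarrow> complex \<Rightarrow> bool" where
  "is_sink f U p \<longleftrightarrow> f p = p \<and> isolated_inv f U {p} \<and>
      (\<exists>N. isolating_nbhd f U N \<and> Inv f N = {p} \<and> f ` N \<subseteq> N)"

definition is_source :: "(complex \<Rightarrow> complex) \<Rightarrow> complex set \<Rightarrow> complex \<Rightarrow> bool" where
  "is_source f U p \<longleftrightarrow> f p = p \<and> isolated_inv f U {p} \<and>
      (\<exists>N. isolating_nbhd f U N \<and> Inv f N = {p} \<and>
           f ` (frontier N) \<inter> interior N = {} \<and>
           (\<forall>x \<in> N - {p}. \<exists>n. (f ^^ n) x \<notin> N))"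

end

theory Submission
  imports Defs "HOL-Complex_Analysis.Complex_Analysis"
begin

text \<open>
  The stable set of p in a small disc contains a connected compact forward invariant set Y on which
  the iterates of f tend uniformly to p. Let N be a neighbourhood of Y bounded by level curves of
  Riemann maps of complementary components of Y, so that the plane minus finitely many points A (one
  in each bounded complementary component of N) retracts onto N by some r. Since p is neither a sink
  nor a source, a chain recurrence argument yields a connected W, open in N, containing Y, with
  f(closure W) inside N, with exit set \<open>closure W - W\<close> nonempty and mapped off closure W, and with a point
  of W missed by f(closure W). The components through which f(closure W) leaves form a finite set J,
  and winding numbers around Y show that the component hit by an exit point extends to a locally
  constant colouring of \<open>N - W\<close>; this induces a map col of J into itself.

  For each m, a nowhere vanishing correction of \<open>x - f\<^sup>m(r x)\<close>, replaced by \<open>x - col\<^sup>m\<close> where the orbit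
  exits, is a continuous function on the plane minus A. Its zeros are p, of order the fixed point
  index, and the points of J fixed by \<open>col\<^sup>m\<close>, of order 1, and it winds once around infinity. Its orders
  at A are the diagonal entries of \<open>M\<^sup>m\<close> for the integer matrix M by which f acts on the winding numbers
  around Y. As f contracts Y to p, M is nilpotent, so these orders sum to 0 and the index is
  \<open>1 - card (Fix (col\<^sup>m))\<close>.
\<close>

section \<open>Logarithms and winding numbers\<close>

text \<open>Heuristically, collapsing each landing piece \<open>C c\<close> to its point
  \<open>c\<close> turns \<open>f\<close> into a self-map whose m-th iterate has Lefschetz number 1,
  because it is traceless on first homology, and whose fixed points are \<open>p\<close> and the
  points of \<open>J\<close> fixed by \<open>col ^^ m\<close>. The proof makes this count without a
  quotient space: the displacement of the collapsed map is one explicit complex function, and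
  homology classes become integer exponents of factors \<open>z - a\<close>, taken modulo functions
  that have a logarithm. The obstacle is that \<open>Y\<close> and the exit set can be very
  irregular and that \<open>f\<close> need not be injective. Replacing \<open>x - y\<close> by
  \<open>x - c\<close>, with \<open>y\<close> and \<open>c\<close> in one connected piece, must not
  change any winding; it does not, because the quotient of the two has a logarithm in both variables
  as long as \<open>x\<close> stays in the connected region \<open>Om\<close>. Both displacements
  are normalised at a base point \<open>y0\<close> that \<open>f\<close> does not reach from
  \<open>closure W\<close>. Such a point exists because \<open>p\<close> is not a source, while
  \<open>J\<close> is nonempty because \<open>p\<close> is not a sink.\<close>

lemma exp_eq_imp_const_diff:
  fixes L M :: "'a::topological_space \<Rightarrow> complex"
  assumes S: "connected S" and L: "continuous_on S L" and M: "continuous_on S M"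
    and eq: "\<And>x. x \<in> S \<Longrightarrow> exp (L x) = exp (M x)"
  shows "\<exists>n::int. \<forall>x\<in>S. L x = M x + of_int n * (2 * of_real pi * \<i>)"
proof (cases "S = {}")
  case False
  have ex: "\<exists>n::int. L x = M x + of_int n * (2 * of_real pi * \<i>)" if xS: "x \<in> S" for x
  proof -
    obtain n :: int where "L x = M x + (of_int (2 * n) * pi) * \<i>"
      using eq[OF xS] unfolding exp_eq by blast
    then show ?thesis by (intro exI[of _ n]) (simp add: algebra_simps)
  qed
  have "(\<lambda>x. L x - M x) constant_on S"
  proof (rule continuous_discrete_range_constant[OF S])
    show "continuous_on S (\<lambda>x. L x - M x)" by (intro continuous_intros L M)
    show "\<exists>e>0. \<forall>y. y \<in> S \<and> L y - M y \<noteq> L x - M x \<longrightarrow> e \<le> norm ((L y - M y) - (L x - M x))" if xS: "x \<in> S" for x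
    proof (intro exI[of _ "2*pi"] conjI allI impI)
      fix y assume y: "y \<in> S \<and> L y - M y \<noteq> L x - M x"
      obtain n m :: int where nm: "L x = M x + of_int n * (2 * of_real pi * \<i>)" "L y = M y + of_int m * (2 * of_real pi * \<i>)"
        using ex y xS by blast
      have "(L y - M y) - (L x - M x) = of_int (m - n) * (2 * of_real pi * \<i>)"
        using nm by (simp add: algebra_simps)
      then have *: "norm ((L y - M y) - (L x - M x)) = \<bar>real_of_int (m - n)\<bar> * (2*pi)"
        by (simp only: norm_mult norm_of_int) simp
      have "m \<noteq> n" using y nm by auto
      then have "1 \<le> \<bar>real_of_int (m - n)\<bar>" by linarith
      then show "2*pi \<le> norm ((L y - M y) - (L x - M x))"
        unfolding * using mult_right_mono[of 1 "\<bar>real_of_int (m - n)\<bar>" "2*pi"] by simp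
    qed auto
  qed
  then obtain c where c: "\<And>x. x \<in> S \<Longrightarrow> L x - M x = c" by (auto simp: constant_on_def)
  obtain x0 where "x0 \<in> S" using False by blast
  then obtain n :: int where "L x0 = M x0 + of_int n * (2 * of_real pi * \<i>)" using ex by blast
  then have "c = of_int n * (2 * of_real pi * \<i>)" using c[OF \<open>x0 \<in> S\<close>] by simp
  then show ?thesis using c by (metis add.commute diff_add_cancel)
qed auto

lemma exp_eq_imp_eq:
  fixes L M :: "'a::topological_space \<Rightarrow> complex"
  assumes S: "connected S" and L: "continuous_on S L" and M: "continuous_on S M"
    and eq: "\<And>x. x \<in> S \<Longrightarrow> exp (L x) = exp (M x)"
    and "x0 \<in> S" "L x0 = M x0" "x \<in> S"
  shows "L x = M x"
proof -
  obtain n :: int where n: "\<forall>x\<in>S. L x = M x + of_int n * (2 * of_real pi * \<i>)"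
    using exp_eq_imp_const_diff[OF S L M eq] by blast
  then have "of_int n * (2 * of_real pi * \<i>) = (0::complex)" using assms by (metis add_cancel_left_right)
  then show ?thesis using n assms by auto
qed

text \<open>The uniqueness statements about orders and exponents reduce to this one. Along the
  circle \<open>k * (ln r + \<i> * t)\<close> is another logarithm of the same function, hence
  differs from \<open>L\<close> by a constant; but it grows by \<open>2 * pi * \<i> * k\<close> over
  one turn while \<open>L\<close> returns to its value.\<close>

lemma power_int_no_log_on_circle:
  fixes b :: complex
  assumes r: "r > 0" and L: "continuous_on (sphere b r) L"
    and eq: "\<And>z. z \<in> sphere b r \<Longrightarrow> (z - b) powi k = exp (L z)"
  shows "k = 0"
proof -
  define c where "c t = b + of_real r * cis t" for t :: real
  have cs: "c t \<in> sphere b r" for t using r by (auto simp: c_def dist_norm norm_mult)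
  have cc: "continuous_on S c" for S unfolding c_def by (intro continuous_intros)
  let ?M = "\<lambda>t. of_int k * (of_real (ln r) + \<i> * of_real t)"
  have "\<exists>n::int. \<forall>t\<in>{0..2*pi}. L (c t) = ?M t + of_int n * (2 * of_real pi * \<i>)"
  proof (rule exp_eq_imp_const_diff)
    show "continuous_on {0..2*pi} (\<lambda>t. L (c t))"
      by (rule continuous_on_compose2[OF L cc]) (use cs in auto)
    fix t :: real
    have "exp (L (c t)) = (c t - b) powi k" using eq[OF cs] by simp
    also have "c t - b = exp (of_real (ln r) + \<i> * of_real t)"
      using r unfolding c_def exp_add exp_of_real cis_conv_exp by simp
    also have "\<dots> powi k = exp (?M t)" by (simp add: exp_power_int)
    finally show "exp (L (c t)) = exp (?M t)" .
  qed (auto intro!: continuous_intros)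
  then obtain n :: int where n: "\<forall>t\<in>{0..2*pi}. L (c t) = ?M t + of_int n * (2 * of_real pi * \<i>)" by blast
  have "L (c 0) = L (c (2*pi))" by (simp add: c_def)
  then have "?M 0 = ?M (2*pi)" using n by auto
  then show ?thesis by (simp add: algebra_simps)
qed

lemma exp_power_int': "z \<noteq> 0 \<Longrightarrow> z powi k = exp (of_int k * Ln z)" for z :: complex
  by (metis exp_Ln exp_power_int)

text \<open>The map \<open>w \<mapsto> a + exp w\<close> covers the punctured disc by a half-plane,
  on which the pulled-back function has a logarithm \<open>l\<close>. One turn around
  \<open>a\<close> changes \<open>l\<close> by a constant \<open>k * 2 * pi * \<i>\<close>, so
  \<open>l w - k * w\<close> is periodic and descends to the disc.\<close>

lemma punctured_ball_power_int_log:
  fixes a :: complex and g :: "complex \<Rightarrow> complex"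
  assumes e: "e > 0" and g: "continuous_on (ball a e - {a}) g" and nz: "\<And>z. z \<in> ball a e - {a} \<Longrightarrow> g z \<noteq> 0"
  shows "\<exists>k::int. \<exists>L. continuous_on (ball a e - {a}) L \<and> (\<forall>z\<in>ball a e - {a}. g z = (z - a) powi k * exp (L z))"
proof -
  define H where "H = {w. Re w < ln e}"
  have convH: "convex H" unfolding H_def by (rule convex_halfspace_Re_lt)
  have mem: "a + exp w \<in> ball a e - {a} \<longleftrightarrow> w \<in> H" for w
  proof -
    have "exp (Re w) < e \<longleftrightarrow> Re w < ln e" using e by (metis exp_less_cancel_iff exp_ln)
    then show ?thesis by (simp add: H_def dist_norm)
  qed
  have contF: "continuous_on H (\<lambda>w. g (a + exp w))"
    by (rule continuous_on_compose2[OF g]) (auto intro!: continuous_intros simp: mem[simplified])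
  obtain l where l: "continuous_on H l" and lg: "\<And>w. w \<in> H \<Longrightarrow> g (a + exp w) = exp (l w)"
    using continuous_logarithm_on_contractible[OF contF convex_imp_contractible[OF convH]] nz mem by metis
  let ?P = "2 * of_real pi * \<i> :: complex"
  have shift: "w + of_int n * ?P \<in> H \<longleftrightarrow> w \<in> H" for w and n :: int by (simp add: H_def)
  have "\<exists>n::int. \<forall>w\<in>H. l (w + ?P) = l w + of_int n * ?P"
  proof (rule exp_eq_imp_const_diff[OF convex_connected[OF convH] _ l])
    show "continuous_on H (\<lambda>w. l (w + ?P))"
      by (rule continuous_on_compose2[OF l]) (use shift[of _ 1] in \<open>auto intro!: continuous_intros\<close>)
    fix w assume "w \<in> H"
    then have "w + ?P \<in> H" using shift[of w 1] by simp
    moreover have "exp (w + ?P) = exp w" by (simp add: exp_add)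
    ultimately show "exp (l (w + ?P)) = exp (l w)" using lg[of w] lg[of "w + ?P"] \<open>w \<in> H\<close> by simp
  qed
  then obtain k :: int where k: "\<And>w. w \<in> H \<Longrightarrow> l (w + ?P) = l w + of_int k * ?P" by blast
  have kn: "l (w + of_nat n * ?P) = l w + of_nat n * (of_int k * ?P)" if "w \<in> H" for w and n :: nat
  proof (induction n)
    case (Suc n)
    have "w + of_nat n * ?P \<in> H" using shift[of w "int n"] that by simp
    from k[OF this] Suc show ?case by (simp add: algebra_simps)
  qed simp
  have ki: "l (w + of_int n * ?P) = l w + of_int n * (of_int k * ?P)" if "w \<in> H" for w and n :: int
  proof (cases "n \<ge> 0")
    case True then show ?thesis using kn[OF that, of "nat n"] by simp
  next
    case False
    have "w + of_int n * ?P \<in> H" using shift that by blast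
    from kn[OF this, of "nat (-n)"] False show ?thesis by (simp add: algebra_simps)
  qed
  define L where "L z = l (Ln (z - a)) - of_int k * Ln (z - a)" for z
  have Lw: "L z = l w - of_int k * w" if w: "w \<in> H" and zw: "z - a = exp w" for z w
  proof -
    have "exp w = exp (Ln (z - a))" using zw by (metis exp_Ln exp_not_eq_zero)
    then obtain n :: int where "w = Ln (z-a) + (of_int (2 * n) * pi) * \<i>" unfolding exp_eq by blast
    then have n: "Ln (z-a) = w + of_int (-n) * ?P" by (simp add: algebra_simps)
    show ?thesis unfolding L_def n ki[OF w] by (simp add: algebra_simps)
  qed
  let ?B = "ball a e - {a}"
  \<comment> \<open>\<open>Ln\<close> jumps across the negative axis, so continuity is checked on
    two slit discs that cover the punctured one. On the second the branch
    \<open>Ln (-(z-a)) + \<i>*pi\<close> is used; by \<open>Lw\<close> the value of \<open>L\<close>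
    does not depend on the branch.\<close>
  let ?U = "?B - {z. z - a \<in> \<real>\<^sub>\<le>\<^sub>0}" and ?V = "?B - {z. -(z - a) \<in> \<real>\<^sub>\<le>\<^sub>0}"
  have LnH: "Ln (z - a) \<in> H" "Ln (-(z-a)) + \<i>*pi \<in> H" if "z \<in> ?B" for z
  proof -
    have "z - a \<noteq> 0" "norm (z - a) < e" using that by (auto simp: dist_norm norm_minus_commute)
    then show "Ln (z - a) \<in> H" "Ln (-(z-a)) + \<i>*pi \<in> H" using e by (auto simp: H_def norm_minus_commute)
  qed
  have cl: "closed {z. z - a \<in> \<real>\<^sub>\<le>\<^sub>0}" "closed {z. -(z - a) \<in> \<real>\<^sub>\<le>\<^sub>0}"
    by (auto intro!: continuous_closed_vimage[unfolded vimage_def] closed_nonpos_Reals_complex continuous_intros)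
  have opB: "open ?B" by (intro open_Diff) auto
  have "continuous_on ?U L"
    unfolding L_def
    by (intro continuous_intros continuous_on_compose2[OF l]) (use LnH in auto)
  moreover have "continuous_on ?V L"
  proof (rule continuous_on_eq)
    show "continuous_on ?V (\<lambda>z. l (Ln (-(z-a)) + \<i>*pi) - of_int k * (Ln (-(z-a)) + \<i>*pi))"
      by (intro continuous_intros continuous_on_compose2[OF l]) (use LnH in auto)
    show "l (Ln (-(z-a)) + \<i>*pi) - of_int k * (Ln (-(z-a)) + \<i>*pi) = L z" if "z \<in> ?V" for z
    proof -
      have "z - a \<noteq> 0" using that by auto
      then have "- (z - a) \<noteq> 0" by simp
      then have "exp (Ln (-(z-a))) = -(z-a)" by (rule exp_Ln)
      then have "z - a = exp (Ln (-(z-a)) + \<i>*pi)"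
        unfolding exp_add by simp
      moreover have "z \<in> ?B" using that by blast
      ultimately show ?thesis using Lw[OF LnH(2)] by metis
    qed
  qed
  ultimately have "continuous_on (?U \<union> ?V) L"
    by (intro continuous_on_open_Un open_Diff opB cl)
  moreover have "?U \<union> ?V = ?B"
  proof -
    have "z = a" if "z - a \<in> \<real>\<^sub>\<le>\<^sub>0" "-(z - a) \<in> \<real>\<^sub>\<le>\<^sub>0" for z
      using that by (auto simp: complex_nonpos_Reals_iff complex_eq_iff)
    then show ?thesis by blast
  qed
  ultimately have contL: "continuous_on ?B L" by simp
  have "g z = (z - a) powi k * exp (L z)" if "z \<in> ?B" for z
  proof -
    have "z - a \<noteq> 0" using that by auto
    then have "g z = exp (l (Ln (z - a)))" using lg[OF LnH(1)[OF that]] by simp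
    also have "\<dots> = exp (of_int k * Ln (z-a)) * exp (L z)" unfolding exp_add[symmetric] L_def by simp
    also have "\<dots> = (z - a) powi k * exp (L z)" using \<open>z - a \<noteq> 0\<close> by (simp add: exp_power_int')
    finally show ?thesis .
  qed
  then show ?thesis using contL by blast
qed

section \<open>Orders of isolated zeros\<close>

text \<open>\<open>k\<close> is the winding number of \<open>h\<close> along small circles around
  \<open>a\<close>. The form as a power times an exponential makes orders of products additive, and
  it says nothing about \<open>h a\<close>, so that zeros and mere punctures of the domain are
  treated alike.\<close>

definition has_order :: "(complex \<Rightarrow> complex) \<Rightarrow> complex \<Rightarrow> int \<Rightarrow> bool" where
  "has_order h a k \<longleftrightarrow> (\<exists>e>0. \<exists>L. continuous_on (ball a e - {a}) L \<and>
      (\<forall>z\<in>ball a e - {a}. h z = (z - a) powi k * exp (L z)))"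

lemma has_order_unique:
  assumes "has_order h a k" "has_order h a l"
  shows "k = l"
proof -
  obtain d K where d: "d > 0" "continuous_on (ball a d - {a}) K" "\<And>z. z \<in> ball a d - {a} \<Longrightarrow> h z = (z - a) powi k * exp (K z)"
    using assms(1) unfolding has_order_def by blast
  obtain e L where e: "e > 0" "continuous_on (ball a e - {a}) L" "\<And>z. z \<in> ball a e - {a} \<Longrightarrow> h z = (z - a) powi l * exp (L z)"
    using assms(2) unfolding has_order_def by blast
  define r where "r = min d e / 2"
  have r: "r > 0" "r < d" "r < e" using d(1) e(1) by (auto simp: r_def min_def)
  have sub: "sphere a r \<subseteq> ball a d - {a}" "sphere a r \<subseteq> ball a e - {a}" using r by auto
  have "k - l = 0"
  proof (rule power_int_no_log_on_circle[OF r(1)])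
    show "continuous_on (sphere a r) (\<lambda>z. L z - K z)"
      by (intro continuous_intros continuous_on_subset[OF d(2)] continuous_on_subset[OF e(2)] sub)
    fix z assume z: "z \<in> sphere a r"
    then have za: "z - a \<noteq> 0" using r by auto
    have "(z - a) powi k * exp (K z) = (z - a) powi l * exp (L z)"
      using d(3)[of z] e(3)[of z] z sub by (metis subsetD)
    then show "(z - a) powi (k - l) = exp (L z - K z)"
      using za by (simp add: power_int_diff exp_diff field_simps)
  qed
  then show ?thesis by simp
qed

lemma has_order_mult:
  assumes "has_order g a k" "has_order h a l"
  shows "has_order (\<lambda>z. g z * h z) a (k + l)"
proof -
  obtain d K where d: "d > 0" "continuous_on (ball a d - {a}) K" "\<And>z. z \<in> ball a d - {a} \<Longrightarrow> g z = (z - a) powi k * exp (K z)"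
    using assms(1) unfolding has_order_def by blast
  obtain e L where e: "e > 0" "continuous_on (ball a e - {a}) L" "\<And>z. z \<in> ball a e - {a} \<Longrightarrow> h z = (z - a) powi l * exp (L z)"
    using assms(2) unfolding has_order_def by blast
  let ?B = "ball a (min d e) - {a}"
  have sub: "?B \<subseteq> ball a d - {a}" "?B \<subseteq> ball a e - {a}" by auto
  have "continuous_on ?B (\<lambda>z. K z + L z)"
    by (intro continuous_intros continuous_on_subset[OF d(2)] continuous_on_subset[OF e(2)] sub)
  moreover have "g z * h z = (z - a) powi (k + l) * exp (K z + L z)" if "z \<in> ?B" for z
    using d(3)[of z] e(3)[of z] that sub by (auto simp: power_int_add exp_add)
  ultimately show ?thesis unfolding has_order_def
    using d(1) e(1) by (intro exI[of _ "min d e"] conjI exI[of _ "\<lambda>z. K z + L z"]) auto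
qed

lemma has_order_0I:
  assumes "e > 0" "continuous_on (ball a e) h" "\<And>z. z \<in> ball a e \<Longrightarrow> h z \<noteq> 0"
  shows "has_order h a 0"
proof -
  obtain L where "continuous_on (ball a e) L" "\<And>z. z \<in> ball a e \<Longrightarrow> h z = exp (L z)"
    using continuous_logarithm_on_ball[OF assms(2,3)] by blast
  then show ?thesis unfolding has_order_def using assms(1)
    by (intro exI[of _ e] conjI exI[of _ L]) (auto intro: continuous_on_subset)
qed

lemma has_order_1: "has_order (\<lambda>z. z - a) a 1"
  unfolding has_order_def by (intro exI[of _ 1] conjI exI[of _ "\<lambda>_. 0"]) auto

lemma has_order_cong:
  assumes "has_order g a k" "e > 0" "\<And>z. z \<in> ball a e - {a} \<Longrightarrow> h z = g z"
  shows "has_order h a k"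
proof -
  obtain d K where d: "d > 0" "continuous_on (ball a d - {a}) K" "\<And>z. z \<in> ball a d - {a} \<Longrightarrow> g z = (z - a) powi k * exp (K z)"
    using assms(1) unfolding has_order_def by blast
  have "continuous_on (ball a (min d e) - {a}) K" by (rule continuous_on_subset[OF d(2)]) auto
  then show ?thesis unfolding has_order_def using d assms(2,3)
    by (intro exI[of _ "min d e"] conjI exI[of _ K]) auto
qed

lemma has_order_exists:
  assumes "e > 0" "continuous_on (ball a e - {a}) h" "\<And>z. z \<in> ball a e - {a} \<Longrightarrow> h z \<noteq> 0"
  shows "\<exists>k. has_order h a k"
  using punctured_ball_power_int_log[OF assms] assms(1) unfolding has_order_def by blast

lemma finite_avoid_ball:
  fixes a :: complex
  assumes "finite A" "a \<notin> A"
  shows "\<exists>e>0. ball a e \<inter> A = {}"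
proof -
  obtain d where "d > 0" "\<forall>x\<in>A. x \<noteq> a \<longrightarrow> d \<le> dist a x" using finite_set_avoid[OF assms(1)] by metis
  then show ?thesis using assms(2) by (intro exI[of _ d]) force
qed

lemma continuous_on_prod_powi:
  assumes "finite A" "S \<inter> A = {}"
  shows "continuous_on S (\<lambda>z::complex. \<Prod>a\<in>A. (z - a) powi k a)"
  by (rule continuous_on_prod, rule continuous_on_power_int) (use assms in \<open>auto intro!: continuous_intros\<close>)

text \<open>Induction removes one puncture at a time: near \<open>a\<close> the function is a power
  of \<open>z - a\<close> times \<open>exp (L0 z)\<close>, and damping \<open>L0\<close> to 0 lets
  the quotient by that power extend over \<open>a\<close> without a zero.\<close>

lemma complement_finite_power_int_log:
  fixes A :: "complex set"
  assumes "finite A" "continuous_on (-A) h" "\<And>z. z \<notin> A \<Longrightarrow> h z \<noteq> 0"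
  shows "\<exists>k::complex\<Rightarrow>int. \<exists>L. continuous_on (-A) L \<and>
     (\<forall>z\<in>-A. h z = (\<Prod>a\<in>A. (z - a) powi k a) * exp (L z))"
  using assms
proof (induction A arbitrary: h rule: finite_induct)
  case empty
  then obtain L where "continuous_on UNIV L" "\<And>z. h z = exp (L z)"
    using continuous_logarithm_on_contractible[of UNIV h] by (auto simp: convex_imp_contractible)
  then show ?case by auto
next
  case (insert a A)
  obtain e where e: "e > 0" "ball a e \<inter> A = {}" using finite_avoid_ball[OF insert.hyps] by blast
  have sub: "ball a e - {a} \<subseteq> - insert a A" using e by auto
  obtain k0 L0 where L0: "continuous_on (ball a e - {a}) L0"
    and hL0: "\<And>z. z \<in> ball a e - {a} \<Longrightarrow> h z = (z - a) powi k0 * exp (L0 z)"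
    using punctured_ball_power_int_log[OF e(1) continuous_on_subset[OF insert.prems(1) sub]] insert.prems(2) sub
    by (metis ComplD subsetD)
  \<comment> \<open>A cut-off that is 0 on the ball of radius \<open>e/4\<close> and 1 outside the
    ball of radius \<open>e/2\<close>. Hence \<open>h1\<close> is 1 near \<open>a\<close> and agrees
    with \<open>h z / (z - a) powi k0\<close> farther out.\<close>
  define \<mu> where "\<mu> z = min 1 (max 0 (4 * norm (z - a) / e - 1))" for z
  have \<mu>c: "continuous_on S \<mu>" for S unfolding \<mu>_def using e(1) by (intro continuous_intros) auto
  have \<mu>0: "\<mu> z = 0" if "z \<in> ball a (e/4)" for z
    using that e(1) unfolding \<mu>_def by (auto simp: dist_norm norm_minus_commute field_simps)
  have \<mu>1: "\<mu> z = 1" if "z \<notin> ball a (e/2)" for z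
    using that e(1) unfolding \<mu>_def by (auto simp: dist_norm norm_minus_commute field_simps)
  define h1 where "h1 z = (if z \<in> ball a e then exp (of_real (\<mu> z) * L0 z) else h z / (z - a) powi k0)" for z
  have h1o: "h1 z = h z / (z - a) powi k0" if "z \<notin> ball a (e/2)" "z \<noteq> a" for z
    using that hL0[of z] \<mu>1 by (auto simp: h1_def)
  let ?U = "- A - cball a (e/2)"
  have opU: "open ?U" using insert.hyps by (intro open_Diff) (auto intro!: open_Compl finite_imp_closed)
  have "continuous_on (ball a e - {a}) h1"
    by (rule continuous_on_eq[of _ "\<lambda>z. exp (of_real (\<mu> z) * L0 z)"]) (auto simp: h1_def intro!: continuous_intros \<mu>c L0)
  moreover have "continuous_on (ball a (e/4)) h1"
    by (rule continuous_on_eq[of _ "\<lambda>z. 1"]) (use e(1) in \<open>auto simp: h1_def \<mu>0\<close>)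
  moreover have "continuous_on ?U h1"
  proof (rule continuous_on_eq[of _ "\<lambda>z. h z / (z - a) powi k0"])
    show "continuous_on ?U (\<lambda>z. h z / (z - a) powi k0)"
      by (intro continuous_intros continuous_on_subset[OF insert.prems(1)]) (use e(1) in \<open>auto simp: power_int_eq_0_iff\<close>)
    fix z assume "z \<in> ?U"
    then have "z \<notin> ball a (e/2)" "z \<noteq> a" using e(1) by auto
    then show "h z / (z - a) powi k0 = h1 z" using h1o by metis
  qed
  ultimately have "continuous_on (((ball a e - {a}) \<union> ball a (e/4)) \<union> ?U) h1"
    by (intro continuous_on_open_Un opU open_Un open_Diff) auto
  then have "continuous_on (-A) h1"
    by (rule continuous_on_subset) (use e(1) in auto)
  moreover have "h1 z \<noteq> 0" if "z \<notin> A" for z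
    using that insert.prems(2)[of z] e(1) by (cases "z = a") (auto simp: h1_def power_int_eq_0_iff)
  ultimately obtain k L1 where L1: "continuous_on (-A) L1"
    and hL1: "\<And>z. z \<notin> A \<Longrightarrow> h1 z = (\<Prod>b\<in>A. (z - b) powi k b) * exp (L1 z)"
    using insert.IH[of h1] by (metis ComplI)
  define k' where "k' = k(a := k0)"
  have pk: "(\<Prod>b\<in>insert a A. (z - b) powi k' b) = (z - a) powi k0 * (\<Prod>b\<in>A. (z - b) powi k b)" for z
  proof -
    have "(\<Prod>b\<in>A. (z - b) powi k' b) = (\<Prod>b\<in>A. (z - b) powi k b)"
      using insert.hyps by (intro prod.cong) (auto simp: k'_def)
    then show ?thesis using insert.hyps by (simp add: k'_def)
  qed
  \<comment> \<open>The additional term restores the factor by which \<open>h1\<close> was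
    damped.\<close>
  define L where "L z = (if z \<in> ball a e then L1 z + (1 - of_real (\<mu> z)) * L0 z else L1 z)" for z
  have "continuous_on (ball a e - {a}) L"
    by (rule continuous_on_eq[of _ "\<lambda>z. L1 z + (1 - of_real (\<mu> z)) * L0 z"])
       (use e(2) in \<open>auto simp: L_def intro!: continuous_intros \<mu>c L0 continuous_on_subset[OF L1]\<close>)
  moreover have "continuous_on ?U L"
    by (rule continuous_on_eq[of _ "\<lambda>z. L1 z"]) (use \<mu>1 in \<open>auto simp: L_def intro!: continuous_on_subset[OF L1]\<close>)
  ultimately have "continuous_on ((ball a e - {a}) \<union> ?U) L"
    by (intro continuous_on_open_Un opU open_Diff) auto
  then have "continuous_on (- insert a A) L"
    by (rule continuous_on_subset) (use e(1) in auto)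
  moreover have "h z = (\<Prod>b\<in>insert a A. (z - b) powi k' b) * exp (L z)" if z: "z \<in> - insert a A" for z
  proof -
    have za: "z - a \<noteq> 0" "z \<notin> A" "z \<noteq> a" using z by auto
    show ?thesis
    proof (cases "z \<in> ball a e")
      case True
      have "h z = (z - a) powi k0 * exp (L0 z)" using hL0 True za by auto
      also have "\<dots> = (z - a) powi k0 * (exp (of_real (\<mu> z) * L0 z) * exp ((1 - of_real (\<mu> z)) * L0 z))"
        unfolding exp_add[symmetric] by (simp add: algebra_simps)
      also have "exp (of_real (\<mu> z) * L0 z) = (\<Prod>b\<in>A. (z - b) powi k b) * exp (L1 z)"
        using hL1[OF za(2)] True by (simp add: h1_def)
      finally show ?thesis unfolding pk using True by (simp add: L_def exp_add mult_ac)
    next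
      case False
      then have "h z / (z - a) powi k0 = (\<Prod>b\<in>A. (z - b) powi k b) * exp (L1 z)"
        using hL1[OF za(2)] by (simp add: h1_def)
      moreover have "(z - a) powi k0 \<noteq> 0" using za by (simp add: power_int_eq_0_iff)
      ultimately show ?thesis unfolding pk using False by (simp add: L_def field_simps)
    qed
  qed
  ultimately show ?case by blast
qed

lemma has_order_prod_exp:
  assumes "finite A" "a \<in> A" "continuous_on (-A) L"
    and eq: "\<And>z. z \<notin> A \<Longrightarrow> h z = (\<Prod>b\<in>A. (z - b) powi k b) * exp (L z)"
  shows "has_order h a (k a)"
proof -
  obtain e where e: "e > 0" "ball a e \<inter> (A - {a}) = {}" using finite_avoid_ball[of "A - {a}" a] assms by auto
  have "has_order (\<lambda>z. \<Prod>b\<in>A-{a}. (z - b) powi k b) a 0"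
    by (rule has_order_0I[OF e(1) continuous_on_prod_powi]) (use assms(1) e in \<open>auto simp: power_int_eq_0_iff\<close>)
  moreover have "has_order (\<lambda>z. (z - a) powi k a * exp (L z)) a (k a)"
    unfolding has_order_def using e assms(3)
    by (intro exI[of _ e] conjI exI[of _ L]) (auto intro: continuous_on_subset)
  ultimately have "has_order (\<lambda>z. ((z - a) powi k a * exp (L z)) * (\<Prod>b\<in>A-{a}. (z - b) powi k b)) a (k a)"
    using has_order_mult by fastforce
  then show ?thesis
  proof (rule has_order_cong[OF _ e(1)])
    fix z assume "z \<in> ball a e - {a}"
    then have "z \<notin> A" using e(2) by blast
    from eq[OF this] show "h z = ((z - a) powi k a * exp (L z)) * (\<Prod>b\<in>A-{a}. (z - b) powi k b)"
      unfolding prod.remove[OF assms(1,2)] by (simp only: mult_ac)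
  qed
qed

text \<open>In \<open>z - a = (z - p) * (1 - (a - p) / (z - p))\<close> the inner quotient has
  modulus below 1 on the circle, so the principal logarithm applies.\<close>

lemma log_ratio_on_sphere:
  fixes a p :: complex
  assumes "a \<in> ball p r"
  shows "\<exists>L. continuous_on (sphere p r) L \<and> (\<forall>z\<in>sphere p r. z - a = (z - p) * exp (L z))"
proof -
  have nz: "z - p \<noteq> 0" "norm ((a - p) / (z - p)) < 1" if "z \<in> sphere p r" for z
  proof -
    have "norm (z - p) = r" "norm (a - p) < r" using that assms by (auto simp: dist_norm norm_minus_commute)
    moreover have "r > 0" using calculation norm_ge_zero le_less_trans by blast
    ultimately show "z - p \<noteq> 0" "norm ((a - p) / (z - p)) < 1" by (auto simp: norm_divide)
  qed
  have np: "1 - (a - p) / (z - p) \<notin> \<real>\<^sub>\<le>\<^sub>0" if "z \<in> sphere p r" for z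
  proof -
    have "Re ((a - p) / (z - p)) < 1" using nz(2)[OF that] complex_Re_le_cmod order_le_less_trans by blast
    then show ?thesis by (auto simp: complex_nonpos_Reals_iff)
  qed
  show ?thesis
  proof (intro exI[of _ "\<lambda>z. Ln (1 - (a - p) / (z - p))"] conjI ballI)
    show "continuous_on (sphere p r) (\<lambda>z. Ln (1 - (a - p) / (z - p)))"
      by (intro continuous_intros) (use nz np in auto)
    fix z assume z: "z \<in> sphere p r"
    then have "1 - (a - p) / (z - p) \<noteq> 0" using np[OF z] by auto
    then show "z - a = (z - p) * exp (Ln (1 - (a - p) / (z - p)))"
      using nz(1)[OF z] by (simp add: field_simps)
  qed
qed

lemma prod_powi_on_sphere:
  fixes p :: complex
  assumes "finite A" "A \<subseteq> ball p r"
  shows "\<exists>L. continuous_on (sphere p r) L \<and>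
     (\<forall>z\<in>sphere p r. (\<Prod>a\<in>A. (z - a) powi k a) = (z - p) powi (\<Sum>a\<in>A. k a) * exp (L z))"
  using assms
proof (induction A rule: finite_induct)
  case empty
  then show ?case by (intro exI[of _ "\<lambda>_. 0"]) auto
next
  case (insert a A)
  then obtain L where L: "continuous_on (sphere p r) L"
     "\<And>z. z\<in>sphere p r \<Longrightarrow> (\<Prod>a\<in>A. (z - a) powi k a) = (z - p) powi (\<Sum>a\<in>A. k a) * exp (L z)" by auto
  obtain M where M: "continuous_on (sphere p r) M" "\<And>z. z\<in>sphere p r \<Longrightarrow> z - a = (z - p) * exp (M z)"
    using log_ratio_on_sphere[of a p r] insert.prems by auto
  have r: "r > 0" using insert.prems by (metis ball_eq_empty empty_subsetI insert_not_empty not_le subset_antisym)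
  show ?case
  proof (intro exI[of _ "\<lambda>z. L z + of_int (k a) * M z"] conjI ballI)
    show "continuous_on (sphere p r) (\<lambda>z. L z + of_int (k a) * M z)" by (intro continuous_intros L M)
    fix z assume z: "z \<in> sphere p r"
    then have zp: "z - p \<noteq> 0" using r by auto
    have "(z - a) powi k a = (z - p) powi k a * exp (of_int (k a) * M z)"
      unfolding M(2)[OF z] by (simp add: power_int_mult_distrib exp_power_int)
    then show "(\<Prod>a\<in>insert a A. (z - a) powi k a) = (z - p) powi (\<Sum>a\<in>insert a A. k a) * exp (L z + of_int (k a) * M z)"
      using insert.hyps zp L(2)[OF z] by (simp add: power_int_add exp_add)
  qed
qed

text \<open>The argument principle for continuous functions. The factorisation over the complement
  of \<open>A\<close> has the local orders as exponents, and on a circle enclosing \<open>A\<close>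
  every \<open>z - a\<close> may be traded for \<open>z - p\<close>.\<close>

lemma sum_of_orders:
  fixes A :: "complex set"
  assumes A: "finite A" "A \<subseteq> ball p r" "r > 0"
    and h: "continuous_on (-A) h" "\<And>z. z \<notin> A \<Longrightarrow> h z \<noteq> 0"
    and k: "\<And>a. a \<in> A \<Longrightarrow> has_order h a (k a)"
    and L: "continuous_on (sphere p r) L" "\<And>z. z \<in> sphere p r \<Longrightarrow> h z = (z - p) powi K * exp (L z)"
  shows "K = (\<Sum>a\<in>A. k a)"
proof -
  obtain k' L' where L': "continuous_on (-A) L'" "\<And>z. z \<notin> A \<Longrightarrow> h z = (\<Prod>a\<in>A. (z - a) powi k' a) * exp (L' z)"
    using complement_finite_power_int_log[OF A(1) h] by auto
  have "k' a = k a" if "a \<in> A" for a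
    using has_order_unique[OF has_order_prod_exp[OF A(1) that L'] k[OF that]] .
  then have eqk: "(\<Sum>a\<in>A. k' a) = (\<Sum>a\<in>A. k a)" by simp
  obtain M where M: "continuous_on (sphere p r) M"
     "\<And>z. z\<in>sphere p r \<Longrightarrow> (\<Prod>a\<in>A. (z - a) powi k' a) = (z - p) powi (\<Sum>a\<in>A. k' a) * exp (M z)"
    using prod_powi_on_sphere[OF A(1,2)] by blast
  have sA: "sphere p r \<subseteq> - A" using A by (auto dest!: subsetD)
  have "K - (\<Sum>a\<in>A. k' a) = 0"
  proof (rule power_int_no_log_on_circle[OF A(3)])
    show "continuous_on (sphere p r) (\<lambda>z. M z + L' z - L z)"
      by (intro continuous_intros M L continuous_on_subset[OF L'(1) sA])
    fix z assume z: "z \<in> sphere p r"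
    then have zp: "z - p \<noteq> 0" using A(3) by auto
    have "(z - p) powi K * exp (L z) = (z - p) powi (\<Sum>a\<in>A. k' a) * exp (M z) * exp (L' z)"
      using L(2)[OF z] L'(2)[of z] M(2)[OF z] z sA by auto
    then show "(z - p) powi (K - (\<Sum>a\<in>A. k' a)) = exp (M z + L' z - L z)"
      using zp by (simp add: power_int_diff exp_diff exp_add field_simps)
  qed
  then show ?thesis using eqk by simp
qed

text \<open>The functions \<open>z - a\<close>, one for each of several bounded components of the
  complement of \<open>Y\<close>, are independent modulo functions with a logarithm on
  \<open>Y\<close>. Given a logarithm of the product, the factor of \<open>b\<close> can be moved to
  the other side of the equation: one side is used inside the component of \<open>b\<close>, the
  other outside it. The glued function is continuous and zero-free on the whole plane, so it does
  not wind on a large circle around \<open>b\<close>.\<close>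

lemma power_int_prod_log_unique:
  fixes Y :: "complex set"
  assumes Y: "compact Y" and A: "finite A" "A \<inter> Y = {}"
    and bd: "\<And>a. a \<in> A \<Longrightarrow> bounded (connected_component_set (-Y) a)"
    and sep: "\<And>a b. a \<in> A \<Longrightarrow> b \<in> A \<Longrightarrow> a \<noteq> b \<Longrightarrow> b \<notin> connected_component_set (-Y) a"
    and L: "continuous_on Y L" "\<And>z. z \<in> Y \<Longrightarrow> (\<Prod>a\<in>A. (z - a) powi k a) = exp (L z)"
    and b: "b \<in> A"
  shows "k b = 0"
proof -
  define P where "P = connected_component_set (-Y) b"
  have opY: "open (-Y)" using Y by (simp add: compact_imp_closed open_Compl)
  have opP: "open P" unfolding P_def by (rule open_connected_component[OF opY])
  have bP: "b \<in> P" unfolding P_def using A b by auto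
  have frP: "closure P - P \<subseteq> Y"
  proof -
    have "frontier P \<subseteq> frontier (-Y)" unfolding P_def by (rule frontier_of_connected_component_subset)
    also have "\<dots> \<subseteq> Y" using Y by (simp add: frontier_complement frontier_subset_closed compact_imp_closed)
    finally show ?thesis using opP by (simp add: frontier_def interior_open)
  qed
  have cP: "c \<notin> closure P" if "c \<in> A - {b}" for c
    using that sep[OF b, of c] frP A(2) unfolding P_def by auto
  \<comment> \<open>\<open>L\<close> lives on \<open>Y\<close> only; its Tietze extension serves
    throughout \<open>closure P\<close>, which has its frontier in \<open>Y\<close>.\<close>
  obtain g where g: "continuous_on UNIV g" "\<And>z. z \<in> Y \<Longrightarrow> g z = L z"
    using Tietze_unbounded[OF L(1), of UNIV] Y by (auto simp: compact_imp_closed)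
  define H where "H z = (if z \<in> closure P then (\<Prod>c\<in>A-{b}. (z - c) powi k c) * exp (- g z) else (z - b) powi (- k b))" for z
  have eqH: "(\<Prod>c\<in>A-{b}. (z - c) powi k c) * exp (- g z) = (z - b) powi (- k b)" if "z \<in> Y" for z
  proof -
    have zb: "z - b \<noteq> 0" using that A(2) b by auto
    have "(z - b) powi k b * (\<Prod>c\<in>A-{b}. (z - c) powi k c) = exp (g z)"
      using L(2)[OF that] g(2)[OF that] prod.remove[OF A(1) b, of "\<lambda>c. (z - c) powi k c"] by simp
    moreover have "(z - b) powi k b \<noteq> 0" using zb by (simp add: power_int_eq_0_iff)
    ultimately show ?thesis by (simp add: exp_minus power_int_minus field_simps)
  qed
  have "continuous_on (closure P \<union> - P) H"
    unfolding H_def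
  proof (rule continuous_on_cases)
    show "closed (closure P)" "closed (-P)" using opP by auto
    show "continuous_on (closure P) (\<lambda>z. (\<Prod>c\<in>A-{b}. (z - c) powi k c) * exp (- g z))"
      by (intro continuous_intros continuous_on_prod_powi continuous_on_subset[OF g(1)]) (use A(1) cP in auto)
    show "continuous_on (- P) (\<lambda>z. (z - b) powi (- k b))"
      by (intro continuous_intros) (use bP in auto)
    show "\<forall>z. z \<in> closure P \<and> z \<notin> closure P \<or> z \<in> - P \<and> z \<in> closure P \<longrightarrow>
        (\<Prod>c\<in>A-{b}. (z - c) powi k c) * exp (- g z) = (z - b) powi (- k b)"
      using eqH frP by blast
  qed
  moreover have "closure P \<union> - P = UNIV" using closure_subset by blast
  ultimately have Hc: "continuous_on UNIV H" by simp
  have Hnz: "H z \<noteq> 0" for z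
    using cP[of z] bP closure_subset[of P] A(1) by (auto simp: H_def power_int_eq_0_iff dest: cP)
  obtain G where G: "continuous_on UNIV G" "\<And>z. H z = exp (G z)"
    using continuous_logarithm_on_contractible[OF Hc] Hnz by (auto simp: convex_imp_contractible)
  have "bounded (closure P)" unfolding P_def using bd[OF b] bounded_closure by blast
  then obtain r where r: "r > 0" "closure P \<subseteq> ball b r" using bounded_subset_ballD by blast
  have "- k b = 0"
  proof (rule power_int_no_log_on_circle[OF r(1) continuous_on_subset[OF G(1)]])
    fix z assume "z \<in> sphere b r"
    then have "z \<notin> closure P" using r(2) by auto
    then show "(z - b) powi - k b = exp (G z)" using G(2)[of z] by (simp add: H_def)
  qed auto
  then show ?thesis by simp
qed

text \<open>The bridge to \<open>wind\<close> and \<open>fp_index\<close>. The factorisation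
  supplies an explicit angle function on each small circle, and two angle functions of the same loop
  differ by a constant, so both definite descriptions have a unique witness.\<close>

lemma fp_index_eq_order:
  assumes "has_order (\<lambda>z. z - g z) p k"
  shows "fp_index g p = k"
proof -
  obtain e L where e: "e > 0" and L: "continuous_on (ball p e - {p}) L"
    and eq: "\<And>z. z \<in> ball p e - {p} \<Longrightarrow> z - g z = (z - p) powi k * exp (L z)"
    using assms unfolding has_order_def by blast
  have w: "wind (\<lambda>t. (p + complex_of_real r * cis (2 * pi * t)) - g (p + complex_of_real r * cis (2 * pi * t))) = k"
    if r: "0 < r" "r < e" for r
  proof -
    define c where "c t = p + complex_of_real r * cis (2 * pi * t)" for t
    define \<gamma> where "\<gamma> t = c t - g (c t)" for t
    have cB: "c t \<in> ball p e - {p}" for t using r by (auto simp: c_def dist_norm norm_mult)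
    have cc: "continuous_on S c" for S unfolding c_def by (intro continuous_intros)
    have Lc: "continuous_on S (\<lambda>t. L (c t))" for S
      by (rule continuous_on_compose2[OF L cc]) (use cB in auto)
    define \<theta> where "\<theta> t = 2 * pi * of_int k * t + Im (L (c t))" for t
    have \<gamma>: "\<gamma> t = of_real (r powi k * exp (Re (L (c t)))) * cis (\<theta> t)" for t
    proof -
      have "\<gamma> t = (of_real r * cis (2*pi*t)) powi k * exp (L (c t))"
        using eq[OF cB] by (simp add: \<gamma>_def c_def)
      also have "(of_real r * cis (2*pi*t)) powi k = of_real (r powi k) * cis (of_int k * (2*pi*t))"
        by (simp add: power_int_mult_distrib cis_power_int)
      also have "exp (L (c t)) = of_real (exp (Re (L (c t)))) * cis (Im (L (c t)))"
        by (simp add: exp_eq_polar)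
      finally show ?thesis by (simp add: \<theta>_def cis_mult[symmetric] mult_ac)
    qed
    have pos: "r powi k * exp (Re (L (c t))) > 0" for t using r by simp
    have nrm: "norm (\<gamma> t) = r powi k * exp (Re (L (c t)))" for t
      unfolding \<gamma> norm_mult norm_of_real norm_cis using pos[of t] by simp
    have \<gamma>n: "\<gamma> t = of_real (norm (\<gamma> t)) * cis (\<theta> t)" for t
      unfolding nrm by (rule \<gamma>)
    have \<theta>c: "continuous_on {0..1} \<theta>" unfolding \<theta>_def by (intro continuous_intros Lc)
    have \<theta>d: "\<theta> 1 - \<theta> 0 = 2 * pi * real_of_int k" by (simp add: \<theta>_def c_def)
    have "wind \<gamma> = k"
      unfolding wind_def
    proof (rule the_equality)
      show "\<exists>\<theta>. continuous_on {0..1} \<theta> \<and> (\<forall>t\<in>{0..1}. \<gamma> t = complex_of_real (norm (\<gamma> t)) * cis (\<theta> t)) \<and> \<theta> 1 - \<theta> 0 = 2 * pi * real_of_int k"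
        using \<theta>c \<theta>d \<gamma> nrm by (intro exI[of _ \<theta>]) auto
      fix w :: int
      assume "\<exists>\<theta>. continuous_on {0..1} \<theta> \<and> (\<forall>t\<in>{0..1}. \<gamma> t = complex_of_real (norm (\<gamma> t)) * cis (\<theta> t)) \<and> \<theta> 1 - \<theta> 0 = 2 * pi * real_of_int w"
      then obtain \<eta> where \<eta>: "continuous_on {0..1} \<eta>" "\<And>t. t\<in>{0..1} \<Longrightarrow> \<gamma> t = complex_of_real (norm (\<gamma> t)) * cis (\<eta> t)"
         "\<eta> 1 - \<eta> 0 = 2 * pi * real_of_int w" by blast
      have "\<exists>n::int. \<forall>t\<in>{0..1::real}. \<i> * of_real (\<eta> t) = \<i> * of_real (\<theta> t) + of_int n * (2 * of_real pi * \<i>)"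
      proof (rule exp_eq_imp_const_diff)
        fix t :: real assume t: "t \<in> {0..1}"
        have "of_real (norm (\<gamma> t)) * cis (\<eta> t) = of_real (norm (\<gamma> t)) * cis (\<theta> t)"
          using \<eta>(2)[OF t] \<gamma>n[of t] by (rule trans[OF sym])
        moreover have "norm (\<gamma> t) \<noteq> 0" using nrm pos by (metis less_irrefl)
        ultimately have "cis (\<eta> t) = cis (\<theta> t)" by (metis mult_left_cancel of_real_eq_0_iff)
        then show "exp (\<i> * of_real (\<eta> t)) = exp (\<i> * of_real (\<theta> t))" by (simp add: cis_conv_exp)
      qed (auto intro!: continuous_intros \<eta> \<theta>c)
      then obtain n :: int where n: "\<And>t. t \<in> {0..1::real} \<Longrightarrow> \<i> * of_real (\<eta> t) = \<i> * of_real (\<theta> t) + of_int n * (2 * of_real pi * \<i>)" by blast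
      have "\<eta> t = \<theta> t + 2 * pi * of_int n" if "t \<in> {0..1}" for t
        using arg_cong[OF n[OF that], of Im] by simp
      then have "\<eta> 1 - \<eta> 0 = \<theta> 1 - \<theta> 0" by simp
      then show "w = k" using \<eta>(3) \<theta>d by simp
    qed
    then show ?thesis unfolding \<gamma>_def c_def .
  qed
  show ?thesis
    unfolding fp_index_def
  proof (rule the_equality)
    show "\<exists>e>0. \<forall>r. 0 < r \<and> r < e \<longrightarrow> wind (\<lambda>t. (p + complex_of_real r * cis (2 * pi * t)) - g (p + complex_of_real r * cis (2 * pi * t))) = k"
      using w e by blast
    fix l assume "\<exists>e>0. \<forall>r. 0 < r \<and> r < e \<longrightarrow> wind (\<lambda>t. (p + complex_of_real r * cis (2 * pi * t)) - g (p + complex_of_real r * cis (2 * pi * t))) = l"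
    then obtain d where d: "d > 0" "\<forall>r. 0 < r \<and> r < d \<longrightarrow> wind (\<lambda>t. (p + complex_of_real r * cis (2 * pi * t)) - g (p + complex_of_real r * cis (2 * pi * t))) = l" by blast
    define r where "r = min d e / 2"
    have "0 < r" "r < d" "r < e" using d(1) e by (auto simp: r_def min_def)
    then show "l = k" using w d(2) by metis
  qed
qed

section \<open>Logarithms in two variables\<close>

text \<open>For fixed \<open>y\<close> a logarithm on the connected set \<open>C\<close> that is 0
  at \<open>z0\<close> is unique. It exists for \<open>y = c\<close>, and compactness of
  \<open>C\<close> allows it to be carried to all nearby \<open>y\<close> by adding principal
  logarithms of \<open>\<kappa> x y / \<kappa> x y1\<close>. Connectedness of
  \<open>\<Gamma>\<close> reaches every \<open>y\<close>, and uniqueness turns the same local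
  formula into joint continuity.\<close>

lemma two_variable_log_compact:
  fixes \<kappa> :: "complex \<Rightarrow> complex \<Rightarrow> complex"
  assumes C: "compact C" "connected C" and \<Gamma>: "connected \<Gamma>"
    and cont: "continuous_on (C \<times> \<Gamma>) (\<lambda>(x,y). \<kappa> x y)" and nz: "\<And>x y. x \<in> C \<Longrightarrow> y \<in> \<Gamma> \<Longrightarrow> \<kappa> x y \<noteq> 0"
    and z0: "z0 \<in> C" "\<And>y. y \<in> \<Gamma> \<Longrightarrow> \<kappa> z0 y = 1" and c: "c \<in> \<Gamma>" "\<And>x. x \<in> C \<Longrightarrow> \<kappa> x c = 1"
  shows "\<exists>l. continuous_on (C \<times> \<Gamma>) (\<lambda>(x,y). l x y) \<and> (\<forall>x\<in>C. \<forall>y\<in>\<Gamma>. exp (l x y) = \<kappa> x y) \<and> (\<forall>y\<in>\<Gamma>. l z0 y = 0)"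
proof -
  \<comment> \<open>Uniformity in \<open>x\<close>: a sequence of counterexamples with second
    coordinates tending to \<open>y1\<close> would accumulate at a point of \<open>C\<close> where
    the quotient is 1.\<close>
  have near: "\<exists>d>0. \<forall>y\<in>\<Gamma>. dist y y1 < d \<longrightarrow> (\<forall>x\<in>C. norm (\<kappa> x y / \<kappa> x y1 - 1) < 1)" if y1: "y1 \<in> \<Gamma>" for y1
  proof (rule ccontr)
    assume neg: "\<not> ?thesis"
    then have neg': "\<exists>y\<in>\<Gamma>. dist y y1 < d \<and> (\<exists>x\<in>C. 1 \<le> norm (\<kappa> x y / \<kappa> x y1 - 1))" if "d > 0" for d
      using that by (meson not_less)
    have "\<exists>x y. x \<in> C \<and> y \<in> \<Gamma> \<and> dist y y1 < 1 / Suc n \<and> 1 \<le> norm (\<kappa> x y / \<kappa> x y1 - 1)" for n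
    proof -
      have "1 / real (Suc n) > 0" by simp
      from neg'[OF this] show ?thesis by blast
    qed
    then obtain X Y where XY: "\<And>n. X n \<in> C" "\<And>n. Y n \<in> \<Gamma>" "\<And>n. dist (Y n) y1 < 1 / Suc n"
       "\<And>n. 1 \<le> norm (\<kappa> (X n) (Y n) / \<kappa> (X n) y1 - 1)" by metis
    obtain x r where x: "x \<in> C" "strict_mono r" "(X \<circ> r) \<longlonglongrightarrow> x"
      using C(1) XY(1) unfolding compact_def by metis
    have Yl: "Y \<longlonglongrightarrow> y1"
    proof (rule metric_LIMSEQ_I)
      fix e :: real assume "e > 0"
      then obtain N where N: "1 / real (Suc N) < e" using nat_approx_posE by blast
      have "dist (Y n) y1 < e" if "n \<ge> N" for n
      proof -
        have "1 / real (Suc n) \<le> 1 / real (Suc N)" using that by (simp add: frac_le)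
        with XY(3)[of n] N show ?thesis by linarith
      qed
      then show "\<exists>no. \<forall>n\<ge>no. dist (Y n) y1 < e" by blast
    qed
    have "(\<lambda>n. (X (r n), Y (r n))) \<longlonglongrightarrow> (x, y1)"
      using x(3) LIMSEQ_subseq_LIMSEQ[OF Yl x(2)] by (intro tendsto_Pair) (auto simp: o_def)
    then have 1: "(\<lambda>n. \<kappa> (X (r n)) (Y (r n))) \<longlonglongrightarrow> \<kappa> x y1"
      using continuous_on_tendsto_compose[OF cont, of "\<lambda>n. (X (r n), Y (r n))" "(x,y1)" sequentially] XY x y1 by auto
    have "(\<lambda>n. (X (r n), y1)) \<longlonglongrightarrow> (x, y1)"
      using x(3) by (intro tendsto_Pair) (auto simp: o_def)
    then have 2: "(\<lambda>n. \<kappa> (X (r n)) y1) \<longlonglongrightarrow> \<kappa> x y1"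
      using continuous_on_tendsto_compose[OF cont, of "\<lambda>n. (X (r n), y1)" "(x,y1)" sequentially] XY x y1 by auto
    have "(\<lambda>n. norm (\<kappa> (X (r n)) (Y (r n)) / \<kappa> (X (r n)) y1 - 1)) \<longlonglongrightarrow> norm (\<kappa> x y1 / \<kappa> x y1 - 1)"
      by (intro tendsto_norm tendsto_diff tendsto_divide 1 2 tendsto_const nz[OF x(1) y1])
    then have "1 \<le> norm (\<kappa> x y1 / \<kappa> x y1 - 1)"
      by (rule LIMSEQ_le_const) (use XY(4) in auto)
    then show False using nz[OF x(1) y1] by simp
  qed
  have npR: "w \<notin> \<real>\<^sub>\<le>\<^sub>0" if "norm (w - 1) < 1" for w :: complex
  proof -
    have "\<bar>Re (w - 1)\<bar> < 1" using that abs_Re_le_cmod le_less_trans by blast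
    then show ?thesis by (auto simp: complex_nonpos_Reals_iff)
  qed
  have slice: "continuous_on C (\<lambda>x. \<kappa> x y)" if "y \<in> \<Gamma>" for y
    by (rule continuous_on_compose2[OF cont, of C "\<lambda>x. (x,y)", simplified]) (use that in \<open>auto intro!: continuous_intros\<close>)
  define Q where "Q y L \<longleftrightarrow> continuous_on C L \<and> L z0 = 0 \<and> (\<forall>x\<in>C. exp (L x) = \<kappa> x y)" for y L
  have "\<exists>L. Q y L" if y: "y \<in> \<Gamma>" for y
  proof (rule connected_induction_simple[OF \<Gamma>, where P = "\<lambda>y. \<exists>L. Q y L" and a = c])
    show "\<exists>L. Q c L" using c unfolding Q_def by (intro exI[of _ "\<lambda>_. 0"]) auto
    fix y1 assume y1: "y1 \<in> \<Gamma>"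
    obtain d where d: "d > 0" "\<And>y x. y \<in> \<Gamma> \<Longrightarrow> dist y y1 < d \<Longrightarrow> x \<in> C \<Longrightarrow> norm (\<kappa> x y / \<kappa> x y1 - 1) < 1"
      using near[OF y1] by blast
    show "\<exists>T. openin (top_of_set \<Gamma>) T \<and> y1 \<in> T \<and> (\<forall>x\<in>T. \<forall>y\<in>T. (\<exists>L. Q x L) \<longrightarrow> (\<exists>L. Q y L))"
    proof (intro exI[of _ "\<Gamma> \<inter> ball y1 d"] conjI ballI impI)
      fix y y' assume y: "y \<in> \<Gamma> \<inter> ball y1 d" and y': "y' \<in> \<Gamma> \<inter> ball y1 d" and "\<exists>L. Q y L"
      then obtain L where L: "continuous_on C L" "L z0 = 0" "\<And>x. x \<in> C \<Longrightarrow> exp (L x) = \<kappa> x y" unfolding Q_def by blast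
      have yy: "norm (\<kappa> x y / \<kappa> x y1 - 1) < 1" "norm (\<kappa> x y' / \<kappa> x y1 - 1) < 1" if "x \<in> C" for x
        using y y' that d(2) by (auto simp: dist_commute)
      have "Q y' (\<lambda>x. L x - Ln (\<kappa> x y / \<kappa> x y1) + Ln (\<kappa> x y' / \<kappa> x y1))"
        unfolding Q_def
      proof (intro conjI ballI)
        show "continuous_on C (\<lambda>x. L x - Ln (\<kappa> x y / \<kappa> x y1) + Ln (\<kappa> x y' / \<kappa> x y1))"
          by (intro continuous_intros L slice) (use y y' y1 yy npR nz in auto)
        show "L z0 - Ln (\<kappa> z0 y / \<kappa> z0 y1) + Ln (\<kappa> z0 y' / \<kappa> z0 y1) = 0"
          using L z0 y y' y1 by simp
        fix x assume "x \<in> C"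
        then show "exp (L x - Ln (\<kappa> x y / \<kappa> x y1) + Ln (\<kappa> x y' / \<kappa> x y1)) = \<kappa> x y'"
          using L(3)[of x] nz[of x] y y' y1 by (simp add: exp_add exp_diff)
      qed
      then show "\<exists>L. Q y' L" by blast
    qed (use d y1 in auto)
  qed (use y c in auto)
  then obtain l' where l': "\<And>y. y \<in> \<Gamma> \<Longrightarrow> Q y (l' y)" by metis
  define l where "l x y = l' y x" for x y
  have l: "\<And>y. y \<in> \<Gamma> \<Longrightarrow> continuous_on C (\<lambda>x. l x y)" "\<And>y. y \<in> \<Gamma> \<Longrightarrow> l z0 y = 0"
     "\<And>x y. x \<in> C \<Longrightarrow> y \<in> \<Gamma> \<Longrightarrow> exp (l x y) = \<kappa> x y"
    using l' unfolding Q_def l_def by auto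
  have "continuous_on (C \<times> \<Gamma>) (\<lambda>(x,y). l x y)"
    unfolding continuous_on_eq_continuous_within
  proof
    fix q assume "q \<in> C \<times> \<Gamma>"
    then obtain x1 y1 where q: "q = (x1,y1)" "x1 \<in> C" "y1 \<in> \<Gamma>" by blast
    obtain d where d: "d > 0" "\<And>y x. y \<in> \<Gamma> \<Longrightarrow> dist y y1 < d \<Longrightarrow> x \<in> C \<Longrightarrow> norm (\<kappa> x y / \<kappa> x y1 - 1) < 1"
      using near[OF q(3)] by blast
    define T where "T = \<Gamma> \<inter> ball y1 d"
    have eq: "l x y = l x y1 + Ln (\<kappa> x y / \<kappa> x y1)" if "x \<in> C" "y \<in> T" for x y
    proof (rule exp_eq_imp_eq[OF C(2), where L = "\<lambda>x. l x y" and M = "\<lambda>x. l x y1 + Ln (\<kappa> x y / \<kappa> x y1)" and ?x0.0 = z0])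
      show "continuous_on C (\<lambda>x. l x y)" using l(1) that by (auto simp: T_def)
      show "continuous_on C (\<lambda>x. l x y1 + Ln (\<kappa> x y / \<kappa> x y1))"
        by (intro continuous_intros l slice) (use that q npR d nz in \<open>auto simp: T_def dist_commute\<close>)
      show "exp (l x y) = exp (l x y1 + Ln (\<kappa> x y / \<kappa> x y1))" if "x \<in> C" for x
        using l(3) nz \<open>y \<in> T\<close> q that by (simp add: T_def exp_add)
      show "l z0 y = l z0 y1 + Ln (\<kappa> z0 y / \<kappa> z0 y1)" using l(2) z0 that q by (auto simp: T_def)
    qed (use that z0 in auto)
    have s1: "continuous_on (C \<times> T) (\<lambda>q. l (fst q) y1)"
      by (rule continuous_on_compose2[OF l(1)[OF q(3)]]) (auto intro!: continuous_intros)
    have s2: "continuous_on (C \<times> T) (\<lambda>q. \<kappa> (fst q) y1)"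
      by (rule continuous_on_compose2[OF slice[OF q(3)]]) (auto intro!: continuous_intros)
    have s3: "continuous_on (C \<times> T) (\<lambda>q. \<kappa> (fst q) (snd q))"
      by (rule continuous_on_subset[OF cont[unfolded case_prod_unfold]]) (auto simp: T_def)
    have "continuous_on (C \<times> T) (\<lambda>q. l (fst q) y1 + Ln (\<kappa> (fst q) (snd q) / \<kappa> (fst q) y1))"
      by (intro continuous_intros s1 s2 s3) (use q npR d nz in \<open>auto simp: T_def dist_commute\<close>)
    then have "continuous_on (C \<times> T) (\<lambda>(x,y). l x y)"
      by (rule continuous_on_eq) (use eq in auto)
    then have "continuous (at q within C \<times> T) (\<lambda>(x,y). l x y)"
      using q d by (auto simp: continuous_on_eq_continuous_within T_def)
    moreover have "at q within C \<times> T = at q within C \<times> \<Gamma>"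
    proof (rule at_within_nhd[of _ "UNIV \<times> ball y1 d"])
      show "open (UNIV \<times> ball y1 d :: (complex \<times> complex) set)" by (intro open_Times) auto
    qed (use q d in \<open>auto simp: T_def\<close>)
    ultimately show "continuous (at q within C \<times> \<Gamma>) (\<lambda>(x,y). l x y)" by simp
  qed
  then show ?thesis using l by blast
qed

text \<open>\<open>\<Omega>\<close> is filled by compact connected sets through \<open>z0\<close>,
  each a path with a closed disc at its end. The normalised logarithms on two such sets agree on the
  overlap because the union of the two is again connected and contains \<open>z0\<close>.\<close>

lemma two_variable_log:
  fixes \<kappa> :: "complex \<Rightarrow> complex \<Rightarrow> complex"
  assumes \<Omega>: "open \<Omega>" "connected \<Omega>" and \<Gamma>: "connected \<Gamma>"
    and cont: "continuous_on (\<Omega> \<times> \<Gamma>) (\<lambda>(x,y). \<kappa> x y)" and nz: "\<And>x y. x \<in> \<Omega> \<Longrightarrow> y \<in> \<Gamma> \<Longrightarrow> \<kappa> x y \<noteq> 0"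
    and z0: "z0 \<in> \<Omega>" "\<And>y. y \<in> \<Gamma> \<Longrightarrow> \<kappa> z0 y = 1" and c: "c \<in> \<Gamma>" "\<And>x. x \<in> \<Omega> \<Longrightarrow> \<kappa> x c = 1"
  shows "\<exists>l. continuous_on (\<Omega> \<times> \<Gamma>) (\<lambda>(x,y). l x y) \<and> (\<forall>x\<in>\<Omega>. \<forall>y\<in>\<Gamma>. exp (l x y) = \<kappa> x y) \<and> (\<forall>y\<in>\<Gamma>. l z0 y = 0)"
proof -
  define G where "G C \<longleftrightarrow> compact C \<and> connected C \<and> z0 \<in> C \<and> C \<subseteq> \<Omega>" for C
  define Q where "Q C l \<longleftrightarrow> continuous_on (C \<times> \<Gamma>) (\<lambda>(x,y). l x y) \<and> (\<forall>x\<in>C. \<forall>y\<in>\<Gamma>. exp (l x y) = \<kappa> x y) \<and> (\<forall>y\<in>\<Gamma>. l z0 y = 0)" for C l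
  have "\<exists>l. Q C l" if "G C" for C
    unfolding Q_def
    by (rule two_variable_log_compact[OF _ _ \<Gamma> continuous_on_subset[OF cont] _ _ _ c(1)])
       (use that nz z0 c in \<open>auto simp: G_def\<close>)
  then obtain F where F: "\<And>C. G C \<Longrightarrow> Q C (F C)" by metis
  have slice: "continuous_on C (\<lambda>x. F C x y)" if "G C" "y \<in> \<Gamma>" for C y
  proof -
    have "continuous_on (C \<times> \<Gamma>) (\<lambda>(x,y). F C x y)" using F[OF that(1)] by (simp add: Q_def)
    then have "continuous_on C (\<lambda>x. case (x,y) of (x,y) \<Rightarrow> F C x y)"
      by (rule continuous_on_compose2) (use that in \<open>auto intro!: continuous_intros\<close>)
    then show ?thesis by simp
  qed
  have agree: "F C x y = F D x y" if "G C" "G D" "x \<in> C" "x \<in> D" "y \<in> \<Gamma>" for C D x y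
  proof -
    have "G (C \<union> D)" using that connected_Un[of C D] by (auto simp: G_def)
    have "F C' x y = F (C \<union> D) x y" if C': "C' = C \<or> C' = D" for C'
    proof (rule exp_eq_imp_eq[where S = C' and L = "\<lambda>x. F C' x y" and M = "\<lambda>x. F (C \<union> D) x y" and ?x0.0 = z0])
      show "connected C'" "z0 \<in> C'" "x \<in> C'" using C' \<open>G C\<close> \<open>G D\<close> \<open>x \<in> C\<close> \<open>x \<in> D\<close> by (auto simp: G_def)
      show "continuous_on C' (\<lambda>x. F C' x y)" using C' \<open>G C\<close> \<open>G D\<close> slice \<open>y \<in> \<Gamma>\<close> by blast
      show "continuous_on C' (\<lambda>x. F (C \<union> D) x y)"
        by (rule continuous_on_subset[OF slice[OF \<open>G (C \<union> D)\<close> \<open>y \<in> \<Gamma>\<close>]]) (use C' in auto)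
      show "exp (F C' x y) = exp (F (C \<union> D) x y)" if "x \<in> C'" for x
        using F[of C'] F[OF \<open>G (C \<union> D)\<close>] that C' \<open>G C\<close> \<open>G D\<close> \<open>y \<in> \<Gamma>\<close> by (auto simp: Q_def)
      show "F C' z0 y = F (C \<union> D) z0 y"
        using F[of C'] F[OF \<open>G (C \<union> D)\<close>] C' \<open>G C\<close> \<open>G D\<close> \<open>y \<in> \<Gamma>\<close> by (auto simp: Q_def)
    qed
    from this[of C] this[of D] show ?thesis by simp
  qed
  have nb: "\<exists>C e. G C \<and> e > 0 \<and> ball x e \<subseteq> C" if x\<Omega>: "x \<in> \<Omega>" for x
  proof -
    obtain e where e: "e > 0" "cball x e \<subseteq> \<Omega>" using \<Omega>(1) x\<Omega> open_contains_cball by blast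
    have "path_connected \<Omega>" using \<Omega> connected_open_path_connected by blast
    then obtain g where g: "path g" "path_image g \<subseteq> \<Omega>" "pathstart g = z0" "pathfinish g = x"
      using z0(1) x\<Omega> unfolding path_connected_def by blast
    have "x \<in> path_image g" "z0 \<in> path_image g" using g by (metis pathfinish_in_path_image pathstart_in_path_image)+
    then have "G (path_image g \<union> cball x e)"
      unfolding G_def using g e by (auto intro!: compact_Un compact_path_image connected_Un connected_path_image)
    then show ?thesis using e(1) by (intro exI[of _ "path_image g \<union> cball x e"] exI[of _ e]) auto
  qed
  then obtain N where N: "\<And>x. x \<in> \<Omega> \<Longrightarrow> G (N x)" "\<And>x. x \<in> \<Omega> \<Longrightarrow> \<exists>e>0. ball x e \<subseteq> N x" by metis
  define l where "l x y = F (N x) x y" for x y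
  have lC: "l x y = F C x y" if "G C" "x \<in> C" "y \<in> \<Gamma>" for C x y
  proof -
    have "x \<in> \<Omega>" using that by (auto simp: G_def)
    then have "x \<in> N x" using N(2)[of x] by (meson centre_in_ball subsetD)
    then show ?thesis unfolding l_def using agree[OF N(1)[OF \<open>x \<in> \<Omega>\<close>] that(1)] that by blast
  qed
  show ?thesis
  proof (intro exI[of _ l] conjI ballI)
    show "continuous_on (\<Omega> \<times> \<Gamma>) (\<lambda>(x,y). l x y)"
      unfolding continuous_on_eq_continuous_within
    proof
      fix q assume "q \<in> \<Omega> \<times> \<Gamma>"
      then obtain x1 y1 where q: "q = (x1,y1)" "x1 \<in> \<Omega>" "y1 \<in> \<Gamma>" by blast
      obtain C e where C: "G C" "e > 0" "ball x1 e \<subseteq> C" using nb[OF q(2)] by blast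
      have "continuous_on (C \<times> \<Gamma>) (\<lambda>(x,y). l x y)"
        by (rule continuous_on_eq[of _ "\<lambda>(x,y). F C x y"]) (use F[OF C(1)] lC[OF C(1)] in \<open>auto simp: Q_def\<close>)
      then have "continuous (at q within C \<times> \<Gamma>) (\<lambda>(x,y). l x y)"
        using q C by (auto simp: continuous_on_eq_continuous_within dest!: subsetD[of _ _ x1])
      moreover have "at q within C \<times> \<Gamma> = at q within \<Omega> \<times> \<Gamma>"
      proof (rule at_within_nhd[of _ "ball x1 e \<times> UNIV"])
        show "open (ball x1 e \<times> UNIV :: (complex \<times> complex) set)" by (intro open_Times) auto
        show "C \<times> \<Gamma> \<inter> ball x1 e \<times> UNIV - {q} = \<Omega> \<times> \<Gamma> \<inter> ball x1 e \<times> UNIV - {q}"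
          using C by (auto simp: G_def)
      qed (use q C in auto)
      ultimately show "continuous (at q within \<Omega> \<times> \<Gamma>) (\<lambda>(x,y). l x y)" by simp
    qed
    show "exp (l x y) = \<kappa> x y" if "x \<in> \<Omega>" "y \<in> \<Gamma>" for x y
    proof -
      have "x \<in> N x" using N(2)[OF that(1)] by (meson centre_in_ball subsetD)
      then show ?thesis unfolding l_def using F[OF N(1)[OF that(1)]] that by (auto simp: Q_def)
    qed
    show "l z0 y = 0" if "y \<in> \<Gamma>" for y
      unfolding l_def using F[OF N(1)[OF z0(1)]] that by (auto simp: Q_def)
  qed
qed

section \<open>Retractions of plane regions\<close>

text \<open>A Riemann map carries \<open>P\<close> to the unit disc. The preimage of a concentric
  disc of radius \<open>s < 1\<close> has a tame boundary however wild the boundary of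
  \<open>P\<close> is, and the retraction of the punctured disc onto its circle is transported
  back.\<close>

lemma simply_connected_puncture_retraction:
  fixes P :: "complex set"
  assumes P: "open P" "simply_connected P" and a: "a \<in> P" and C: "compact C" "C \<subseteq> P"
  obtains V \<rho> where "open V" "connected V" "a \<in> V" "C \<subseteq> V" "compact (closure V)" "closure V \<subseteq> P"
    "continuous_on (P - {a}) \<rho>" "\<And>x. x \<in> P - V \<Longrightarrow> \<rho> x = x" "\<And>x. x \<in> V - {a} \<Longrightarrow> \<rho> x \<in> closure V - V"
proof -
  have "P homeomorphic ball (0::complex) 1"
    using simply_connected_eq_homeomorphic_to_disc[OF P(1)] P(2) a by auto
  then obtain h k where hk: "homeomorphism P (ball (0::complex) 1) h k"
    unfolding homeomorphic_def by auto
  have hP: "h ` P = ball 0 1" "k ` ball 0 1 = P" "continuous_on P h" "continuous_on (ball 0 1) k"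
    and hk1: "\<And>x. x \<in> P \<Longrightarrow> k (h x) = x" and hk2: "\<And>y. y \<in> ball 0 1 \<Longrightarrow> h (k y) = y"
    using hk unfolding homeomorphism_def by auto
  have "compact (h ` (insert a C))"
    by (rule compact_continuous_image[OF continuous_on_subset[OF hP(3)]]) (use a C in auto)
  moreover have "h ` (insert a C) \<subseteq> ball 0 1" using hP a C by blast
  ultimately obtain s where s: "0 < s" "s < 1" "h ` (insert a C) \<subseteq> ball 0 s"
  proof -
    let ?K = "h ` (insert a C)"
    have K: "compact ?K" "?K \<noteq> {}" "?K \<subseteq> ball 0 1"
      using \<open>compact ?K\<close> \<open>?K \<subseteq> ball 0 1\<close> by blast+
    obtain m where m: "m \<in> ?K" "\<And>y. y \<in> ?K \<Longrightarrow> norm y \<le> norm m"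
      using continuous_attains_sup[OF K(1,2), of norm] by (auto intro!: continuous_intros)
    have "norm m < 1" using m(1) K(3) by auto
    then obtain s where s: "norm m < s" "s < 1" using dense by blast
    moreover have "0 < s" using s(1) norm_ge_zero[of m] by linarith
    moreover have "?K \<subseteq> ball 0 s"
    proof
      fix y assume "y \<in> ?K"
      then have "norm y \<le> norm m" by (rule m(2))
      then show "y \<in> ball 0 s" using s(1) by simp
    qed
    ultimately show ?thesis using that by blast
  qed
  define V where "V = k ` ball 0 s"
  have sub: "ball 0 s \<subseteq> ball 0 (1::real)" "cball (0::complex) s \<subseteq> ball 0 1" using s by auto
  have sub': "ball (0::complex) s \<subseteq> ball 0 1" using s by auto
  have injk: "inj_on k (ball 0 1)" using hk2 by (metis inj_on_inverseI)
  have memV: "x \<in> V \<longleftrightarrow> x \<in> P \<and> h x \<in> ball 0 s" for x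
    unfolding V_def using hk1 hk2 hP sub' by (metis (no_types, opaque_lifting) image_iff subsetD)
  have "open V"
  proof -
    have "V = P \<inter> h -` ball 0 s" by (intro set_eqI) (simp add: memV)
    then show ?thesis using continuous_open_preimage[OF hP(3) P(1), of "ball 0 s"] by simp
  qed
  have cV: "closure V = k ` cball 0 s"
  proof
    have "compact (k ` cball 0 s)"
      by (rule compact_continuous_image[OF continuous_on_subset[OF hP(4) sub(2)]]) auto
    moreover have "V \<subseteq> k ` cball 0 s" unfolding V_def by auto
    ultimately show "closure V \<subseteq> k ` cball 0 s" by (meson closure_minimal compact_imp_closed)
    have "k ` closure (ball 0 s) \<subseteq> closure V"
      by (rule image_closure_subset) (use s sub(2) closure_subset[of V] V_def in \<open>auto intro!: continuous_on_subset[OF hP(4)]\<close>)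
    then show "k ` cball 0 s \<subseteq> closure V" using s by simp
  qed
  have cVP: "closure V \<subseteq> P" unfolding cV using hP(2) sub(2) by blast
  have memcV: "x \<in> closure V \<longleftrightarrow> x \<in> P \<and> h x \<in> cball 0 s" for x
    unfolding cV using hk1 hk2 hP sub(2) by (metis (no_types, opaque_lifting) image_iff subsetD)
  obtain r where r: "retraction (- {h a}) (sphere 0 s) r"
    using sphere_retract_of_punctured_universe_gen[of "h a" 0 s] s(3) unfolding retract_of_def by auto
  have rc: "continuous_on (- {h a}) r" and rs: "\<And>y. y \<noteq> h a \<Longrightarrow> r y \<in> sphere 0 s" and rid: "\<And>y. y \<in> sphere 0 s \<Longrightarrow> r y = y"
    using r unfolding retraction_def by auto
  define \<rho> where "\<rho> x = (if x \<in> closure V then k (r (h x)) else x)" for x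
  have ha: "h x \<noteq> h a" if "x \<in> P - {a}" for x using that hk1 a by (metis DiffE insertI1)
  have bdV: "x \<in> closure V - V \<Longrightarrow> \<rho> x = x" for x
  proof -
    assume x: "x \<in> closure V - V"
    then have "h x \<in> sphere 0 s" "x \<in> P" using memcV[of x] memV[of x] by auto
    then show "\<rho> x = x" using x rid hk1 by (simp add: \<rho>_def)
  qed
  have "continuous_on ((closure V - {a}) \<union> (P - V)) \<rho>"
    unfolding \<rho>_def
  proof (rule continuous_on_cases_local)
    have un: "closure V - {a} \<union> (P - V) = P - {a}" using cVP closure_subset[of V] memV a s(3) by auto
    show "closedin (top_of_set (closure V - {a} \<union> (P - V))) (closure V - {a})"
      unfolding un closedin_closed using cVP by (intro exI[of _ "closure V"]) auto
    show "closedin (top_of_set (closure V - {a} \<union> (P - V))) (P - V)"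
      unfolding un closedin_closed using \<open>open V\<close> memV a s(3) by (intro exI[of _ "-V"]) auto
    have hc: "continuous_on (closure V - {a}) h" by (rule continuous_on_subset[OF hP(3)]) (use cVP in auto)
    have rh: "continuous_on (closure V - {a}) (\<lambda>x. r (h x))"
    proof (rule continuous_on_compose2[OF rc hc])
      have "h x \<in> - {h a}" if "x \<in> closure V - {a}" for x
        using ha[of x] that cVP by auto
      then show "h ` (closure V - {a}) \<subseteq> - {h a}" by (rule image_subsetI)
    qed
    show "continuous_on (closure V - {a}) (\<lambda>x. k (r (h x)))"
    proof (rule continuous_on_compose2[OF hP(4) rh])
      have "r (h x) \<in> ball 0 1" if "x \<in> closure V - {a}" for x
        using rs[of "h x"] ha[of x] that cVP s by auto
      then show "(\<lambda>x. r (h x)) ` (closure V - {a}) \<subseteq> ball 0 1" by (rule image_subsetI)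
    qed
    show "\<And>x. x \<in> closure V - {a} \<and> x \<notin> closure V \<or> x \<in> P - V \<and> x \<in> closure V \<Longrightarrow> k (r (h x)) = x"
      using bdV by (auto simp: \<rho>_def split: if_splits)
  qed auto
  moreover have "closure V - {a} \<union> (P - V) = P - {a}" using cVP closure_subset[of V] memV a s(3) by auto
  ultimately have "continuous_on (P - {a}) \<rho>" by simp
  moreover have "\<rho> x = x" if "x \<in> P - V" for x
    using bdV[of x] that by (cases "x \<in> closure V") (auto simp: \<rho>_def)
  moreover have "\<rho> x \<in> closure V - V" if x: "x \<in> V - {a}" for x
  proof -
    have xP: "x \<in> P - {a}" using x memV by auto
    have xc: "x \<in> closure V" using x closure_subset by auto
    have "r (h x) \<in> sphere 0 s" using rs ha[OF xP] by blast
    then have "r (h x) \<in> ball 0 1" "r (h x) \<in> cball 0 s" "r (h x) \<notin> ball 0 s" using s by auto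
    then have "k (r (h x)) \<in> P" "h (k (r (h x))) = r (h x)" using hP hk2 by auto
    then show ?thesis using memcV memV \<open>r (h x) \<in> cball 0 s\<close> \<open>r (h x) \<notin> ball 0 s\<close> xc by (simp add: \<rho>_def)
  qed
  moreover have "connected V"
    unfolding V_def by (rule connected_continuous_image[OF continuous_on_subset[OF hP(4) sub']]) auto
  moreover have "compact (closure V)" unfolding cV
    by (rule compact_continuous_image[OF continuous_on_subset[OF hP(4) sub(2)]]) auto
  moreover have "a \<in> V" using memV[of a] a s(3) by simp
  moreover have "C \<subseteq> V"
  proof
    fix x assume "x \<in> C"
    then show "x \<in> V" using memV[of x] s(3) C(2) by blast
  qed
  ultimately show ?thesis
    using that[of V \<rho>] \<open>open V\<close> cVP by blast
qed

lemma component_compl_simply_connected: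
  fixes Y :: "complex set"
  assumes "compact Y" "connected Y" "a \<notin> Y" "bounded (connected_component_set (-Y) a)"
  shows "simply_connected (connected_component_set (-Y) a)"
proof -
  let ?P = "connected_component_set (-Y) a"
  have "open ?P" using assms by (simp add: open_connected_component compact_imp_closed open_Compl)
  moreover have "connected (- ?P)"
    by (rule component_complement_connected[OF assms(2)]) (use assms(3) in \<open>auto simp: components_def\<close>)
  ultimately show ?thesis using assms(4) by (simp add: simply_connected_iff_simple)
qed

text \<open>The substitution \<open>z = 1 / (x - p)\<close> moves infinity to 0, so that the
  unbounded component with infinity added becomes a plane region to be punctured at 0. It is simply
  connected because a bounded component of its complement would split off a compact piece from the
  connected set \<open>-P\<close>.\<close>

lemma inversion_unbounded_component:
  fixes Y :: "complex set"
  assumes Y: "compact Y" "connected Y" "p \<in> Y" and P: "P \<in> components (-Y)" "\<not> bounded P"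
  defines "Q \<equiv> insert 0 {z. z \<noteq> 0 \<and> p + 1/z \<in> P}"
  shows "open Q" "simply_connected Q"
proof -
  have opP: "open P" using P Y by (meson compact_imp_closed open_Compl open_components)
  have pP: "p \<notin> P" using P Y by (metis ComplD in_components_subset subsetD)
  obtain r where r: "r > 0" "Y \<subseteq> ball p r" using Y(1) compact_imp_bounded bounded_subset_ballD by blast
  have far: "x \<in> P" if "x \<notin> ball p r" for x
  proof -
    have c: "connected (- ball p r)" by (rule connected_complement_bounded_convex) auto
    have "\<exists>y\<in>P. y \<notin> ball p r" using P(2) bounded_subset[OF bounded_ball] by blast
    then have "P \<inter> - ball p r \<noteq> {}" by blast
    then have "- ball p r \<subseteq> P" using components_maximal[OF P(1) c] r by blast
    then show ?thesis using that by blast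
  qed
  have near: "z \<in> Q" if "norm z < 1/r" for z
  proof (cases "z = 0")
    case False
    then have "r \<le> norm (1/z)" using that r(1) by (simp add: norm_divide field_simps)
    then have "p + 1/z \<notin> ball p r" by (simp add: dist_norm)
    then show ?thesis using far False by (simp add: Q_def)
  qed (simp add: Q_def)
  have eqQ: "Q = ball 0 (1/r) \<union> (- {0} \<inter> (\<lambda>z. p + 1/z) -` P)"
  proof (intro set_eqI iffI)
    fix z assume "z \<in> ball 0 (1/r) \<union> (- {0} \<inter> (\<lambda>z. p + 1/z) -` P)"
    then show "z \<in> Q" using near[of z] unfolding Q_def by auto
  qed (use r in \<open>auto simp: Q_def\<close>)
  have "open (- {0} \<inter> (\<lambda>z. p + 1/z) -` P)"
    by (rule continuous_open_preimage[OF _ _ opP]) (auto intro!: continuous_intros)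
  then show opQ: "open Q" unfolding eqQ by auto
  define \<phi> where "\<phi> x = 1 / (x - p)" for x :: complex
  have \<phi>: "\<phi> x \<noteq> 0" "p + 1 / \<phi> x = x" if "x \<noteq> p" for x using that by (auto simp: \<phi>_def)
  have QP: "Q - {0} = \<phi> ` P"
  proof
    show "\<phi> ` P \<subseteq> Q - {0}"
    proof
      fix z assume "z \<in> \<phi> ` P"
      then obtain x where x: "x \<in> P" "z = \<phi> x" by blast
      then have "x \<noteq> p" using pP by blast
      from \<phi>[OF this] x show "z \<in> Q - {0}" by (simp add: Q_def)
    qed
    show "Q - {0} \<subseteq> \<phi> ` P"
    proof
      fix z assume z: "z \<in> Q - {0}"
      then have "z = \<phi> (p + 1/z)" "p + 1/z \<in> P" by (auto simp: Q_def \<phi>_def)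
      then show "z \<in> \<phi> ` P" by blast
    qed
  qed
  have "connected (Q - {0})" unfolding QP
    by (rule connected_continuous_image) (use pP P in \<open>auto simp: \<phi>_def intro!: continuous_intros in_components_connected\<close>)
  moreover have "0 \<in> closure (Q - {0})"
  proof -
    have "0 \<in> closure (Q - {0}) \<longleftrightarrow> 0 islimpt Q" by (metis closure_approachable islimpt_approachable closure_def Diff_iff UnE Un_iff insertI1 islimpt_punctured mem_Collect_eq)
    moreover have "0 islimpt Q" by (rule interior_limit_point) (use opQ in \<open>auto simp: Q_def interior_open\<close>)
    ultimately show ?thesis by blast
  qed
  ultimately have "connected Q"
    using connected_intermediate_closure[of "Q - {0}" Q] closure_subset[of "Q - {0}"] by blast
  moreover have "\<not> bounded C" if C: "C \<in> components (-Q)" for C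
  proof
    assume bC: "bounded C"
    have clQ: "closed (-Q)" using opQ by auto
    have "closed C" using closed_components[OF clQ C] .
    then have "compact C" using bC compact_eq_bounded_closed by blast
    obtain s where s: "C \<subseteq> ball 0 s" using bC bounded_subset_ballD by blast
    \<comment> \<open>By Sura-Bura the compact component \<open>C\<close> lies in a compact,
      relatively open piece \<open>K\<close> of the complement. Its image \<open>K'\<close> is
      closed and open in \<open>-P\<close>, nonempty, and misses \<open>p\<close>, which corresponds
      to infinity in the \<open>z\<close>-plane.\<close>
    obtain K where K: "openin (top_of_set (-Q)) K" "compact K" "C \<subseteq> K" "K \<subseteq> ball 0 s"
      using Sura_Bura_clopen_subset[OF closed_imp_locally_compact[OF clQ] C \<open>compact C\<close> open_ball s] by blast
    have KQ: "K \<subseteq> - Q" using K(1) openin_imp_subset by blast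
    then have K0: "0 \<notin> K" by (auto simp: Q_def)
    obtain T where T: "open T" "K = -Q \<inter> T" using K(1) openin_open by blast
    define K' where "K' = (\<lambda>z. p + 1/z) ` K"
    have cK': "compact K'" unfolding K'_def
      by (rule compact_continuous_image) (use K0 K in \<open>auto intro!: continuous_intros\<close>)
    have K'P: "K' \<subseteq> - P" using KQ K0 by (auto simp: K'_def Q_def)
    have pK': "p \<notin> K'" by (auto simp: K'_def K0)
    have "connected (-P)" by (rule component_complement_connected[OF Y(2) P(1)])
    have "- P - K' = - P \<inter> ({p} \<union> {x. x \<noteq> p \<and> \<phi> x \<notin> T})"
    proof -
      have "x \<in> K' \<longleftrightarrow> \<phi> x \<in> T" if "x \<notin> P" "x \<noteq> p" for x
      proof -
        have "\<phi> x \<in> - Q" using that \<phi>[OF that(2)] by (auto simp: Q_def)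
        then have "\<phi> x \<in> K \<longleftrightarrow> \<phi> x \<in> T" using T(2) by blast
        moreover have "\<phi> x \<in> K \<longleftrightarrow> x \<in> K'"
        proof
          show "\<phi> x \<in> K \<Longrightarrow> x \<in> K'" unfolding K'_def using \<phi>(2)[OF that(2)] by (metis image_eqI)
          show "x \<in> K' \<Longrightarrow> \<phi> x \<in> K" unfolding K'_def \<phi>_def by auto
        qed
        ultimately show ?thesis by blast
      qed
      then show ?thesis using pK' by blast
    qed
    have clo: "closed (- P - K')"
      unfolding closed_sequential_limits
    proof (intro allI impI, elim conjE)
      fix X x assume X: "\<forall>n. X n \<in> - P - K'" "X \<longlonglongrightarrow> x"
      have xP: "x \<in> -P" using opP X closed_sequentially[of "-P" X x] by auto
      show "x \<in> - P - K'"
      proof (rule ccontr)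
        assume "x \<notin> - P - K'"
        then have xK: "x \<in> K'" using xP by blast
        then have xp: "x \<noteq> p" using pK' by blast
        have "\<phi> x \<in> T" using xK T(2) unfolding K'_def \<phi>_def by auto
        moreover have "isCont \<phi> x" unfolding \<phi>_def using xp by (intro continuous_intros) auto
        ultimately have "eventually (\<lambda>n. \<phi> (X n) \<in> T) sequentially"
          using T(1) isCont_tendsto_compose[OF _ X(2), of \<phi>] topological_tendstoD by blast
        moreover have "eventually (\<lambda>n. X n \<noteq> p) sequentially"
          using X(2) xp by (metis tendsto_imp_eventually_ne)
        ultimately have "eventually (\<lambda>n. False) sequentially"
        proof eventually_elim
          case (elim n)
          have "X n \<notin> P" using X(1) by blast
          then have "\<phi> (X n) \<in> - Q" using elim \<phi>[of "X n"] by (auto simp: Q_def)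
          then have "\<phi> (X n) \<in> K" using elim T(2) by blast
          then have "X n \<in> K'" unfolding K'_def using \<phi>(2)[of "X n"] elim by (metis image_eqI)
          then show False using X(1) by blast
        qed
        then show False by simp
      qed
    qed
    have "K \<noteq> {}" using K(3) in_components_nonempty[OF C] by blast
    then have "K' \<noteq> {}" by (simp add: K'_def)
    moreover have "p \<in> - P - K'" using pP pK' by blast
    ultimately have "K' \<inter> - P \<noteq> {}" "(- P - K') \<inter> - P \<noteq> {}" "- P \<subseteq> K' \<union> (- P - K')" "K' \<inter> (- P - K') \<inter> - P = {}"
      using K'P by blast+
    then show False
      using \<open>connected (-P)\<close> clo compact_imp_closed[OF cK'] unfolding connected_closed by blast
  qed
  ultimately show "simply_connected Q"
    using simply_connected_eq_unbounded_complement_components[OF opQ] by blast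
qed

text \<open>The complement of \<open>Y\<close> may have infinitely many components, but by
  compactness only finitely many bounded ones are not inside \<open>R\<close>. Each of these is
  punctured once, while the other bounded ones are absorbed by \<open>N\<close>. The unbounded one
  is treated through inversion, with infinity as its puncture.\<close>

lemma planar_neighbourhood:
  fixes Y R :: "complex set"
  assumes Y: "compact Y" "connected Y" "p \<in> Y" and R: "open R" "Y \<subseteq> R" "bounded R"
  obtains N A r V Vinf \<sigma> where
    "compact N" "N \<subseteq> R" "Y \<subseteq> interior N" "finite A" "A \<inter> N = {}"
    "\<And>a. a \<in> A \<Longrightarrow> bounded (connected_component_set (-Y) a)"
    "\<And>a b. a \<in> A \<Longrightarrow> b \<in> A \<Longrightarrow> a \<noteq> b \<Longrightarrow> b \<notin> connected_component_set (-Y) a"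
    "continuous_on (-A) r" "\<And>x. x \<in> N \<Longrightarrow> r x = x" "\<And>x. x \<notin> A \<Longrightarrow> r x \<in> N"
    "\<And>a. a \<in> A \<Longrightarrow> open (V a) \<and> connected (V a) \<and> a \<in> V a \<and> V a \<inter> A = {a}"
    "connected Vinf" "Vinf \<inter> A = {}" "- N = Vinf \<union> (\<Union>a\<in>A. V a)"
    "\<And>a x. a \<in> A \<Longrightarrow> x \<in> V a - {a} \<Longrightarrow> r x \<in> closure (V a)"
    "\<And>x. x \<in> Vinf \<Longrightarrow> r x \<in> closure Vinf"
    "\<sigma> > 0" "- ball p \<sigma> \<subseteq> Vinf" "N \<subseteq> ball p \<sigma>" "A \<subseteq> ball p \<sigma>"
proof -
  let ?c = "\<lambda>a. connected_component_set (-Y) a"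
  have opY: "open (-Y)" using Y by (simp add: compact_imp_closed open_Compl)
  obtain \<sigma> where \<sigma>: "\<sigma> > 0" "R \<subseteq> ball p \<sigma>" using R(3) bounded_subset_ballD by blast
  have opc: "open (?c a)" for a by (rule open_connected_component[OF opY])
  have frc: "closure P - P \<subseteq> Y" if "P \<in> components (-Y)" for P
  proof -
    have "open P" using that opY open_components by blast
    have "frontier P \<subseteq> frontier (-Y)" using that frontier_of_components_subset by blast
    also have "\<dots> \<subseteq> Y" using Y by (simp add: frontier_complement frontier_subset_closed compact_imp_closed)
    finally show ?thesis using \<open>open P\<close> by (simp add: frontier_def interior_open)
  qed
  have clPR: "closed (P - R)" if "P \<in> components (-Y)" for P
  proof -
    have "P - R = closure P - R" using frc[OF that] closure_subset[of P] R(2) by blast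
    then show ?thesis using R(1) by (simp add: closed_Diff)
  qed
  have cfar: "connected (- ball p \<sigma>)" by (rule connected_complement_bounded_convex) auto
  have farY: "- ball p \<sigma> \<subseteq> - Y" using \<sigma> R(2) by blast
  have "\<not> bounded (- ball p \<sigma>)"
    by (rule cobounded_imp_unbounded) (unfold double_complement, rule bounded_ball)
  then have "- ball p \<sigma> \<noteq> {}" using bounded_empty by metis
  then have "- Y \<noteq> {}" using farY by blast
  from exists_component_superset[OF farY this cfar]
  obtain P0 where P0: "P0 \<in> components (-Y)" "- ball p \<sigma> \<subseteq> P0" by (elim exE conjE)
  have unb: "\<not> bounded P0" using P0(2) \<open>\<not> bounded (- ball p \<sigma>)\<close> bounded_subset by blast
  have bdP: "P \<subseteq> ball p \<sigma>" "bounded P" if "P \<in> components (-Y)" "P \<noteq> P0" for P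
  proof -
    have "P \<inter> P0 = {}" using components_nonoverlap[OF that(1) P0(1)] that(2) by blast
    then show "P \<subseteq> ball p \<sigma>" using P0(2) by blast
    then show "bounded P" using bounded_subset bounded_ball by blast
  qed
  define \<P> where "\<P> = {P \<in> components (-Y). P \<noteq> P0 \<and> \<not> P \<subseteq> R}"
  have fin: "finite \<P>"
  proof -
    have "compact (cball p \<sigma> - R)" using R(1) by (simp add: compact_diff)
    moreover have "cball p \<sigma> - R \<subseteq> \<Union>(components (-Y))" using R(2) by (auto simp: Union_components)
    ultimately obtain D where D: "D \<subseteq> components (-Y)" "finite D" "cball p \<sigma> - R \<subseteq> \<Union>D"
      using compactE[of "cball p \<sigma> - R" "components (-Y)"] opY open_components by metis
    have "\<P> \<subseteq> D"
    proof
      fix P assume P: "P \<in> \<P>"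
      then obtain x where x: "x \<in> P" "x \<notin> R" by (auto simp: \<P>_def)
      then have "x \<in> cball p \<sigma> - R" using bdP[of P] P by (force simp: \<P>_def)
      then obtain P' where "P' \<in> D" "x \<in> P'" using D(3) by blast
      then have "P' = P" using x P D(1) components_nonoverlap[of P "-Y" P'] by (auto simp: \<P>_def)
      then show "P \<in> D" using \<open>P' \<in> D\<close> by simp
    qed
    then show ?thesis using D(2) finite_subset by blast
  qed
  define \<alpha> where "\<alpha> P = (SOME x. x \<in> P - R)" for P
  have \<alpha>: "\<alpha> P \<in> P - R" if "P \<in> \<P>" for P
    unfolding \<alpha>_def by (rule someI_ex) (use that in \<open>auto simp: \<P>_def\<close>)
  have c\<alpha>: "?c (\<alpha> P) = P" if PP: "P \<in> \<P>" for P
  proof -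
    obtain x where x: "x \<in> -Y" "P = ?c x" using PP by (auto simp: \<P>_def components_def)
    then have "\<alpha> P \<in> ?c x" using \<alpha>[OF PP] by simp
    then have "?c x = ?c (\<alpha> P)" by (simp add: connected_component_eq)
    then show ?thesis using x by simp
  qed
  define A where "A = \<alpha> ` \<P>"
  have finA: "finite A" using fin by (simp add: A_def)
  have cA: "?c a \<in> \<P>" if "a \<in> A" for a using that c\<alpha> by (auto simp: A_def)
  have aR: "a \<notin> R" "a \<in> ?c a" "a \<notin> Y" if "a \<in> A" for a
    using that \<alpha> c\<alpha> R(2) by (auto simp: A_def)
  have cinj: "a = b" if "a \<in> A" "b \<in> A" "?c a \<inter> ?c b \<noteq> {}" for a b
  proof -
    have "?c a = ?c b" using cA that components_nonoverlap[of "?c a" "-Y" "?c b"] by (auto simp: \<P>_def)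
    moreover have "a = \<alpha> (?c a)" "b = \<alpha> (?c b)" using that(1,2) c\<alpha> by (auto simp: A_def)
    ultimately show ?thesis by metis
  qed
  have cP: "?c a \<in> components (-Y)" "?c a \<noteq> P0" "bounded (?c a)" "?c a \<inter> P0 = {}" if "a \<in> A" for a
  proof -
    show 1: "?c a \<in> components (-Y)" "?c a \<noteq> P0" using cA[OF that] by (auto simp: \<P>_def)
    show "bounded (?c a)" using bdP 1 by blast
    show "?c a \<inter> P0 = {}" using components_nonoverlap[OF 1(1) P0(1)] 1(2) by blast
  qed
  define G where "G a V \<rho> \<longleftrightarrow> open V \<and> connected V \<and> a \<in> V \<and> ?c a - R \<subseteq> V \<and> closure V \<subseteq> ?c a \<and>
    continuous_on (?c a - {a}) \<rho> \<and> (\<forall>x. x \<in> ?c a - V \<longrightarrow> \<rho> x = x) \<and> (\<forall>x. x \<in> V - {a} \<longrightarrow> \<rho> x \<in> closure V - V)" for a V \<rho>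
  have "\<exists>V \<rho>. G a V \<rho>"
    if aA: "a \<in> A" for a
  proof -
    have "compact (?c a - R)"
      using clPR[OF cP(1)[OF aA]] cP(3)[OF aA] bounded_subset[of "?c a" "?c a - R"] by (auto simp: compact_eq_bounded_closed)
    with simply_connected_puncture_retraction[OF opc component_compl_simply_connected[OF Y(1,2) aR(3)[OF aA] cP(3)[OF aA]] aR(2)[OF aA], of "?c a - R"]
    show ?thesis unfolding G_def by (metis Diff_subset)
  qed
  then obtain V \<rho> where "\<And>a. a \<in> A \<Longrightarrow> G a (V a) (\<rho> a)" by metis
  then have V: "\<And>a. a \<in> A \<Longrightarrow> open (V a)" "\<And>a. a \<in> A \<Longrightarrow> connected (V a)" "\<And>a. a \<in> A \<Longrightarrow> a \<in> V a"
     "\<And>a. a \<in> A \<Longrightarrow> ?c a - R \<subseteq> V a" "\<And>a. a \<in> A \<Longrightarrow> closure (V a) \<subseteq> ?c a"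
     and \<rho>: "\<And>a. a \<in> A \<Longrightarrow> continuous_on (?c a - {a}) (\<rho> a)" "\<And>a x. a \<in> A \<Longrightarrow> x \<in> ?c a - V a \<Longrightarrow> \<rho> a x = x"
       "\<And>a x. a \<in> A \<Longrightarrow> x \<in> V a - {a} \<Longrightarrow> \<rho> a x \<in> closure (V a) - V a"
    unfolding G_def by blast+
  have Vc: "V a \<subseteq> ?c a" if "a \<in> A" for a using V(5)[OF that] closure_subset by blast
  define \<phi> where "\<phi> x = 1 / (x - p)" for x :: complex
  have \<phi>: "\<phi> x \<noteq> 0" "p + 1 / \<phi> x = x" if "x \<noteq> p" for x using that by (auto simp: \<phi>_def)
  have \<phi>2: "\<phi> (p + 1/z) = z" "p + 1/z \<noteq> p" if "z \<noteq> 0" for z using that by (auto simp: \<phi>_def)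
  have pP0: "p \<notin> P0" using P0(1) Y(3) in_components_subset by fastforce
  define Q where "Q = insert 0 {z. z \<noteq> 0 \<and> p + 1/z \<in> P0}"
  have Q: "open Q" "simply_connected Q"
    using inversion_unbounded_component[OF Y P0(1) unb] by (auto simp: Q_def)
  have \<phi>Q: "\<phi> x \<in> Q - {0}" if "x \<in> P0" for x
  proof -
    have "x \<noteq> p" using that pP0 by blast
    then show ?thesis using that \<phi> by (simp add: Q_def)
  qed
  \<comment> \<open>Infinity and all of \<open>P0 - R\<close> in the inverted coordinate. The disc
    \<open>V0\<close> has to cover this set, which keeps \<open>N\<close> inside \<open>R\<close> on
    the unbounded side.\<close>
  define C where "C = insert 0 {z. z \<noteq> 0 \<and> p + 1/z \<in> P0 - R}"
  have "compact C"
  proof -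
    have "open (- (P0 - R))" using clPR[OF P0(1)] by (rule open_Compl)
    then have "open (- {0} \<inter> (\<lambda>z. p + 1/z) -` (- (P0 - R)))"
      by (rule continuous_open_preimage[rotated 2]) (auto intro!: continuous_intros)
    moreover have "- {0} \<inter> (\<lambda>z. p + 1/z) -` (- (P0 - R)) = - C" by (auto simp: C_def)
    ultimately have "closed C" by (simp add: closed_def)
    moreover have "bounded C"
    proof -
      obtain e where e: "e > 0" "ball p e \<subseteq> R" using R(1,2) Y(3) open_contains_ball by blast
      have "norm z \<le> 1/e" if "z \<in> C" for z
      proof (cases "z = 0")
        case False
        then have "p + 1/z \<notin> ball p e" using that e(2) by (auto simp: C_def)
        then have "e \<le> norm (1/z)" by (simp add: dist_norm)
        then show ?thesis using False e(1) by (simp add: norm_divide field_simps)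
      qed (use e(1) in simp)
      then show ?thesis unfolding bounded_iff by blast
    qed
    ultimately show ?thesis by (simp add: compact_eq_bounded_closed)
  qed
  moreover have "C \<subseteq> Q" by (auto simp: C_def Q_def)
  moreover have "0 \<in> Q" by (simp add: Q_def)
  ultimately obtain V0 \<rho>0 where V0: "open V0" "connected V0" "0 \<in> V0" "C \<subseteq> V0" "compact (closure V0)" "closure V0 \<subseteq> Q"
    and \<rho>0: "continuous_on (Q - {0}) \<rho>0" "\<And>x. x \<in> Q - V0 \<Longrightarrow> \<rho>0 x = x" "\<And>x. x \<in> V0 - {0} \<Longrightarrow> \<rho>0 x \<in> closure V0 - V0"
    using simply_connected_puncture_retraction[OF Q] by metis
  define Vinf where "Vinf = (\<lambda>z. p + 1/z) ` (V0 - {0})"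
  have memVi: "x \<in> Vinf \<longleftrightarrow> x \<noteq> p \<and> \<phi> x \<in> V0" for x
  proof
    show "x \<in> Vinf \<Longrightarrow> x \<noteq> p \<and> \<phi> x \<in> V0" using \<phi>2 by (auto simp: Vinf_def)
    show "x \<noteq> p \<and> \<phi> x \<in> V0 \<Longrightarrow> x \<in> Vinf" unfolding Vinf_def using \<phi>[of x] by (intro image_eqI[of _ _ "\<phi> x"]) auto
  qed
  define F where "F = {x. x \<noteq> p \<and> \<phi> x \<in> closure V0}"
  have contphi: "continuous_on (- {p}) \<phi>" unfolding \<phi>_def by (intro continuous_intros) auto
  have clF: "closed F"
  proof -
    obtain b where b: "b > 0" "closure V0 \<subseteq> ball 0 b" using V0(5) compact_imp_bounded bounded_subset_ballD by blast
    have "- F = ball p (1/b) \<union> (- {p} \<inter> \<phi> -` (- closure V0))"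
    proof (intro set_eqI iffI)
      fix x assume "x \<in> ball p (1/b) \<union> (- {p} \<inter> \<phi> -` (- closure V0))"
      moreover have "\<phi> x \<notin> closure V0" if "x \<in> ball p (1/b)" "x \<noteq> p"
      proof -
        have "b \<le> norm (\<phi> x)" using that b(1) by (simp add: \<phi>_def norm_divide dist_norm norm_minus_commute field_simps)
        then show ?thesis using b(2) by auto
      qed
      ultimately show "x \<in> - F" by (auto simp: F_def)
    qed (use b(1) in \<open>auto simp: F_def\<close>)
    moreover have "open (- {p} \<inter> \<phi> -` (- closure V0))"
      by (rule continuous_open_preimage[OF contphi]) auto
    ultimately have "open (-F)" by auto
    then show ?thesis by (simp add: closed_def)
  qed
  have FP0: "F \<subseteq> P0"
  proof
    fix x assume x: "x \<in> F"
    then have "\<phi> x \<in> Q" "\<phi> x \<noteq> 0" "x \<noteq> p" using V0(6) \<phi> by (auto simp: F_def)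
    then show "x \<in> P0" using \<phi>(2)[of x] by (simp add: Q_def)
  qed
  have VF: "Vinf \<subseteq> F" using memVi closure_subset[of V0] by (auto simp: F_def)
  have opVi: "open Vinf"
  proof -
    have "Vinf = - {p} \<inter> \<phi> -` V0" using memVi by auto
    then show ?thesis using continuous_open_preimage[OF contphi _ V0(1)] by auto
  qed
  define N where "N = - (Vinf \<union> (\<Union>a\<in>A. V a))"
  have clN: "closed N" unfolding N_def closed_def using opVi V(1) by auto
  have NR: "N \<subseteq> R"
  proof
    fix x assume x: "x \<in> N"
    show "x \<in> R"
    proof (rule ccontr)
      assume xR: "x \<notin> R"
      then have "x \<in> - Y" using R(2) by blast
      then obtain P where P: "P \<in> components (-Y)" "x \<in> P" by (metis UnionE Union_components)
      show False
      proof (cases "P = P0")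
        case True
        then have "x \<noteq> p" using P(2) pP0 by blast
        then have "\<phi> x \<in> C" using \<phi>[of x] P(2) xR True by (simp add: C_def)
        then show False using x V0(4) memVi \<open>x \<noteq> p\<close> by (auto simp: N_def)
      next
        case False
        then have "P \<in> \<P>" using P xR by (auto simp: \<P>_def)
        then have "\<alpha> P \<in> A" "?c (\<alpha> P) = P" using c\<alpha> by (auto simp: A_def)
        then have "x \<in> V (\<alpha> P)" using V(4)[of "\<alpha> P"] P(2) xR by auto
        then show False using x \<open>\<alpha> P \<in> A\<close> by (auto simp: N_def)
      qed
    qed
  qed
  then have compN: "compact N" using clN R(3) bounded_subset by (auto simp: compact_eq_bounded_closed)
  \<comment> \<open>An open set inside \<open>N\<close>, on which \<open>r\<close> is the identity.
    Together with \<open>P0\<close> and the punctured components it is an open cover of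
    \<open>-A\<close>, so continuity of \<open>r\<close> can be checked on each piece.\<close>
  define Ob where "Ob = - (F \<union> (\<Union>a\<in>A. closure (V a)))"
  have opO: "open Ob" unfolding Ob_def using clF finA by (intro open_Compl closed_Un closed_UN) auto
  have ON: "Ob \<subseteq> N" using VF closure_subset by (fastforce simp: Ob_def N_def)
  have YO: "Y \<subseteq> Ob"
  proof -
    have "P0 \<subseteq> - Y" using P0(1) in_components_subset by blast
    moreover have "?c a \<subseteq> - Y" for a by (rule connected_component_subset)
    ultimately show ?thesis using FP0 V(5) by (fastforce simp: Ob_def)
  qed
  define r where "r x = (if x \<in> P0 then p + 1 / \<rho>0 (\<phi> x) else if \<exists>a\<in>A. x \<in> ?c a then \<rho> (THE a. a \<in> A \<and> x \<in> ?c a) x else x)" for x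
  have rP0: "r x = p + 1 / \<rho>0 (\<phi> x)" if "x \<in> P0" for x using that by (simp add: r_def)
  have rc: "r x = \<rho> a x" if "a \<in> A" "x \<in> ?c a" for a x
  proof -
    have "(THE a. a \<in> A \<and> x \<in> ?c a) = a" using that cinj by (intro the_equality) blast+
    moreover have "x \<notin> P0" using cP(4)[OF that(1)] that(2) by blast
    ultimately show ?thesis using that by (auto simp: r_def)
  qed
  have rid: "r x = x" if x: "x \<in> N" for x
  proof (cases "x \<in> P0")
    case True
    then have "x \<noteq> p" using pP0 by blast
    then have "\<phi> x \<in> Q - V0" using \<phi>Q[OF True] x memVi by (auto simp: N_def)
    then show ?thesis using \<rho>0(2) rP0[OF True] \<phi>(2)[OF \<open>x \<noteq> p\<close>] by simp
  next
    case False
    show ?thesis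
    proof (cases "\<exists>a\<in>A. x \<in> ?c a")
      case True
      then obtain a where a: "a \<in> A" "x \<in> ?c a" by blast
      then show ?thesis using rc[OF a] \<rho>(2)[OF a(1), of x] x by (auto simp: N_def)
    qed (use False in \<open>simp add: r_def\<close>)
  qed
  have \<rho>0nz: "\<rho>0 z \<noteq> 0" if "z \<in> Q - {0}" for z
    using \<rho>0(2)[of z] \<rho>0(3)[of z] V0(3) that by (cases "z \<in> V0") auto
  have "continuous_on P0 r"
  proof (rule continuous_on_eq)
    have "\<phi> ` P0 \<subseteq> Q - {0}" using \<phi>Q by (rule image_subsetI)
    moreover have "P0 \<subseteq> - {p}" using pP0 by auto
    ultimately have "continuous_on P0 (\<lambda>x. \<rho>0 (\<phi> x))"
      by (intro continuous_on_compose2[OF \<rho>0(1) continuous_on_subset[OF contphi]])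
    moreover have "\<rho>0 (\<phi> x) \<noteq> 0" if "x \<in> P0" for x using \<rho>0nz[OF \<phi>Q[OF that]] .
    ultimately show "continuous_on P0 (\<lambda>x. p + 1 / \<rho>0 (\<phi> x))"
      by (auto intro!: continuous_on_add continuous_on_divide)
  qed (simp add: rP0)
  moreover have "continuous_on Ob r"
    by (rule continuous_on_eq[of _ "\<lambda>x. x"]) (use rid ON in \<open>auto intro!: continuous_intros\<close>)
  moreover have "continuous_on (?c a - {a}) r" if "a \<in> A" for a
    by (rule continuous_on_eq[OF \<rho>(1)[OF that]]) (use rc[OF that] in auto)
  ultimately have "continuous_on (\<Union>(insert P0 (insert Ob ((\<lambda>a. ?c a - {a}) ` A)))) r"
    using opO P0(1) opY open_components opc by (intro continuous_on_open_Union) (auto intro!: open_Diff)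
  moreover have "- A \<subseteq> \<Union>(insert P0 (insert Ob ((\<lambda>a. ?c a - {a}) ` A)))"
  proof
    fix x assume "x \<in> - A"
    then show "x \<in> \<Union>(insert P0 (insert Ob ((\<lambda>a. ?c a - {a}) ` A)))"
      using FP0 V(5) by (cases "x \<in> Ob") (auto simp: Ob_def)
  qed
  ultimately have rcont: "continuous_on (-A) r" by (rule continuous_on_subset)
  have rV: "r x \<in> closure (V a) - V a" if "a \<in> A" "x \<in> V a - {a}" for a x
    using \<rho>(3)[OF that] rc[OF that(1), of x] Vc[OF that(1)] that(2) by auto
  have disj: "V a \<inter> V b = {}" if "a \<in> A" "b \<in> A" "a \<noteq> b" for a b
    using cinj[OF that(1,2)] that Vc by blast
  have ViP: "Vinf \<subseteq> P0" using VF FP0 by blast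
  have cN: "x \<in> N" if "x \<in> ?c a" "a \<in> A" "x \<notin> V a" for x a
    using that cinj[OF that(2)] Vc ViP cP(4)[OF that(2)] by (auto simp: N_def)
  have rVi: "r x \<in> N \<and> r x \<in> closure Vinf" if x: "x \<in> Vinf" for x
  proof -
    define w where "w = \<rho>0 (\<phi> x)"
    have xp: "x \<noteq> p" "\<phi> x \<in> V0 - {0}" using x memVi \<phi> by auto
    have w: "w \<in> closure V0 - V0" unfolding w_def using \<rho>0(3) xp by blast
    then have w0: "w \<noteq> 0" using V0(3) by blast
    have rx: "r x = p + 1/w" using rP0[of x] x ViP by (auto simp: w_def)
    have "w \<in> Q" using w V0(6) by blast
    then have "p + 1/w \<in> P0" using w0 by (simp add: Q_def)
    moreover have "p + 1/w \<notin> Vinf" using memVi \<phi>2[OF w0] w by auto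
    ultimately have "p + 1/w \<in> N" using cP(4) Vc by (auto simp: N_def)
    moreover have "p + 1/w \<in> closure Vinf"
    proof -
      have "w \<in> closure (V0 - {0})"
      proof -
        have "w \<in> closure (V0 \<inter> - {0})"
          using open_Int_closure_subset[of "- {0}" V0] w w0 by (auto simp: Int_commute)
        then show ?thesis by (simp add: Diff_eq)
      qed
      then obtain X where X: "\<And>n. X n \<in> V0 - {0}" "X \<longlonglongrightarrow> w" unfolding closure_sequential by blast
      have "(\<lambda>n. p + 1 / X n) \<longlonglongrightarrow> p + 1/w" by (intro tendsto_intros X w0)
      moreover have "p + 1 / X n \<in> Vinf" for n unfolding Vinf_def using X by blast
      ultimately show ?thesis unfolding closure_sequential by (intro exI[of _ "\<lambda>n. p + 1 / X n"]) auto
    qed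
    ultimately show ?thesis using rx by simp
  qed
  have "connected (V0 - {0})" by (rule connected_open_delete[OF V0(1,2)]) simp
  then have conVi: "connected Vinf" unfolding Vinf_def
    by (rule connected_continuous_image[rotated]) (auto intro!: continuous_intros)
  have rN: "r x \<in> N" if "x \<notin> A" for x
  proof (cases "x \<in> N")
    case False
    then consider "x \<in> Vinf" | a where "a \<in> A" "x \<in> V a" by (auto simp: N_def)
    then show ?thesis
    proof cases
      case 2
      then have "r x \<in> closure (V a) - V a" using rV that by blast
      then show ?thesis using cN[of "r x" a] V(5)[OF 2(1)] 2(1) by blast
    qed (use rVi in blast)
  qed (use rid in simp)
  have VA: "V a \<inter> A = {a}" if "a \<in> A" for a
    using V(3) disj that by blast
  have AVi: "Vinf \<inter> A = {}" using ViP cP(4) aR(2) by blast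
  have far: "- ball p \<sigma> \<subseteq> Vinf"
  proof
    fix x assume x: "x \<in> - ball p \<sigma>"
    then have "x \<noteq> p" "x \<notin> R" "x \<in> P0" using \<sigma> P0(2) by auto
    then have "\<phi> x \<in> C" using \<phi>[of x] by (simp add: C_def)
    then show "x \<in> Vinf" using memVi V0(4) \<open>x \<noteq> p\<close> by blast
  qed
  show ?thesis
  proof (rule that[of N A r V Vinf \<sigma>])
    show "Y \<subseteq> interior N" using YO ON opO interior_maximal by blast
    show "A \<inter> N = {}" using V(3) by (auto simp: N_def)
    show "b \<notin> ?c a" if "a \<in> A" "b \<in> A" "a \<noteq> b" for a b using cinj[OF that(1,2)] that aR(2)[OF that(2)] by blast
    show "- N = Vinf \<union> (\<Union>a\<in>A. V a)" by (auto simp: N_def)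
    show "N \<subseteq> ball p \<sigma>" using NR \<sigma> by blast
    show "A \<subseteq> ball p \<sigma>"
    proof
      fix a assume "a \<in> A"
      then show "a \<in> ball p \<sigma>" using bdP(1)[OF cP(1,2)] aR(2) by blast
    qed
    show "compact N" "N \<subseteq> R" "finite A" "continuous_on (-A) r" "connected Vinf" "Vinf \<inter> A = {}"
      "\<sigma> > 0" "- ball p \<sigma> \<subseteq> Vinf" by fact+
    show "bounded (?c a)" if "a \<in> A" for a using cP(3)[OF that] .
    show "r x = x" if "x \<in> N" for x using rid[OF that] .
    show "r x \<in> N" if "x \<notin> A" for x using rN[OF that] .
    show "open (V a) \<and> connected (V a) \<and> a \<in> V a \<and> V a \<inter> A = {a}" if "a \<in> A" for a
      using V(1,2,3)[OF that] VA[OF that] by (intro conjI)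
    show "r x \<in> closure (V a)" if "a \<in> A" "x \<in> V a - {a}" for a x using rV[OF that] by (rule DiffD1)
    show "r x \<in> closure Vinf" if "x \<in> Vinf" for x using rVi[OF that] by (rule conjunct2)
  qed
qed

section \<open>Full solutions, stable sets and uniform attraction to the fixed point\<close>

lemma Inv_backward_forward:
  assumes B: "B \<subseteq> K" "\<And>y. y \<in> B \<Longrightarrow> \<exists>z\<in>B. f z = y" and x: "x \<in> B" "\<And>n. (f ^^ n) x \<in> K"
  shows "x \<in> Inv f K"
proof -
  obtain g where g: "\<And>y. y \<in> B \<Longrightarrow> g y \<in> B \<and> f (g y) = y" using B(2) by metis
  have gn: "(g ^^ n) x \<in> B" for n by (induction n) (use g x in auto)
  define s where "s i = (if i \<ge> 0 then (f ^^ nat i) x else (g ^^ nat (- i)) x)" for i :: int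
  have "s i \<in> K \<and> f (s i) = s (i + 1)" for i
  proof (cases "i \<ge> 0")
    case True
    then have "nat (i + 1) = Suc (nat i)" by simp
    then show ?thesis using True x by (simp add: s_def)
  next
    case False
    then obtain m where "nat (- i) = Suc m" by (cases "nat (- i)") auto
    then have m: "i = - int (Suc m)" using False by linarith
    have "f ((g ^^ Suc m) x) = (g ^^ m) x" using g[OF gn[of m]] by simp
    moreover have "s (i + 1) = (g ^^ m) x" by (cases "m = 0") (auto simp: s_def m)
    moreover have "s i = (g ^^ Suc m) x" using False by (simp add: s_def m nat_add_distrib)
    ultimately show ?thesis using gn[of "Suc m"] B(1) by auto
  qed
  moreover have "s 0 = x" by (simp add: s_def)
  ultimately show ?thesis unfolding Inv_def using x B(1) by auto
qed

lemma Inv_mono: "A \<subseteq> B \<Longrightarrow> Inv f A \<subseteq> Inv f B"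
  unfolding Inv_def by blast

text \<open>Isolation therefore excludes periodic orbits other than \<open>p\<close>; this is what
  later leaves \<open>p\<close> as the only zero of the corrected displacement that comes from
  \<open>f\<close> itself.\<close>

lemma Inv_periodic:
  assumes "n \<ge> 1" "\<And>i. i < n \<Longrightarrow> (f ^^ i) x \<in> K" "(f ^^ n) x = x"
  shows "x \<in> Inv f K"
proof -
  let ?B = "(\<lambda>i. (f ^^ i) x) ` {..<n}"
  have per: "(f ^^ i) x \<in> ?B" for i
  proof -
    have "(f ^^ i) x = (f ^^ (i mod n)) x"
      using assms(3) by (metis funpow_mod_eq)
    then show ?thesis using assms(1) by auto
  qed
  show ?thesis
  proof (rule Inv_backward_forward[of ?B])
    show "?B \<subseteq> K" using assms(2) by auto
    show "x \<in> ?B" using per[of 0] by simp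
    show "(f ^^ m) x \<in> K" for m using per[of m] assms(2) by auto
    show "\<exists>z\<in>?B. f z = y" if "y \<in> ?B" for y
    proof -
      obtain i where i: "i < n" "y = (f ^^ i) x" using \<open>y \<in> ?B\<close> by auto
      have "(f ^^ (i + n)) x = (f ^^ i) x" using assms(3) by (simp add: funpow_add)
      moreover have "(f ^^ (i + n)) x = f ((f ^^ (i + n - 1)) x)"
        using assms(1) by (cases "i + n") auto
      ultimately show ?thesis using per[of "i + n - 1"] i by auto
    qed
  qed
qed

lemma continuous_on_funpow:
  fixes f :: "'a::topological_space \<Rightarrow> 'a"
  assumes "continuous_on S f" "\<And>i x. i < n \<Longrightarrow> x \<in> T \<Longrightarrow> (f ^^ i) x \<in> S"
  shows "continuous_on T (f ^^ n)"
  using assms(2)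
proof (induction n)
  case (Suc n)
  have "continuous_on T (f ^^ n)" by (rule Suc.IH) (use Suc.prems in auto)
  moreover have "(f ^^ n) ` T \<subseteq> S" using Suc.prems by auto
  ultimately show ?case by (auto intro: continuous_on_compose2[OF assms(1)])
qed auto

lemma stable_set_forward:
  assumes "x \<in> {x \<in> K. \<forall>n. (f ^^ n) x \<in> K}"
  shows "f x \<in> {x \<in> K. \<forall>n. (f ^^ n) x \<in> K}"
proof -
  have 1: "(f ^^ n) (f x) \<in> K" for n
  proof -
    have "(f ^^ n) (f x) = (f ^^ Suc n) x" by (simp add: funpow_swap1)
    then show ?thesis using assms by (simp del: funpow.simps)
  qed
  show ?thesis using 1 1[of 0] by simp
qed

lemma compact_stable_set:
  fixes f :: "complex \<Rightarrow> complex"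
  assumes K: "compact K" "continuous_on K f"
  shows "compact {x \<in> K. \<forall>n. (f ^^ n) x \<in> K}"
proof -
  have cl: "closed {x \<in> K. \<forall>n\<le>m. (f ^^ n) x \<in> K}" for m
  proof (induction m)
    case (Suc m)
    have "{x \<in> K. \<forall>n\<le>Suc m. (f ^^ n) x \<in> K} = {x \<in> K. \<forall>n\<le>m. (f ^^ n) x \<in> K} \<inter> (f ^^ Suc m) -` K"
      by (auto simp: le_Suc_eq)
    moreover have "closed ({x \<in> K. \<forall>n\<le>m. (f ^^ n) x \<in> K} \<inter> (f ^^ Suc m) -` K)"
      by (rule continuous_closed_preimage[OF continuous_on_funpow[OF K(2)]]) (use Suc K in \<open>auto simp: compact_imp_closed\<close>)
    ultimately show ?case by simp
  qed (use K in \<open>auto simp: compact_imp_closed\<close>)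
  have "{x \<in> K. \<forall>n. (f ^^ n) x \<in> K} = K \<inter> (\<Inter>m. {x \<in> K. \<forall>n\<le>m. (f ^^ n) x \<in> K})" by auto
  moreover have "closed (\<Inter>m. {x \<in> K. \<forall>n\<le>m. (f ^^ n) x \<in> K})" using cl by (intro closed_INT) auto
  ultimately show ?thesis using K(1) by (simp add: compact_Int_closed)
qed

text \<open>The images \<open>D n\<close> of the stable set decrease, and compactness of the fibres
  gives each point of their intersection a preimage in the intersection. So these points have full
  solutions in \<open>K\<close>, and only \<open>p\<close> can occur. Nestedness of the compact sets
  \<open>D n\<close> makes the attraction uniform.\<close>

lemma stable_set_attracted:
  fixes f :: "complex \<Rightarrow> complex"
  assumes K: "compact K" "continuous_on K f" "Inv f K \<subseteq> {p}"
  defines "\<Lambda> \<equiv> {x \<in> K. \<forall>n. (f ^^ n) x \<in> K}"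
  assumes "e > 0"
  shows "\<exists>k. \<forall>j\<ge>k. \<forall>x\<in>\<Lambda>. dist ((f ^^ j) x) p < e"
proof -
  have fL: "f x \<in> \<Lambda>" if "x \<in> \<Lambda>" for x
    using stable_set_forward[of x K f] that unfolding \<Lambda>_def by blast
  have fnL: "(f ^^ n) x \<in> \<Lambda>" if "x \<in> \<Lambda>" for x n by (induction n) (use that fL in auto)
  have cn: "continuous_on \<Lambda> (f ^^ n)" for n
    by (rule continuous_on_funpow[OF K(2)]) (auto simp: \<Lambda>_def)
  have clL: "compact \<Lambda>" unfolding \<Lambda>_def by (rule compact_stable_set[OF K(1,2)])
  define D where "D n = (f ^^ n) ` \<Lambda>" for n
  have cD: "compact (D n)" for n unfolding D_def by (rule compact_continuous_image[OF cn clL])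
  have Dmono: "D n \<subseteq> D m" if "m \<le> n" for m n
  proof -
    have "(f ^^ n) x = (f ^^ m) ((f ^^ (n - m)) x)" for x
      using that by (metis funpow_add le_add_diff_inverse o_apply)
    then show ?thesis unfolding D_def using fnL by (metis image_eqI image_subsetI)
  qed
  have DL: "D n \<subseteq> \<Lambda>" for n unfolding D_def using fnL by auto
  have sub: "(\<Inter>n. D n) \<subseteq> {p}"
  proof
    fix x assume x: "x \<in> (\<Inter>n. D n)"
    have "x \<in> Inv f K"
    proof (rule Inv_backward_forward[of "\<Inter>n. D n"])
      show "(\<Inter>n. D n) \<subseteq> K" using DL[of 0] by (auto simp: \<Lambda>_def)
      show "(f ^^ n) x \<in> K" for n using x DL[of 0] by (auto simp: \<Lambda>_def)
      show "\<exists>z\<in>\<Inter>n. D n. f z = y" if y: "y \<in> (\<Inter>n. D n)" for y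
      proof -
        define E where "E n = D n \<inter> f -` {y}" for n
        have "closed (E n)" for n unfolding E_def
          by (rule continuous_closed_preimage[OF continuous_on_subset[OF K(2)]]) (use DL cD in \<open>auto simp: \<Lambda>_def compact_imp_closed\<close>)
        then have "compact (E n)" for n using cD[of n] by (metis E_def Int_lower1 compact_Int_closed inf.absorb_iff2)
        moreover have "E n \<noteq> {}" for n
        proof -
          have "y \<in> D (Suc n)" using y by blast
          then obtain z where "z \<in> \<Lambda>" "y = f ((f ^^ n) z)" by (auto simp: D_def)
          then show ?thesis by (auto simp: E_def D_def)
        qed
        moreover have "E n \<subseteq> E m" if "m \<le> n" for m n using Dmono[OF that] by (auto simp: E_def)
        ultimately have "(\<Inter>n. E n) \<noteq> {}" by (intro compact_nest) auto
        then show ?thesis by (auto simp: E_def)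
      qed
    qed (rule x)
    then show "x \<in> {p}" using K(3) by blast
  qed
  have "\<exists>k. D k \<subseteq> ball p e"
  proof (rule ccontr)
    assume "\<nexists>k. D k \<subseteq> ball p e"
    then have "D k - ball p e \<noteq> {}" for k by blast
    moreover have "compact (D k - ball p e)" for k using cD by (simp add: compact_diff)
    moreover have "D n - ball p e \<subseteq> D m - ball p e" if "m \<le> n" for m n using Dmono[OF that] by blast
    ultimately have "(\<Inter>k. D k - ball p e) \<noteq> {}" by (intro compact_nest) auto
    then obtain x where "\<And>k. x \<in> D k" "x \<notin> ball p e" by blast
    then have "x \<in> (\<Inter>n. D n)" "\<not> dist p x < e" by auto
    then have "x = p" using sub by blast
    then show False using \<open>\<not> dist p x < e\<close> \<open>e > 0\<close> by simp
  qed
  then obtain k where k: "D k \<subseteq> ball p e" by blast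
  have "dist ((f ^^ j) x) p < e" if "j \<ge> k" "x \<in> \<Lambda>" for j x
  proof -
    have "(f ^^ j) x \<in> D j" using that(2) by (simp add: D_def)
    then have "(f ^^ j) x \<in> ball p e" using Dmono[OF that(1)] k by blast
    then show ?thesis by (simp add: dist_commute)
  qed
  then show ?thesis by blast
qed

lemma nested_connected_Inter:
  fixes B :: "nat \<Rightarrow> 'a::euclidean_space set"
  assumes "\<And>n. compact (B n)" "\<And>n. connected (B n)" "\<And>m n. m \<le> n \<Longrightarrow> B n \<subseteq> B m"
  shows "connected (\<Inter>n. B n)" "compact (\<Inter>n. B n)"
    "open T \<Longrightarrow> (\<Inter>n. B n) \<subseteq> T \<Longrightarrow> \<exists>n. B n \<subseteq> T"
proof -
  show "connected (\<Inter>n. B n)" by (rule connected_nest[OF assms(1,2)]) (use assms(3) in auto)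
  show "compact (\<Inter>n. B n)" using assms(1) by (intro compact_Inter) auto
  show "\<exists>n. B n \<subseteq> T" if T: "open T" "(\<Inter>n. B n) \<subseteq> T"
  proof (rule ccontr)
    assume "\<nexists>n. B n \<subseteq> T"
    then have "B n - T \<noteq> {}" for n by blast
    moreover have "compact (B n - T)" for n using assms(1) T(1) by (simp add: compact_diff)
    moreover have "B n - T \<subseteq> B m - T" if "m \<le> n" for m n using assms(3)[OF that] by blast
    ultimately have "(\<Inter>n. B n - T) \<noteq> {}" by (intro compact_nest) auto
    then show False using T(2) by blast
  qed
qed

text \<open>Weighting the j-th iterate with 1 + j/k makes the sublevel set strictly forward invariant.\<close>
lemma forward_invariant_nbhd:
  fixes f :: "complex \<Rightarrow> complex"
  assumes K: "compact K" "continuous_on K f" "Inv f K \<subseteq> {p}" "f p = p" and c: "c > 0" "cball p c \<subseteq> interior K"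
  defines "\<Lambda> \<equiv> {x \<in> K. \<forall>n. (f ^^ n) x \<in> K}"
  shows "\<exists>R. open R \<and> p \<in> R \<and> R \<subseteq> ball p c \<and> f ` (closure R \<inter> \<Lambda>) \<subseteq> R"
proof -
  obtain k0 where k0: "\<And>j x. j \<ge> k0 \<Longrightarrow> x \<in> \<Lambda> \<Longrightarrow> dist ((f ^^ j) x) p < c/2"
    using stable_set_attracted[OF K(1-3), of "c/2"] c(1) unfolding \<Lambda>_def by auto
  define k where "k = Suc k0"
  have k: "k > 0" "\<And>j x. j \<ge> k \<Longrightarrow> x \<in> \<Lambda> \<Longrightarrow> dist ((f ^^ j) x) p < c/2" using k0 by (auto simp: k_def)
  define R where "R = {x. \<forall>j\<le>k. (1 + real j / real k) * dist ((f ^^ j) x) p < c}"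
  have Rb: "(f ^^ j) x \<in> ball p c" if "x \<in> R" "j \<le> k" for x j
  proof -
    have "dist ((f ^^ j) x) p \<le> (1 + real j / real k) * dist ((f ^^ j) x) p"
      by (simp add: algebra_simps)
    also have "\<dots> < c" using that by (auto simp: R_def)
    finally show ?thesis by (simp add: dist_commute)
  qed
  have "ball p c \<subseteq> interior K" using c(2) ball_subset_cball by blast
  then have RK: "(f ^^ j) x \<in> interior K" if "x \<in> R" "j \<le> k" for x j using Rb[OF that] by blast
  define O' where "O' m = {x. \<forall>j\<le>m. (f ^^ j) x \<in> interior K}" for m
  have cO: "continuous_on (O' m) (f ^^ j)" if "j \<le> Suc m" for j m
    by (rule continuous_on_funpow[OF K(2)]) (use that interior_subset[of K] in \<open>auto simp: O'_def\<close>)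
  have opO: "open (O' m)" for m
  proof (induction m)
    case 0
    have "O' 0 = interior K" by (auto simp: O'_def)
    then show ?case by simp
  next
    case (Suc m)
    have "O' (Suc m) = O' m \<inter> (f ^^ Suc m) -` interior K" by (auto simp: O'_def le_Suc_eq)
    then show ?case using continuous_open_preimage[OF cO[of "Suc m" m] Suc, of "interior K"] by simp
  qed
  have "open R"
  proof -
    have "R = (\<Inter>j\<in>{..k}. O' k \<inter> (\<lambda>x. (1 + real j / real k) * dist ((f ^^ j) x) p) -` {..<c})"
      using RK by (auto simp: R_def O'_def)
    moreover have "open (O' k \<inter> (\<lambda>x. (1 + real j / real k) * dist ((f ^^ j) x) p) -` {..<c})" if "j \<le> k" for j
      by (rule continuous_open_preimage[OF _ opO]) (use that k(1) in \<open>auto intro!: continuous_intros cO\<close>)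
    ultimately show ?thesis by (simp only:) (rule open_INT, auto)
  qed
  moreover have "p \<in> R"
  proof -
    have "(f ^^ j) p = p" for j by (induction j) (use K(4) in auto)
    then show ?thesis using c(1) by (simp add: R_def)
  qed
  moreover have "R \<subseteq> ball p c" using Rb[of _ 0] by auto
  moreover have "f ` (closure R \<inter> \<Lambda>) \<subseteq> R"
  proof
    fix y assume "y \<in> f ` (closure R \<inter> \<Lambda>)"
    then obtain x where x: "x \<in> closure R" "x \<in> \<Lambda>" "y = f x" by blast
    have le: "(1 + real j / real k) * dist ((f ^^ j) x) p \<le> c" if j: "j \<le> k" for j
    proof -
      obtain X where X: "\<And>n. X n \<in> R" "X \<longlonglongrightarrow> x" using x(1) unfolding closure_sequential by blast
      have "(\<lambda>n. (f ^^ i) (X n)) \<longlonglongrightarrow> (f ^^ i) x" if "i \<le> k" for i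
        using that
      proof (induction i)
        case (Suc i)
        have "(\<lambda>n. f ((f ^^ i) (X n))) \<longlonglongrightarrow> f ((f ^^ i) x)"
          by (rule continuous_on_tendsto_compose[OF K(2)])
             (use Suc RK[OF X(1), of i] interior_subset[of K] x(2) in \<open>auto simp: \<Lambda>_def subset_iff\<close>)
        then show ?case by simp
      qed (use X in auto)
      then have "(\<lambda>n. (1 + real j / real k) * dist ((f ^^ j) (X n)) p) \<longlonglongrightarrow> (1 + real j / real k) * dist ((f ^^ j) x) p"
        using j by (intro tendsto_intros) auto
      moreover have "(1 + real j / real k) * dist ((f ^^ j) (X n)) p \<le> c" for n using X(1)[of n] j by (auto simp: R_def less_imp_le)
      ultimately show ?thesis using LIMSEQ_le_const2 by blast
    qed
    \<comment> \<open>At \<open>j = k\<close> the weight is 2, which the bound \<open>c/2\<close>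
      from the choice of \<open>k\<close> pays for. For smaller \<open>j\<close> the bound on
      \<open>x\<close> at index \<open>Suc j\<close> carries a larger weight than needed for
      \<open>y = f x\<close> at index \<open>j\<close>, and the surplus is strict unless the
      distance is 0.\<close>
    have "(1 + real j / real k) * dist ((f ^^ j) y) p < c" if "j \<le> k" for j
    proof (cases "j = k")
      case True
      have "dist ((f ^^ Suc k) x) p < c/2" using k(2)[of "Suc k" x] x(2) by simp
      then have "dist ((f ^^ k) y) p < c/2" using x(3) by (simp add: funpow_swap1)
      then show ?thesis using True k(1) by simp
    next
      case False
      then have j: "Suc j \<le> k" using that by simp
      have eq: "(f ^^ j) y = (f ^^ Suc j) x" using x(3) by (simp add: funpow_swap1)
      let ?d = "dist ((f ^^ j) y) p"
      have 1: "(1 + real (Suc j) / real k) * ?d \<le> c" using le[OF j] eq by simp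
      show ?thesis
      proof (cases "?d = 0")
        case False
        then have "(1 + real j / real k) * ?d < (1 + real (Suc j) / real k) * ?d"
          using k(1) by (intro mult_strict_right_mono) (auto simp: field_simps)
        then show ?thesis using 1 by linarith
      qed (use c(1) in simp)
    qed
    then show "y \<in> R" by (simp add: R_def)
  qed
  ultimately show ?thesis by blast
qed

section \<open>Isolating blocks\<close>

text \<open>N is the block and \<open>-N\<close> is the union of Vinf and the holes V a; \<open>closure W - W\<close> is the exit set.\<close>
locale planar_block =
  fixes f :: "complex \<Rightarrow> complex" and p :: complex and Y N A :: "complex set" and r :: "complex \<Rightarrow> complex"
    and V :: "complex \<Rightarrow> complex set" and Vinf :: "complex set" and \<sigma> :: real and W :: "complex set"
  assumes contf: "continuous_on N f" and fp: "f p = p"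
    and compY: "compact Y" and conY: "connected Y" and pY: "p \<in> Y" and fY: "f ` Y \<subseteq> Y"
    and compN: "compact N" and YN: "Y \<subseteq> interior N" and finA: "finite A" and AN: "A \<inter> N = {}"
    and bdA: "\<And>a. a \<in> A \<Longrightarrow> bounded (connected_component_set (-Y) a)"
    and sepA: "\<And>a b. a \<in> A \<Longrightarrow> b \<in> A \<Longrightarrow> a \<noteq> b \<Longrightarrow> b \<notin> connected_component_set (-Y) a"
    and rcont: "continuous_on (-A) r" and rid: "\<And>x. x \<in> N \<Longrightarrow> r x = x" and rN: "\<And>x. x \<notin> A \<Longrightarrow> r x \<in> N"
    and V: "\<And>a. a \<in> A \<Longrightarrow> open (V a) \<and> connected (V a) \<and> a \<in> V a \<and> V a \<inter> A = {a}"
    and conVi: "connected Vinf" and AVi: "Vinf \<inter> A = {}" and complN: "- N = Vinf \<union> (\<Union>a\<in>A. V a)"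
    and rV: "\<And>a x. a \<in> A \<Longrightarrow> x \<in> V a - {a} \<Longrightarrow> r x \<in> closure (V a)"
    and rVi: "\<And>x. x \<in> Vinf \<Longrightarrow> r x \<in> closure Vinf"
    and \<sigma>: "\<sigma> > 0" and far: "- ball p \<sigma> \<subseteq> Vinf" and N\<sigma>: "N \<subseteq> ball p \<sigma>" and A\<sigma>: "A \<subseteq> ball p \<sigma>"
    and locN: "locally connected N"
    and opW: "openin (top_of_set N) W" and conW: "connected W" and YW: "Y \<subseteq> W"
    and fW: "f ` closure W \<subseteq> N" and fbd: "f ` (closure W - W) \<inter> closure W = {}"
    and per: "\<And>n x. n \<ge> 1 \<Longrightarrow> (\<And>i. i < n \<Longrightarrow> (f ^^ i) x \<in> closure W) \<Longrightarrow> (f ^^ n) x = x \<Longrightarrow> x = p"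
    and attr: "\<And>e. e > 0 \<Longrightarrow> \<exists>k. \<forall>j\<ge>k. \<forall>y\<in>Y. dist ((f ^^ j) y) p < e"
    and bdne: "closure W - W \<noteq> {}"
    and y0ex: "\<exists>y\<in>W. y \<notin> f ` closure W"

section \<open>Chains with small errors that end at the fixed point\<close>

definition chains_to :: "(complex \<Rightarrow> complex) \<Rightarrow> complex set \<Rightarrow> complex \<Rightarrow> real \<Rightarrow> complex set" where
  "chains_to f N p \<delta> = {x \<in> N. (x, p) \<in> {(a, b). a \<in> N \<and> b \<in> N \<and> dist (f a) b < \<delta>}\<^sup>*}"

lemma chains_to_step:
  assumes "x \<in> N" "y \<in> chains_to f N p \<delta>" "dist (f x) y < \<delta>"
  shows "x \<in> chains_to f N p \<delta>"
proof -
  have "(x, y) \<in> {(a, b). a \<in> N \<and> b \<in> N \<and> dist (f a) b < \<delta>}" using assms by (auto simp: chains_to_def)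
  moreover have "(y, p) \<in> {(a, b). a \<in> N \<and> b \<in> N \<and> dist (f a) b < \<delta>}\<^sup>*" using assms by (auto simp: chains_to_def)
  ultimately show ?thesis using assms(1) unfolding chains_to_def by (simp add: converse_rtrancl_into_rtrancl)
qed

lemma chains_to_cases:
  assumes x: "x \<in> chains_to f N p \<delta>" and "f p = p" "\<delta> > 0"
  shows "\<exists>y\<in>chains_to f N p \<delta>. dist (f x) y < \<delta>"
proof -
  have "(x, p) \<in> {(a, b). a \<in> N \<and> b \<in> N \<and> dist (f a) b < \<delta>}\<^sup>*" using x by (auto simp: chains_to_def)
  then show ?thesis
  proof (cases rule: converse_rtranclE)
    case base
    then show ?thesis using x assms(2,3) by (intro bexI[of _ p]) auto
  next
    case (step y)
    then show ?thesis by (intro bexI[of _ y]) (auto simp: chains_to_def)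
  qed
qed

lemma chains_to_mono: "\<delta> \<le> \<epsilon> \<Longrightarrow> chains_to f N p \<delta> \<subseteq> chains_to f N p \<epsilon>"
proof -
  assume "\<delta> \<le> \<epsilon>"
  then have "{(a, b). a \<in> N \<and> b \<in> N \<and> dist (f a) b < \<delta>} \<subseteq> {(a, b). a \<in> N \<and> b \<in> N \<and> dist (f a) b < \<epsilon>}" by auto
  then show ?thesis unfolding chains_to_def using rtrancl_mono by blast
qed

lemma chains_to_base: "p \<in> N \<Longrightarrow> p \<in> chains_to f N p \<delta>"
  by (simp add: chains_to_def)

text \<open>The error allowed in the first step lets the starting point of a chain be moved a
  little. The component of \<open>p\<close> in such a set will be \<open>W\<close>, which inherits
  relative openness.\<close>

lemma chains_to_openin:
  assumes "continuous_on N f" "f p = p" "\<delta> > 0"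
  shows "openin (top_of_set N) (chains_to f N p \<delta>)"
  unfolding openin_contains_ball
proof (intro conjI ballI)
  show "chains_to f N p \<delta> \<subseteq> N" by (auto simp: chains_to_def)
  fix x assume x: "x \<in> chains_to f N p \<delta>"
  then have xN: "x \<in> N" by (auto simp: chains_to_def)
  obtain y where y: "y \<in> chains_to f N p \<delta>" "dist (f x) y < \<delta>" using chains_to_cases[OF x assms(2,3)] by blast
  then have "\<delta> - dist (f x) y > 0" by simp
  then obtain e where e: "e > 0" "\<And>x'. x' \<in> N \<Longrightarrow> dist x' x < e \<Longrightarrow> dist (f x') (f x) < \<delta> - dist (f x) y"
    using assms(1) xN unfolding continuous_on_iff by metis
  have "x' \<in> chains_to f N p \<delta>" if "x' \<in> ball x e \<inter> N" for x'
  proof (rule chains_to_step[OF _ y(1)])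
    show "x' \<in> N" using that by blast
    have "dist (f x') (f x) < \<delta> - dist (f x) y" using e(2)[of x'] that by (auto simp: dist_commute)
    then show "dist (f x') y < \<delta>" using dist_triangle[of "f x'" y "f x"] by linarith
  qed
  then show "\<exists>e>0. ball x e \<inter> N \<subseteq> chains_to f N p \<delta>" using e(1) by blast
qed

text \<open>Were the image that close, one more step would prolong a chain backwards to
  \<open>x\<close>. This is why exit points are mapped off \<open>closure W\<close>.\<close>

lemma chains_to_boundary:
  assumes "x \<in> N" "x \<notin> chains_to f N p \<delta>" "\<delta> > 0"
  shows "f x \<notin> closure (chains_to f N p \<delta>)"
proof
  assume "f x \<in> closure (chains_to f N p \<delta>)"
  then obtain y where "y \<in> chains_to f N p \<delta>" "dist y (f x) < \<delta>" using assms(3) by (auto simp: closure_approachable)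
  then show False using chains_to_step[OF assms(1)] assms(2) by (metis dist_commute)
qed

lemma chains_to_orbit:
  assumes N: "\<And>i. (f ^^ i) x \<in> N" and pN: "p \<in> N" and k: "dist ((f ^^ Suc k) x) p < \<delta>" and d: "\<delta> > 0"
  shows "x \<in> chains_to f N p \<delta>"
proof -
  have "(f ^^ (k - i)) x \<in> chains_to f N p \<delta>" if "i \<le> k" for i
    using that
  proof (induction i)
    case 0
    then show ?case using chains_to_step[OF N[of k] chains_to_base[OF pN]] k by simp
  next
    case (Suc i)
    then have "(f ^^ (k - i)) x = f ((f ^^ (k - Suc i)) x)" by (simp add: Suc_diff_Suc[symmetric])
    then show ?case using chains_to_step[OF N[of "k - Suc i"], of "(f ^^ (k - i)) x"] Suc d by simp
  qed
  from this[of k] show ?thesis by simp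
qed

text \<open>\<open>W\<close> is the component of \<open>p\<close> in the set of starting points of
  fine chains. As the error tends to 0, the closures \<open>B n\<close> shrink to a connected set
  \<open>Bi\<close> of points with exact forward orbits in \<open>N\<close>, which is therefore part
  of \<open>X\<close>; its image lies in \<open>Y\<close>, so \<open>f\<close> maps
  \<open>B n\<close> into the interior of \<open>N\<close> for large \<open>n\<close>. Without exit
  points \<open>W = N\<close> is a sink neighbourhood. If \<open>f\<close> covers \<open>W\<close>
  from \<open>closure W\<close>, every point of \<open>W\<close> has a backward orbit in
  \<open>W\<close>; isolation then gives \<open>Bi = {p}\<close>, and \<open>closure W\<close> is a
  source neighbourhood.\<close>

lemma planar_block_exists:
  fixes f :: "complex \<Rightarrow> complex"
  assumes U: "open U" "continuous_on U f" "p \<in> U" "f p = p" and iso: "isolated_inv f U {p}"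
    and nsink: "\<not> is_sink f U p" and nsource: "\<not> is_source f U p"
  shows "\<exists>Y N A r V Vinf \<sigma> W. planar_block f p Y N A r V Vinf \<sigma> W"
proof -
  obtain N0 where N0: "isolating_nbhd f U N0" "{p} = Inv f N0" using iso unfolding isolated_inv_def by blast
  then have pN0: "p \<in> interior N0" "N0 \<subseteq> U" unfolding isolating_nbhd_def by blast+
  obtain c1 where c1: "c1 > 0" "cball p c1 \<subseteq> interior N0" using pN0(1) open_contains_cball open_interior by metis
  define K where "K = cball p c1"
  have K: "compact K" "K \<subseteq> U" "K \<subseteq> N0" using c1 pN0 interior_subset unfolding K_def by (blast intro: compact_cball)+
  have contK: "continuous_on K f" using U(2) K(2) continuous_on_subset by blast
  have InvK: "Inv f K \<subseteq> {p}" using Inv_mono[OF K(3)] N0(2) by blast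
  define \<Lambda> where "\<Lambda> = {x \<in> K. \<forall>n. (f ^^ n) x \<in> K}"
  have compL: "compact \<Lambda>" unfolding \<Lambda>_def by (rule compact_stable_set[OF K(1) contK])
  have fL: "f x \<in> \<Lambda>" if "x \<in> \<Lambda>" for x using stable_set_forward[of x K f] that unfolding \<Lambda>_def by blast
  have fnp: "(f ^^ n) p = p" for n by (induction n) (use U(4) in auto)
  have pL: "p \<in> \<Lambda>" using c1(1) by (simp add: \<Lambda>_def fnp K_def)
  define c where "c = c1/2"
  have c: "c > 0" "cball p c \<subseteq> interior K" using c1(1) by (auto simp: c_def K_def)
  obtain R where R: "open R" "p \<in> R" "R \<subseteq> ball p c" "f ` (closure R \<inter> \<Lambda>) \<subseteq> R"
    using forward_invariant_nbhd[OF K(1) contK InvK U(4) c] unfolding \<Lambda>_def by blast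
  have RK: "R \<subseteq> K" using R(3) c1(1) by (auto simp: c_def K_def dest!: subsetD)
  define X where "X = connected_component_set (\<Lambda> \<inter> closure R) p"
  have pR: "p \<in> \<Lambda> \<inter> closure R" using pL R(2) closure_subset by blast
  have XL: "X \<subseteq> \<Lambda> \<inter> closure R" unfolding X_def by (rule connected_component_subset)
  have conX: "connected X" unfolding X_def by (rule connected_connected_component)
  have pX: "p \<in> X" unfolding X_def using pR by (simp add: connected_component_refl)
  have Xmax: "Z \<subseteq> X" if "connected Z" "p \<in> Z" "Z \<subseteq> \<Lambda> \<inter> closure R" for Z
    unfolding X_def by (rule connected_component_maximal[OF that(2,1,3)])
  have clX: "compact X"
  proof -
    have "compact (\<Lambda> \<inter> closure R)" using compL by (simp add: compact_Int_closed)
    then show ?thesis unfolding X_def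
      by (metis compact_eq_bounded_closed closed_connected_component connected_component_subset bounded_subset)
  qed
  have contX: "continuous_on X f" by (rule continuous_on_subset[OF contK]) (use XL in \<open>auto simp: \<Lambda>_def\<close>)
  \<comment> \<open>\<open>X\<close> can reach the frontier of \<open>R\<close>, but its image
    cannot, because \<open>f\<close> maps all of \<open>closure R \<inter> \<Lambda>\<close> into
    the open set \<open>R\<close>. So the image is the continuum that gets a neighbourhood inside
    \<open>R\<close>.\<close>
  define Y where "Y = f ` X"
  have Y: "compact Y" "connected Y" "p \<in> Y" "Y \<subseteq> R" "Y \<subseteq> \<Lambda>"
  proof -
    show "compact Y" unfolding Y_def by (rule compact_continuous_image[OF contX clX])
    show "connected Y" unfolding Y_def by (rule connected_continuous_image[OF contX conX])
    show "p \<in> Y" unfolding Y_def using pX U(4) by (metis image_eqI)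
    show "Y \<subseteq> R" unfolding Y_def using R(4) XL by blast
    show "Y \<subseteq> \<Lambda>" unfolding Y_def using fL XL by blast
  qed
  have YX: "Y \<subseteq> X" using Xmax[OF Y(2,3)] Y(4,5) closure_subset by blast
  have fY: "f ` Y \<subseteq> Y" using YX unfolding Y_def by blast
  have "bounded R" using R(3) bounded_ball bounded_subset by blast
  note nbhd = planar_neighbourhood[OF Y(1-3) R(1) Y(4) this]
  obtain N A r V Vinf \<sigma> where G:
    "compact N" "N \<subseteq> R" "Y \<subseteq> interior N" "finite A" "A \<inter> N = {}"
    "\<And>a. a \<in> A \<Longrightarrow> bounded (connected_component_set (-Y) a)"
    "\<And>a b. a \<in> A \<Longrightarrow> b \<in> A \<Longrightarrow> a \<noteq> b \<Longrightarrow> b \<notin> connected_component_set (-Y) a"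
    "continuous_on (-A) r" "\<And>x. x \<in> N \<Longrightarrow> r x = x" "\<And>x. x \<notin> A \<Longrightarrow> r x \<in> N"
    "\<And>a. a \<in> A \<Longrightarrow> open (V a) \<and> connected (V a) \<and> a \<in> V a \<and> V a \<inter> A = {a}"
    "connected Vinf" "Vinf \<inter> A = {}" "- N = Vinf \<union> (\<Union>a\<in>A. V a)"
    "\<And>a x. a \<in> A \<Longrightarrow> x \<in> V a - {a} \<Longrightarrow> r x \<in> closure (V a)"
    "\<And>x. x \<in> Vinf \<Longrightarrow> r x \<in> closure Vinf"
    "\<sigma> > 0" "- ball p \<sigma> \<subseteq> Vinf" "N \<subseteq> ball p \<sigma>" "A \<subseteq> ball p \<sigma>"
    by (rule nbhd) (rule that, assumption+)
  have NK: "N \<subseteq> K" using G(2) RK by blast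
  have contN: "continuous_on N f" using contK NK continuous_on_subset by blast
  have clN: "closed N" using G(1) compact_imp_closed by blast
  have pN: "p \<in> N" "p \<in> interior N" using Y(3) G(3) interior_subset by blast+
  have retr: "retraction (-A) N r" unfolding retraction_def using G(5,8,9,10) by auto
  \<comment> \<open>As a retract of an open subset of the plane \<open>N\<close> is an ANR, which
    gives local connectedness without a study of its boundary.\<close>
  have locN: "locally connected N"
  proof -
    have "open (- A)" using G(4) by (simp add: finite_imp_closed open_Compl)
    then have "ANR (- A)" by (rule open_imp_ANR)
    then have "ANR N" using retr retract_of_def ANR_retract_of_ANR by blast
    then show ?thesis by (rule ANR_imp_locally_connected)
  qed
  have conN: "connected N"
  proof -
    have "connected (UNIV - A)"
      by (rule connected_open_diff_countable) (use G(4) in \<open>auto simp: countable_finite\<close>)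
    then have "connected (r ` (- A))" by (intro connected_continuous_image[OF G(8)]) (simp add: Compl_eq_Diff_UNIV)
    moreover have "r ` (- A) = N" using retr by (auto simp: retraction_def) (metis ComplI G(5) G(9) IntI empty_iff image_eqI)
    ultimately show ?thesis by simp
  qed
  define T where "T n = chains_to f N p (1 / Suc n)" for n
  define B where "B n = closure (connected_component_set (T n) p)" for n
  have Tmono: "T n \<subseteq> T m" if "m \<le> n" for m n
    unfolding T_def by (rule chains_to_mono) (use that in \<open>simp add: frac_le\<close>)
  have TN: "T n \<subseteq> N" for n by (auto simp: T_def chains_to_def)
  have pT: "p \<in> T n" for n unfolding T_def using chains_to_base pN by blast
  have pB: "p \<in> B n" for n unfolding B_def using pT closure_subset connected_component_refl by (metis mem_Collect_eq subsetD)
  have BN: "B n \<subseteq> N" for n unfolding B_def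
    by (rule closure_minimal[OF _ clN]) (use TN connected_component_subset in blast)
  have compB: "compact (B n)" for n using BN G(1) unfolding B_def by (meson bounded_subset closed_closure compact_eq_bounded_closed)
  have conB: "connected (B n)" for n unfolding B_def by (intro connected_imp_connected_closure connected_connected_component)
  have Bmono: "B n \<subseteq> B m" if "m \<le> n" for m n
    unfolding B_def by (intro closure_mono connected_component_mono Tmono that)
  define Bi where "Bi = (\<Inter>n. B n)"
  define Ts where "Ts = (\<Inter>n. closure (T n))"
  have TsN: "Ts \<subseteq> N" using closure_minimal[OF TN[of 0] clN] by (auto simp: Ts_def)
  \<comment> \<open>Forward invariance in the limit: close to \<open>x\<close> there are starting
    points of arbitrarily fine chains, and the successors in these chains approximate
    \<open>f x\<close>.\<close>
  have fTs: "f x \<in> Ts" if x: "x \<in> Ts" for x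
  proof -
    have "f x \<in> closure (T m)" for m
      unfolding closure_approachable
    proof (intro allI impI)
      fix e :: real assume e: "e > 0"
      obtain n0 where n0: "1 / real (Suc n0) < e/2" using e nat_approx_posE[of "e/2"] by auto
      define n where "n = max m n0"
      have n: "1 / real (Suc n) < e/2" "T n \<subseteq> T m"
      proof -
        have "1 / real (Suc n) \<le> 1 / real (Suc n0)" by (simp add: n_def frac_le)
        then show "1 / real (Suc n) < e/2" using n0 by linarith
        show "T n \<subseteq> T m" by (rule Tmono) (simp add: n_def)
      qed
      have xN: "x \<in> N" using x TsN by blast
      obtain d where d: "d > 0" "\<And>x'. x' \<in> N \<Longrightarrow> dist x' x < d \<Longrightarrow> dist (f x') (f x) < e/2"
        using contN xN e unfolding continuous_on_iff by (metis half_gt_zero)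
      have "x \<in> closure (T n)" using x by (auto simp: Ts_def)
      then obtain x' where x': "x' \<in> T n" "dist x' x < d" using d(1) by (auto simp: closure_approachable)
      obtain y where y: "y \<in> T n" "dist (f x') y < 1 / Suc n"
        using chains_to_cases[of x' f N p "1 / Suc n"] x'(1) U(4) by (auto simp: T_def)
      have "dist (f x') (f x) < e/2" using d(2) x' TN by blast
      then have "dist y (f x) < e" using y(2) n(1) dist_triangle[of y "f x" "f x'"] by (simp add: dist_commute)
      then show "\<exists>y\<in>T m. dist y (f x) < e" using y(1) n(2) by blast
    qed
    then show ?thesis by (simp add: Ts_def)
  qed
  have fnTs: "(f ^^ n) x \<in> Ts" if "x \<in> Ts" for x n by (induction n) (use that fTs in auto)
  have TsL: "Ts \<subseteq> \<Lambda>" using fnTs TsN NK by (fastforce simp: \<Lambda>_def)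
  have BiTs: "Bi \<subseteq> Ts" unfolding Bi_def Ts_def B_def using closure_mono[OF connected_component_subset] by blast
  have conBi: "connected Bi" unfolding Bi_def by (rule nested_connected_Inter(1)[OF compB conB Bmono])
  have pBi: "p \<in> Bi" using pB by (simp add: Bi_def)
  have BiX: "Bi \<subseteq> X"
    by (rule Xmax[OF conBi pBi]) (use BiTs TsL TsN G(2) closure_subset[of R] in blast)
  obtain Gf where Gf: "open Gf" "N \<inter> f -` interior N = N \<inter> Gf"
    using continuous_on_open_gen[of f N UNIV] contN by (metis (no_types, lifting) continuous_openin_preimage_gen open_interior openin_open)
  have BiGf: "Bi \<subseteq> Gf"
  proof
    fix x assume x: "x \<in> Bi"
    then have "f x \<in> interior N" using BiX G(3) unfolding Y_def by blast
    moreover have "x \<in> N" using x BiTs TsN by blast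
    ultimately show "x \<in> Gf" using Gf(2) by blast
  qed
  have "\<exists>n. B n \<subseteq> Gf"
    by (rule nested_connected_Inter(3)[OF compB conB Bmono Gf(1)]) (use BiGf in \<open>simp_all add: Bi_def\<close>)
  then obtain n1 where n1: "B n1 \<subseteq> Gf" by blast
  \<comment> \<open>The case \<open>Bi = {p}\<close> arises when a source has to be excluded, after
    \<open>n\<close> has been fixed; hence the implication.\<close>
  have "\<exists>n. Bi = {p} \<longrightarrow> B n \<subseteq> interior N"
  proof (cases "Bi = {p}")
    case True
    have "\<exists>n. B n \<subseteq> interior N"
      by (rule nested_connected_Inter(3)[OF compB conB Bmono open_interior]) (use True pN(2) in \<open>simp_all add: Bi_def\<close>)
    then show ?thesis by blast
  qed simp
  then obtain n2 where n2: "Bi = {p} \<longrightarrow> B n2 \<subseteq> interior N" by blast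
  define n where "n = max n1 n2"
  define \<delta> where "\<delta> = 1 / real (Suc n)"
  have \<delta>: "\<delta> > 0" by (simp add: \<delta>_def)
  define W where "W = connected_component_set (T n) p"
  have cW: "closure W = B n" by (simp add: W_def B_def)
  have cWN: "closure W \<subseteq> N" using cW BN by simp
  have opT: "openin (top_of_set N) (T n)" unfolding T_def by (rule chains_to_openin[OF contN U(4)]) simp
  have "locally connected (T n)" by (rule locally_open_subset[OF locN opT])
  then have "openin (top_of_set (T n)) W" unfolding W_def by (rule openin_connected_component_locally_connected)
  then have opW: "openin (top_of_set N) W" using opT openin_trans by blast
  have conW: "connected W" unfolding W_def by (rule connected_connected_component)
  have pW: "p \<in> W" unfolding W_def using pT by (simp add: connected_component_refl)
  have WT: "W \<subseteq> T n" unfolding W_def by (rule connected_component_subset)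
  have Wmax: "Z \<subseteq> W" if "connected Z" "p \<in> Z" "Z \<subseteq> T n" for Z
    unfolding W_def by (rule connected_component_maximal[OF that(2,1,3)])
  have fWi: "f ` closure W \<subseteq> interior N"
  proof -
    have "B n \<subseteq> Gf" using Bmono[of n1 n] n1 by (auto simp: n_def)
    then show ?thesis using cW BN[of n] Gf(2) by blast
  qed
  have fbd: "f ` (closure W - W) \<inter> closure W = {}"
  proof -
    have "f x \<notin> closure W" if x: "x \<in> closure W" "x \<notin> W" for x
    proof -
      have "x \<notin> T n"
      proof
        assume "x \<in> T n"
        have "closedin (top_of_set (T n)) W" unfolding W_def by (rule closedin_connected_component)
        then obtain C where "closed C" "W = T n \<inter> C" by (auto simp: closedin_closed)
        then have "x \<in> W" using x(1) \<open>x \<in> T n\<close> by (metis IntI Int_lower2 closure_minimal subsetD)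
        then show False using x(2) by simp
      qed
      then have "f x \<notin> closure (T n)" unfolding T_def
        by (intro chains_to_boundary) (use x(1) cWN in auto)
      then show ?thesis using closure_mono[OF WT] by blast
    qed
    then show ?thesis by blast
  qed
  have orbT: "x \<in> T n" if "x \<in> \<Lambda>" "\<And>i. (f ^^ i) x \<in> N" for x
  proof -
    obtain k where k: "\<And>j y. j \<ge> k \<Longrightarrow> y \<in> \<Lambda> \<Longrightarrow> dist ((f ^^ j) y) p < \<delta>"
      using stable_set_attracted[OF K(1) contK InvK \<delta>] unfolding \<Lambda>_def by blast
    have "dist ((f ^^ Suc k) x) p < \<delta>" by (rule k[OF _ \<open>x \<in> \<Lambda>\<close>]) simp
    then show ?thesis unfolding T_def using chains_to_orbit[OF that(2) pN(1)] \<delta> by (simp add: \<delta>_def)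
  qed
  have fnY: "(f ^^ i) y \<in> Y" if "y \<in> Y" for y i by (induction i) (use that fY in auto)
  have YT: "Y \<subseteq> T n" using orbT fnY Y(5) G(3) interior_subset by blast
  have YW: "Y \<subseteq> W" by (rule Wmax[OF Y(2,3) YT])
  have BiW: "Bi \<subseteq> W"
    by (rule Wmax[OF conBi pBi]) (use orbT BiTs TsL fnTs TsN in blast)
  have pInv: "p \<in> Inv f S" if "p \<in> S" for S
    unfolding Inv_def using that U(4) by (auto intro!: exI[of _ "\<lambda>_. p"])
  have bdne: "closure W - W \<noteq> {}"
  proof
    assume "closure W - W = {}"
    then have "closed W" using closure_subset by (metis Diff_eq_empty_iff closed_closure subset_antisym)
    then have "closedin (top_of_set N) W" using opW by (simp add: closed_subset openin_imp_subset)
    then have "W = N" using conN opW pW connected_clopen by blast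
    then have "f ` N \<subseteq> N" using fWi interior_subset cWN by (metis \<open>closed W\<close> closure_closed order_trans)
    moreover have "Inv f N = {p}" using Inv_mono[OF NK] InvK pInv[OF pN(1)] by blast
    moreover have "isolating_nbhd f U N" unfolding isolating_nbhd_def using G(1) NK K(2) \<open>Inv f N = {p}\<close> pN by auto
    ultimately show False using nsink iso U(4) unfolding is_sink_def by blast
  qed
  have y0: "\<exists>y\<in>W. y \<notin> f ` closure W"
  proof (rule ccontr)
    assume "\<not> ?thesis"
    then have Wf: "W \<subseteq> f ` closure W" by blast
    \<comment> \<open>A preimage in \<open>closure W - W\<close> is impossible, as exit points land
      off \<open>closure W\<close>. So preimages can be chosen inside \<open>W\<close> again and
      again.\<close>
    have sur: "\<exists>x\<in>W. f x = y" if y: "y \<in> W" for y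
    proof -
      obtain x where x: "x \<in> closure W" "f x = y" using Wf y by blast
      have "y \<in> closure W" using y closure_subset by blast
      then have "x \<in> W" using fbd x by blast
      then show ?thesis using x by blast
    qed
    have WK: "W \<subseteq> K" using cWN NK closure_subset by blast
    have WL: "x = p" if "x \<in> W" "x \<in> \<Lambda>" for x
      using Inv_backward_forward[OF WK sur that(1)] that(2) InvK by (auto simp: \<Lambda>_def)
    have "Bi = {p}" using BiW BiTs TsL WL pBi by blast
    then have cWi: "closure W \<subseteq> interior N" using n2 Bmono[of n2 n] cW by (auto simp: n_def)
    have "open W"
    proof -
      obtain S where S: "open S" "W = N \<inter> S" using opW openin_open by blast
      then have "W = interior N \<inter> S" using cWi closure_subset[of W] interior_subset[of N] by blast
      then show ?thesis using S by auto
    qed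
    have Wi: "W \<subseteq> interior (closure W)" using \<open>open W\<close> closure_subset interior_maximal by blast
    have InvW: "Inv f (closure W) = {p}"
      using Inv_mono[of "closure W" K] cWN NK InvK pInv[of "closure W"] pW closure_subset by blast
    have "isolating_nbhd f U (closure W)"
      unfolding isolating_nbhd_def using compB[of n] cW cWN NK K(2) InvW pW Wi by auto
    moreover have "f ` frontier (closure W) \<inter> interior (closure W) = {}"
    proof -
      have "frontier (closure W) \<subseteq> closure W - W" using Wi by (auto simp: frontier_def)
      then show ?thesis using fbd interior_subset by blast
    qed
    moreover have "\<exists>m. (f ^^ m) x \<notin> closure W" if x: "x \<in> closure W - {p}" for x
    proof (rule ccontr)
      assume "\<nexists>m. (f ^^ m) x \<notin> closure W"
      then have all: "(f ^^ m) x \<in> closure W" for m by blast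
      have "x \<in> W" using all[of 1] fbd x by auto
      moreover have "x \<in> \<Lambda>" using all all[of 0] cWN NK by (auto simp: \<Lambda>_def)
      ultimately show False using WL x by blast
    qed
    ultimately show False using nsource iso U(4) InvW unfolding is_source_def by blast
  qed
  have "planar_block f p Y N A r V Vinf \<sigma> W"
  proof
    show "f ` closure W \<subseteq> N" using fWi interior_subset by blast
    show "x = p" if "m \<ge> 1" "\<And>i. i < m \<Longrightarrow> (f ^^ i) x \<in> closure W" "(f ^^ m) x = x" for m x
      using Inv_periodic[of m f x K] that cWN NK InvK by blast
    show "\<exists>k. \<forall>j\<ge>k. \<forall>y\<in>Y. dist ((f ^^ j) y) p < e" if "e > 0" for e
      using stable_set_attracted[OF K(1) contK InvK that] Y(5) unfolding \<Lambda>_def by blast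
    show "f p = p" "f ` Y \<subseteq> Y" by fact+
    show "open (V a) \<and> connected (V a) \<and> a \<in> V a \<and> V a \<inter> A = {a}" if "a \<in> A" for a using G(11)[OF that] .
    show "bounded (connected_component_set (-Y) a)" if "a \<in> A" for a using G(6)[OF that] .
    show "b \<notin> connected_component_set (-Y) a" if "a \<in> A" "b \<in> A" "a \<noteq> b" for a b using G(7)[OF that] .
    show "r x = x" if "x \<in> N" for x using G(9)[OF that] .
    show "r x \<in> N" if "x \<notin> A" for x using G(10)[OF that] .
    show "r x \<in> closure (V a)" if "a \<in> A" "x \<in> V a - {a}" for a x using G(15)[OF that] .
    show "r x \<in> closure Vinf" if "x \<in> Vinf" for x using G(16)[OF that] .
    show "compact Y" "connected Y" "p \<in> Y" "continuous_on N f" "compact N" "Y \<subseteq> interior N" "finite A" "A \<inter> N = {}"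
      "continuous_on (- A) r" "connected Vinf" "Vinf \<inter> A = {}" "- N = Vinf \<union> (\<Union>a\<in>A. V a)" "\<sigma> > 0" "- ball p \<sigma> \<subseteq> Vinf"
      "N \<subseteq> ball p \<sigma>" "A \<subseteq> ball p \<sigma>" "locally connected N" "openin (top_of_set N) W" "connected W" "Y \<subseteq> W"
      "f ` (closure W - W) \<inter> closure W = {}" "closure W - W \<noteq> {}" "\<exists>y\<in>W. y \<notin> f ` closure W" by fact+
  qed
  then show ?thesis by blast
qed

section \<open>Landing points of the exit set and the colouring they induce\<close>

context planar_block
begin

definition "L = N - W"
definition "bd = closure W - W"
definition "Bs = f ` bd"

lemma clN: "closed N" using compN compact_imp_closed by blast
lemma WN: "W \<subseteq> N" using opW openin_imp_subset by blast
lemma cWN: "closure W \<subseteq> N" by (rule closure_minimal[OF WN clN])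
lemma contf_cW: "continuous_on (closure W) f" using contf cWN continuous_on_subset by blast
lemma bd_eq: "L \<inter> closure W = bd" using cWN by (auto simp: L_def bd_def)
lemma closedL: "closed L"
proof -
  obtain S where "open S" "W = N \<inter> S" using opW openin_open by blast
  then have "L = N - S" unfolding L_def by auto
  then show ?thesis using clN \<open>open S\<close> by (simp add: closed_Diff)
qed
lemma compact_bd: "compact bd"
proof -
  have "bounded bd" unfolding bd_def using cWN compN bounded_subset compact_imp_bounded by (metis Diff_subset)
  moreover have "closed bd" unfolding bd_eq[symmetric] using closedL by auto
  ultimately show ?thesis by (simp add: compact_eq_bounded_closed)
qed
lemma bdcW: "bd \<subseteq> closure W" by (auto simp: bd_def)
lemma compact_Bs: "compact Bs"
  unfolding Bs_def by (rule compact_continuous_image[OF continuous_on_subset[OF contf_cW bdcW] compact_bd])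
lemma Bs_N: "Bs \<subseteq> N" using fW bdcW by (auto simp: Bs_def)
lemma Bs_cW: "Bs \<inter> closure W = {}" using fbd by (auto simp: Bs_def bd_def)
lemma Bs_ne: "Bs \<noteq> {}" using bdne by (auto simp: Bs_def bd_def)
lemma N_un: "closure W \<union> L = N" using cWN closure_subset[of W] by (auto simp: L_def)
lemma YN': "Y \<subseteq> N" using YN interior_subset by blast
lemma AY: "A \<inter> Y = {}" using AN YN' by blast
lemma opA: "open (- A)" using finA by (simp add: finite_imp_closed open_Compl)

lemma power_int_rep:
  assumes "continuous_on N g" "\<And>x. x \<in> N \<Longrightarrow> g x \<noteq> 0"
  shows "\<exists>k::complex\<Rightarrow>int. \<exists>M. continuous_on (-A) M \<and> (\<forall>z\<in>-A. g (r z) = (\<Prod>a\<in>A. (z - a) powi k a) * exp (M z))"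
proof (rule complement_finite_power_int_log[OF finA])
  show "continuous_on (-A) (\<lambda>z. g (r z))" by (rule continuous_on_compose2[OF assms(1) rcont]) (use rN in auto)
qed (use assms(2) rN in auto)

text \<open>The exponents of a function on \<open>N\<close>, pulled back by \<open>r\<close> to the
  complement of \<open>A\<close>, can be read off on \<open>Y\<close> alone, where \<open>f\<close>
  can be iterated without end.\<close>

lemma power_int_unique:
  assumes "continuous_on Y M" "\<And>z. z \<in> Y \<Longrightarrow> (\<Prod>a\<in>A. (z - a) powi k a) = exp (M z)" "b \<in> A"
  shows "k b = 0"
  by (rule power_int_prod_log_unique[OF compY finA AY bdA sepA assms])

text \<open>A loop around a hole of N can be pushed into Y, where the phase \<open>s \<circ> f\<close> is single-valued;
  so the phase, made trivial on L, lifts to all of N.\<close>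
lemma integer_extension:
  fixes s :: "complex \<Rightarrow> real"
  assumes s: "continuous_on UNIV s" "\<And>y. y \<in> Bs \<Longrightarrow> s y \<in> {0,1}"
  shows "\<exists>w::complex\<Rightarrow>complex. continuous_on N w \<and> (\<forall>x\<in>closure W. w x = of_real (s (f x))) \<and> (\<forall>x\<in>L. w x \<in> \<int>)"
proof -
  let ?P = "2 * of_real pi * \<i> :: complex"
  have sf: "continuous_on (closure W) (\<lambda>x. s (f x))"
    by (rule continuous_on_compose2[OF s(1) contf_cW]) auto
  \<comment> \<open>At exit points \<open>s (f x)\<close> is 0 or 1, so the phase is 1 there and the
    constant 1 continues it over \<open>L\<close>.\<close>
  define g where "g x = (if x \<in> L then 1 else exp (of_real (s (f x)) * ?P))" for x
  have e1: "exp (of_real (s y) * ?P) = 1" if "y \<in> Bs" for y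
    using s(2)[OF that] by auto
  have gcW: "g x = exp (of_real (s (f x)) * ?P)" if "x \<in> closure W" for x
    using that e1[of "f x"] bd_eq by (auto simp: g_def Bs_def)
  have "continuous_on (L \<union> closure W) g"
    unfolding g_def
  proof (rule continuous_on_cases[OF closedL closed_closure])
    show "continuous_on (closure W) (\<lambda>x. exp (of_real (s (f x)) * ?P))" by (intro continuous_intros sf)
    show "\<forall>x. x \<in> L \<and> x \<notin> L \<or> x \<in> closure W \<and> x \<in> L \<longrightarrow> 1 = exp (of_real (s (f x)) * ?P)"
      using e1 bd_eq by (metis IntI Bs_def imageI)
  qed auto
  then have "continuous_on N g" using N_un by (simp add: Un_commute)
  moreover have "g x \<noteq> 0" for x by (simp add: g_def)
  ultimately obtain k :: "complex \<Rightarrow> int" and M where M: "continuous_on (-A) M" "\<And>z. z \<in> -A \<Longrightarrow> g (r z) = (\<Prod>a\<in>A. (z - a) powi k a) * exp (M z)"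
    using power_int_rep[of g] by blast
  have NA: "N \<subseteq> -A" using AN by blast
  have "k b = 0" if "b \<in> A" for b
  proof (rule power_int_unique[OF _ _ that])
    show "continuous_on Y (\<lambda>y. of_real (s (f y)) * ?P - M y)"
      by (intro continuous_intros continuous_on_subset[OF sf] continuous_on_subset[OF M(1)])
         (use YW closure_subset[of W] YN' NA in blast)+
    fix y assume y: "y \<in> Y"
    then have "g (r y) = exp (of_real (s (f y)) * ?P)" using rid YN' gcW YW closure_subset by (metis subsetD)
    then show "(\<Prod>a\<in>A. (y - a) powi k a) = exp (of_real (s (f y)) * ?P - M y)"
      using M(2)[of y] y YN' NA by (auto simp: exp_diff field_simps)
  qed
  then have gM: "g x = exp (M x)" if "x \<in> N" for x
    using M(2)[of x] rid[OF that] that NA by (auto simp: subset_iff)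
  have MN: "continuous_on N M" using M(1) NA continuous_on_subset by blast
  have "\<exists>n::int. \<forall>x\<in>closure W. M x = of_real (s (f x)) * ?P + of_int n * ?P"
  proof (rule exp_eq_imp_const_diff)
    show "connected (closure W)" using conW by (rule connected_imp_connected_closure)
    show "continuous_on (closure W) M" using MN cWN continuous_on_subset by blast
    show "continuous_on (closure W) (\<lambda>x. of_real (s (f x)) * ?P)" by (intro continuous_intros sf)
    show "exp (M x) = exp (of_real (s (f x)) * ?P)" if "x \<in> closure W" for x
      using gM[of x] gcW[OF that] cWN that by auto
  qed
  then obtain n :: int where n: "\<And>x. x \<in> closure W \<Longrightarrow> M x = of_real (s (f x)) * ?P + of_int n * ?P" by blast
  \<comment> \<open>On the connected set \<open>closure W\<close> the logarithm \<open>M\<close> is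
    ambiguous only by the one integer \<open>n\<close>, which is subtracted. On \<open>L\<close> the
    phase is 1, so an integer remains there.\<close>
  show ?thesis
  proof (intro exI[of _ "\<lambda>x. M x / ?P - of_int n"] conjI ballI)
    show "continuous_on N (\<lambda>x. M x / ?P - of_int n)" by (intro continuous_intros MN) auto
    show "M x / ?P - of_int n = of_real (s (f x))" if "x \<in> closure W" for x
      using n[OF that] by (simp add: field_simps)
    fix x assume x: "x \<in> L"
    then have "exp (M x) = 1" using gM[of x] by (simp add: g_def L_def)
    then obtain m :: int where "Re (M x) = 0" "Im (M x) = of_int (2 * m) * pi" unfolding exp_eq_1 by blast
    then have "M x = of_int m * ?P" by (simp add: complex_eq_iff)
    then show "M x / ?P - of_int n \<in> \<int>" by simp
  qed
qed

text \<open>The landing set \<open>Bs\<close> is compact and has distance at least \<open>d\<close>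
  from \<open>closure W\<close>. Points of \<open>N\<close> at distance above \<open>d/2\<close>
  form a relatively open set, and its components are relatively open because \<open>N\<close> is
  locally connected; finitely many of them cover \<open>Bs\<close>. Half the distance keeps even the
  closures of these pieces off \<open>closure W\<close>.\<close>

lemma components_of_exit_set:
  "\<exists>J C. finite J \<and> J \<noteq> {} \<and> J \<subseteq> Bs \<and> Bs \<subseteq> (\<Union>c\<in>J. C c) \<and>
     (\<forall>c\<in>J. c \<in> C c \<and> connected (C c) \<and> openin (top_of_set N) (C c) \<and> closure (C c) \<inter> closure W = {} \<and> C c \<subseteq> L) \<and>
     (\<forall>c\<in>J. \<forall>d\<in>J. c \<noteq> d \<longrightarrow> C c \<inter> C d = {})"
proof -
  have cWne: "closure W \<noteq> {}" using pY YW closure_subset by blast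
  obtain d where d: "d > 0" "\<And>x y. x \<in> Bs \<Longrightarrow> y \<in> closure W \<Longrightarrow> d \<le> dist x y"
    using separate_compact_closed[OF compact_Bs closed_closure Bs_cW] by blast
  have dB: "d \<le> infdist x (closure W)" if "x \<in> Bs" for x
    using d(2)[OF that] cWne by (auto simp: infdist_def intro!: cINF_greatest)
  define E where "E = N \<inter> {x. d/2 < infdist x (closure W)}"
  have "open {x. d/2 < infdist x (closure W)}" by (intro open_Collect_less continuous_intros)
  then have opE: "openin (top_of_set N) E" unfolding E_def by (simp add: openin_open_Int)
  have BE: "Bs \<subseteq> E" using dB d(1) Bs_N by (fastforce simp: E_def)
  define C where "C c = connected_component_set E c" for c
  have locE: "locally connected E" by (rule locally_open_subset[OF locN opE])
  have opC: "openin (top_of_set N) (C c)" for c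
    unfolding C_def using openin_connected_component_locally_connected[OF locE] opE openin_trans by blast
  have cC: "c \<in> C c" if "c \<in> Bs" for c using that BE by (auto simp: C_def connected_component_refl)
  have "\<exists>S. open S \<and> C c = N \<inter> S" for c using opC[of c] by (auto simp: openin_open)
  then obtain S where S: "\<And>c. open (S c)" "\<And>c. C c = N \<inter> S c" by metis
  have "Bs \<subseteq> (\<Union>c\<in>Bs. S c)" using cC S(2) by blast
  then obtain D where D: "D \<subseteq> Bs" "finite D" "Bs \<subseteq> (\<Union>c\<in>D. S c)"
    using compactE_image[OF compact_Bs, of Bs S] S(1) by metis
  \<comment> \<open>One representative for each component, itself a landing point, so that distinct
    elements of \<open>J\<close> name disjoint pieces.\<close>
  define \<rho> where "\<rho> S = (SOME c. c \<in> D \<and> C c = S)" for S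
  have \<rho>: "\<rho> S \<in> D \<and> C (\<rho> S) = S" if "S \<in> C ` D" for S
    unfolding \<rho>_def by (rule someI_ex) (use that in auto)
  define J where "J = \<rho> ` C ` D"
  have JD: "J \<subseteq> D" using \<rho> by (auto simp: J_def)
  have fin: "finite J" using D(2) by (simp add: J_def)
  have cov: "Bs \<subseteq> (\<Union>c\<in>J. C c)"
  proof
    fix y assume y: "y \<in> Bs"
    then obtain c where c: "c \<in> D" "y \<in> C c" using D(3) Bs_N S(2) by blast
    then have "C (\<rho> (C c)) = C c" "\<rho> (C c) \<in> J" using \<rho> by (auto simp: J_def)
    then show "y \<in> (\<Union>c\<in>J. C c)" using c by blast
  qed
  have disj: "C c \<inter> C e = {}" if ce: "c \<in> J" "e \<in> J" "c \<noteq> e" for c e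
  proof (rule ccontr)
    assume ne: "C c \<inter> C e \<noteq> {}"
    then obtain y where "y \<in> C c" "y \<in> C e" by blast
    then have "C c = C e" unfolding C_def by (metis connected_component_eq)
    obtain c' e' where "c' \<in> D" "c = \<rho> (C c')" "e' \<in> D" "e = \<rho> (C e')" using ce by (auto simp: J_def)
    then have "C c = C c'" "C e = C e'" using \<rho> by auto
    then show False using \<open>C c = C e\<close> \<open>c = \<rho> (C c')\<close> \<open>e = \<rho> (C e')\<close> ce(3) by simp
  qed
  have props: "c \<in> C c \<and> connected (C c) \<and> openin (top_of_set N) (C c) \<and> closure (C c) \<inter> closure W = {} \<and> C c \<subseteq> L" if c: "c \<in> J" for c
  proof (intro conjI)
    show "c \<in> C c" using cC c JD D(1) by blast
    show "connected (C c)" unfolding C_def by (rule connected_connected_component)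
    show "openin (top_of_set N) (C c)" by (rule opC)
    have CE: "C c \<subseteq> E" unfolding C_def by (rule connected_component_subset)
    have "closed {x. d/2 \<le> infdist x (closure W)}" by (intro closed_Collect_le continuous_intros)
    moreover have "C c \<subseteq> {x. d/2 \<le> infdist x (closure W)}" using CE by (auto simp: E_def)
    ultimately have "closure (C c) \<subseteq> {x. d/2 \<le> infdist x (closure W)}" by (rule closure_minimal[rotated])
    moreover have "infdist x (closure W) = 0" if "x \<in> closure W" for x using that by (rule infdist_zero)
    ultimately show *: "closure (C c) \<inter> closure W = {}" using d(1) by fastforce
    show "C c \<subseteq> L" using CE * closure_subset[of "C c"] closure_subset[of W] by (auto simp: E_def L_def)
  qed
  have "J \<noteq> {}" using cov Bs_ne by blast
  moreover have "J \<subseteq> Bs" using JD D(1) by blast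
  moreover have "\<forall>c\<in>J. c \<in> C c \<and> connected (C c) \<and> openin (top_of_set N) (C c) \<and> closure (C c) \<inter> closure W = {} \<and> C c \<subseteq> L"
    using props by (rule ballI)
  moreover have "\<forall>c\<in>J. \<forall>d\<in>J. c \<noteq> d \<longrightarrow> C c \<inter> C d = {}" using disj by (intro ballI impI)
  ultimately show ?thesis using fin cov by (intro exI[of _ J] exI[of _ C] conjI)
qed

text \<open>For each \<open>c\<close> a cut-off, 1 on the landing points in \<open>C c\<close> and 0
  on the others, is continued by \<open>integer_extension\<close> to integer values on
  \<open>L\<close>. At exit points these integers are the indicator of the piece that is hit.
  Continuous integer-valued functions are locally constant, so a colour read off from them is so as
  well.\<close>

lemma colouring_exists:
  "\<exists>J C col. finite J \<and> J \<noteq> {} \<and> J \<subseteq> Bs \<and> Bs \<subseteq> (\<Union>c\<in>J. C c) \<and>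
     (\<forall>c\<in>J. c \<in> C c \<and> connected (C c) \<and> openin (top_of_set N) (C c) \<and> closure (C c) \<inter> closure W = {} \<and> C c \<subseteq> L) \<and>
     (\<forall>c\<in>J. \<forall>d\<in>J. c \<noteq> d \<longrightarrow> C c \<inter> C d = {}) \<and>
     continuous_on L col \<and> col ` L \<subseteq> J \<and> (\<forall>x\<in>bd. f x \<in> C (col x))"
proof -
  obtain J C where JC: "finite J \<and> J \<noteq> {} \<and> J \<subseteq> Bs \<and> Bs \<subseteq> (\<Union>c\<in>J. C c) \<and>
     (\<forall>c\<in>J. c \<in> C c \<and> connected (C c) \<and> openin (top_of_set N) (C c) \<and> closure (C c) \<inter> closure W = {} \<and> C c \<subseteq> L) \<and>
     (\<forall>c\<in>J. \<forall>d\<in>J. c \<noteq> d \<longrightarrow> C c \<inter> C d = {})"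
    using components_of_exit_set by blast
  then have J: "finite J" "J \<noteq> {}" "J \<subseteq> Bs" "Bs \<subseteq> (\<Union>c\<in>J. C c)" by - (elim conjE, assumption)+
  have C': "\<forall>c\<in>J. c \<in> C c \<and> connected (C c) \<and> openin (top_of_set N) (C c) \<and> closure (C c) \<inter> closure W = {} \<and> C c \<subseteq> L"
    and disj': "\<forall>c\<in>J. \<forall>d\<in>J. c \<noteq> d \<longrightarrow> C c \<inter> C d = {}"
    using JC by - (elim conjE, assumption)+
  note C = bspec[OF C']
  have disj: "C c \<inter> C d = {}" if "c \<in> J" "d \<in> J" "c \<noteq> d" for c d using disj' that by simp
  have "\<exists>w::complex\<Rightarrow>complex. continuous_on N w \<and> (\<forall>x\<in>closure W. f x \<in> Bs \<longrightarrow> w x = (if f x \<in> C c then 1 else 0)) \<and> (\<forall>x\<in>L. w x \<in> \<int>)" if c: "c \<in> J" for c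
  proof -
    have clo: "closed (Bs - C e)" if "e \<in> J" for e
    proof -
      obtain S where S: "open S" "C e = N \<inter> S" using C[OF \<open>e \<in> J\<close>] openin_open by metis
      then have "Bs - C e = Bs - S" using Bs_N by blast
      then show ?thesis using compact_Bs S(1) by (simp add: closed_Diff compact_imp_closed)
    qed
    have eq: "Bs \<inter> C c = Bs \<inter> (\<Inter>e\<in>J-{c}. Bs - C e)"
      using J(4) disj c by blast
    have "closed (Bs \<inter> C c)" unfolding eq using clo compact_Bs by (intro closed_Int closed_INT) (auto simp: compact_imp_closed)
    moreover have "(Bs \<inter> C c) \<inter> (Bs - C c) = {}" by blast
    ultimately obtain s :: "complex \<Rightarrow> real" where s: "continuous_on UNIV s" "\<And>x. x \<in> Bs \<inter> C c \<Longrightarrow> s x = 1" "\<And>x. x \<in> Bs - C c \<Longrightarrow> s x = 0"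
      using Urysohn[OF _ clo[OF c], of "Bs \<inter> C c" 1 0] by metis
    obtain w :: "complex \<Rightarrow> complex" where "continuous_on N w" "\<And>x. x \<in> closure W \<Longrightarrow> w x = of_real (s (f x))" "\<And>x. x \<in> L \<Longrightarrow> w x \<in> \<int>"
      using integer_extension[OF s(1)] s(2,3) by blast
    then show ?thesis using s(2,3) by (intro exI[of _ w]) auto
  qed
  then obtain w :: "complex \<Rightarrow> complex \<Rightarrow> complex" where w: "\<And>c. c \<in> J \<Longrightarrow> continuous_on N (w c)"
     "\<And>c x. c \<in> J \<Longrightarrow> x \<in> closure W \<Longrightarrow> f x \<in> Bs \<Longrightarrow> w c x = (if f x \<in> C c then 1 else 0)" "\<And>c x. c \<in> J \<Longrightarrow> x \<in> L \<Longrightarrow> w c x \<in> \<int>"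
    by metis
  define Q where "Q x c \<longleftrightarrow> c \<in> J \<and> (\<forall>e\<in>J. w e x = (if e = c then 1 else 0))" for x c
  have Quni: "c = d" if "Q x c" "Q x d" for x c d using that unfolding Q_def by (metis zero_neq_one)
  obtain c0 where c0: "c0 \<in> J" using J(2) by blast
  \<comment> \<open>Away from the exit set the integers need not be the indicator of a single
    element of \<open>J\<close>; the colour is then the arbitrary \<open>c0\<close>. The rule
    depends on \<open>x\<close> only through the locally constant integers, so this default does not
    disturb continuity.\<close>
  define col where "col x = (if \<exists>c. Q x c then THE c. Q x c else c0)" for x
  have colQ: "col x = c" if "Q x c" for x c
  proof -
    have "(THE c. Q x c) = c" using that Quni by (intro the_equality) blast+
    then show ?thesis using that by (auto simp: col_def)
  qed
  have "col x \<in> J" for x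
  proof (cases "\<exists>c. Q x c")
    case True
    then obtain c where "Q x c" by blast
    then show ?thesis using colQ[of x c] by (simp add: Q_def)
  qed (simp add: col_def c0)
  then have "col ` L \<subseteq> J" by blast
  have "continuous_on L col"
    unfolding continuous_on_def
  proof
    fix x assume x: "x \<in> L"
    have LN: "L \<subseteq> N" by (auto simp: L_def)
    have "\<forall>\<^sub>F x' in at x within L. w c x' = w c x" if c: "c \<in> J" for c
    proof -
      have "(w c \<longlongrightarrow> w c x) (at x within L)"
        using continuous_on_subset[OF w(1)[OF c] LN] x by (simp add: continuous_on_def)
      then have "\<forall>\<^sub>F x' in at x within L. dist (w c x') (w c x) < 1" by (rule tendstoD) simp
      moreover have "\<forall>\<^sub>F x' in at x within L. x' \<in> L" by (simp add: eventually_at_filter)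
      ultimately show ?thesis
      proof eventually_elim
        case (elim x')
        obtain m n :: int where mn: "w c x' = of_int m" "w c x = of_int n"
          using w(3)[OF c elim(2)] w(3)[OF c x] by (auto elim!: Ints_cases)
        have "dist (w c x') (w c x) = \<bar>real_of_int (m - n)\<bar>" unfolding mn dist_norm by (metis norm_of_int of_int_diff)
        then have "m = n" using elim(1) by linarith
        then show ?case using mn by simp
      qed
    qed
    then have "\<forall>\<^sub>F x' in at x within L. \<forall>c\<in>J. w c x' = w c x"
      using J(1) by (simp add: eventually_ball_finite)
    then have "\<forall>\<^sub>F x' in at x within L. col x' = col x"
    proof eventually_elim
      case (elim x')
      then have "Q x' = Q x" by (auto simp: Q_def fun_eq_iff)
      then show ?case by (simp add: col_def)
    qed
    then show "(col \<longlongrightarrow> col x) (at x within L)" by (rule tendsto_eventually)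
  qed
  have "f x \<in> C (col x)" if x: "x \<in> bd" for x
  proof -
    have fx: "f x \<in> Bs" "x \<in> closure W" using x by (auto simp: Bs_def bd_def)
    obtain c where c: "c \<in> J" "f x \<in> C c" using fx(1) J(4) by blast
    have "Q x c" unfolding Q_def using c w(2)[OF _ fx(2,1)] disj by fastforce
    then show ?thesis using colQ c(2) by simp
  qed
  then have "\<forall>x\<in>bd. f x \<in> C (col x)" by (rule ballI)
  moreover have "\<forall>c\<in>J. c \<in> C c \<and> connected (C c) \<and> openin (top_of_set N) (C c) \<and> closure (C c) \<inter> closure W = {} \<and> C c \<subseteq> L"
    using C by (rule ballI)
  moreover have "\<forall>c\<in>J. \<forall>d\<in>J. c \<noteq> d \<longrightarrow> C c \<inter> C d = {}" using disj by (intro ballI impI)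
  ultimately show ?thesis using J \<open>col ` L \<subseteq> J\<close> \<open>continuous_on L col\<close> by (intro exI[of _ J] exI[of _ C] exI[of _ col] conjI)
qed

end

section \<open>Colourings of the exit set\<close>

locale coloured_block = planar_block +
  fixes J :: "complex set" and C :: "complex \<Rightarrow> complex set" and col :: "complex \<Rightarrow> complex"
  assumes finJ: "finite J" and neJ: "J \<noteq> {}" and JBs: "J \<subseteq> Bs" and covJ: "Bs \<subseteq> (\<Union>c\<in>J. C c)"
    and C: "\<And>c. c \<in> J \<Longrightarrow> c \<in> C c \<and> connected (C c) \<and> openin (top_of_set N) (C c) \<and> closure (C c) \<inter> closure W = {} \<and> C c \<subseteq> L"
    and disjC: "\<And>c d. c \<in> J \<Longrightarrow> d \<in> J \<Longrightarrow> c \<noteq> d \<Longrightarrow> C c \<inter> C d = {}"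
    and colc: "continuous_on L col" and colJ: "\<And>x. x \<in> L \<Longrightarrow> col x \<in> J" and colf: "\<And>x. x \<in> bd \<Longrightarrow> f x \<in> C (col x)"
begin

text \<open>AA n are the points of N whose iterates up to the n-th stay in closure W; SS n are those which have
  met L by then, and \<open>\<psi> n\<close> is the colour which the (n+1)-st iterate of such a point would have.\<close>
primrec AA :: "nat \<Rightarrow> complex set" where
  "AA 0 = closure W"
| "AA (Suc n) = {x \<in> closure W. f x \<in> AA n}"

primrec SS :: "nat \<Rightarrow> complex set" where
  "SS 0 = L"
| "SS (Suc n) = L \<union> {x \<in> closure W. f x \<in> SS n}"

primrec \<psi> :: "nat \<Rightarrow> complex \<Rightarrow> complex" where
  "\<psi> 0 = col"
| "\<psi> (Suc n) = (\<lambda>x. if x \<in> L then (col ^^ Suc (Suc n)) x else \<psi> n (f x))"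

lemma JL: "c \<in> J \<Longrightarrow> c \<in> L" using C by blast

lemma colL: "x \<in> L \<Longrightarrow> (col ^^ n) x \<in> L"
proof (induction n)
  case (Suc n)
  then show ?case using colJ JL by simp
qed simp

text \<open>\<open>C c\<close> is connected and \<open>col\<close> takes finitely many values on it.
  The colour of a landing point thus depends only on its piece, which makes \<open>col\<close> on
  \<open>J\<close> describe how colours continue.\<close>

lemma col_const:
  assumes "c \<in> J" "y \<in> C c"
  shows "col y = col c"
proof -
  have "col constant_on C c"
  proof (rule continuous_finite_range_constant)
    show "connected (C c)" using C[OF assms(1)] by blast
    show "continuous_on (C c) col" by (rule continuous_on_subset[OF colc]) (use C[OF assms(1)] in blast)
    show "finite (col ` C c)"
      by (rule finite_subset[OF _ finJ]) (use C[OF assms(1)] colJ in blast)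
  qed
  then show ?thesis using assms C unfolding constant_on_def by metis
qed

lemma AA_sub: "AA n \<subseteq> closure W" by (cases n) auto

lemma LSS: "L \<subseteq> SS n" by (cases n) auto

lemma psi_L: "x \<in> L \<Longrightarrow> \<psi> n x = (col ^^ Suc n) x" by (cases n) auto

lemma funpow_Suc_f: "(f ^^ n) (f x) = (f ^^ Suc n) x" by (simp add: funpow_swap1)

lemma SSN: "SS n \<subseteq> N" by (cases n) (use cWN in \<open>auto simp: L_def\<close>)

lemma AA_SS_un: "AA n \<union> SS n = N"
proof (induction n)
  case 0
  then show ?case using N_un by simp
next
  case (Suc n)
  show ?case
  proof
    show "AA (Suc n) \<union> SS (Suc n) \<subseteq> N" using AA_sub[of "Suc n"] SSN[of "Suc n"] cWN by blast
    show "N \<subseteq> AA (Suc n) \<union> SS (Suc n)"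
    proof
      fix x assume x: "x \<in> N"
      show "x \<in> AA (Suc n) \<union> SS (Suc n)"
      proof (cases "x \<in> L")
        case False
        then have "x \<in> closure W" using x N_un by blast
        moreover have "f x \<in> AA n \<union> SS n" using fW calculation Suc by blast
        ultimately show ?thesis by auto
      qed simp
    qed
  qed
qed

lemma AA_iter: "x \<in> AA n \<Longrightarrow> i \<le> n \<Longrightarrow> (f ^^ i) x \<in> closure W"
proof (induction n arbitrary: x i)
  case (Suc n)
  show ?case
  proof (cases i)
    case (Suc i')
    have "f x \<in> AA n" "i' \<le> n" using Suc.prems Suc by auto
    then have "(f ^^ i') (f x) \<in> closure W" by (rule Suc.IH)
    then show ?thesis using Suc by (simp only: funpow_Suc_f)
  qed (use Suc.prems in auto)
qed auto

lemma AA_image: "x \<in> AA n \<Longrightarrow> (f ^^ Suc n) x \<in> f ` closure W"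
  using AA_iter[of x n n] by simp

lemma AA_N: "x \<in> AA n \<Longrightarrow> (f ^^ Suc n) x \<in> N" using AA_image fW by blast

lemma closedAA: "closed (AA n)"
proof (induction n)
  case (Suc n)
  have "AA (Suc n) = closure W \<inter> f -` AA n" by auto
  then show ?case using continuous_closed_preimage[OF contf_cW closed_closure Suc] by simp
qed simp

lemma closedSS: "closed (SS n)"
proof (induction n)
  case (Suc n)
  have "SS (Suc n) = L \<union> (closure W \<inter> f -` SS n)" by auto
  then show ?case using continuous_closed_preimage[OF contf_cW closed_closure Suc] closedL by (simp only: closed_Un)
qed (simp add: closedL)

lemma contfn: "continuous_on (AA n) (f ^^ Suc n)"
  by (rule continuous_on_funpow[OF contf_cW]) (use AA_iter in auto)

text \<open>On the overlap the orbit meets \<open>L\<close> at the last moment considered: after an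
  earlier visit the next iterate would be a landing point, off \<open>closure W\<close>, against
  membership in \<open>AA n\<close>. Hence it is the iterate \<open>Suc n\<close> that lands, in the
  piece named by \<open>\<psi> n\<close>.\<close>

lemma AA_SS: "x \<in> AA n \<Longrightarrow> x \<in> SS n \<Longrightarrow> (f ^^ Suc n) x \<in> C (\<psi> n x) \<and> (f ^^ Suc n) x \<in> Bs \<and> \<psi> n x \<in> J"
proof (induction n arbitrary: x)
  case 0
  then have "x \<in> bd" using bd_eq by auto
  then show ?case using colf colJ 0 by (auto simp: Bs_def)
next
  case (Suc n)
  have x: "x \<in> closure W" "f x \<in> AA n" using Suc.prems by auto
  have "x \<notin> L"
  proof
    assume "x \<in> L"
    then have "f x \<in> Bs" using x bd_eq by (auto simp: Bs_def)
    then show False using Bs_cW AA_sub x(2) by blast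
  qed
  then have "f x \<in> SS n" "\<psi> (Suc n) x = \<psi> n (f x)" using Suc.prems by auto
  then show ?case using Suc.IH[OF x(2)] by (simp only: funpow_Suc_f)
qed

lemma psi_cont: "continuous_on (SS n) (\<psi> n) \<and> \<psi> n ` SS n \<subseteq> J"
proof (induction n)
  case 0
  then show ?case using colc colJ by auto
next
  case (Suc n)
  let ?Z = "closure W \<inter> f -` SS n"
  have eqS: "SS (Suc n) = L \<union> ?Z" by auto
  have clZ: "closed ?Z" using continuous_closed_preimage[OF contf_cW closed_closure closedSS] by simp
  have "continuous_on (L \<union> ?Z) (\<lambda>x. if x \<in> L then (col ^^ Suc (Suc n)) x else \<psi> n (f x))"
  proof (rule continuous_on_cases[OF closedL clZ])
    show "continuous_on L (col ^^ Suc (Suc n))"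
      by (rule continuous_on_funpow[OF colc]) (use colL in auto)
    show "continuous_on ?Z (\<lambda>x. \<psi> n (f x))"
      by (rule continuous_on_compose2[OF conjunct1[OF Suc] continuous_on_subset[OF contf_cW]]) auto
    \<comment> \<open>The two rules meet at exit points. There \<open>f x\<close> lies in the piece
      of \<open>col x\<close>, so both have the same colour, and following colours from
      \<open>f x\<close> continues those of \<open>x\<close> one step later.\<close>
    show "\<forall>x. x \<in> L \<and> x \<notin> L \<or> x \<in> ?Z \<and> x \<in> L \<longrightarrow> (col ^^ Suc (Suc n)) x = \<psi> n (f x)"
    proof (intro allI impI)
      fix x assume "x \<in> L \<and> x \<notin> L \<or> x \<in> ?Z \<and> x \<in> L"
      then have x: "x \<in> L" "x \<in> bd" using bd_eq by auto
      then have fx: "f x \<in> C (col x)" "col x \<in> J" using colf colJ by auto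
      then have "f x \<in> L" using C by blast
      then have "\<psi> n (f x) = (col ^^ Suc n) (f x)" by (rule psi_L)
      also have "\<dots> = (col ^^ n) (col (f x))" by (simp add: funpow_swap1)
      also have "col (f x) = col (col x)" using col_const[OF fx(2,1)] .
      also have "(col ^^ n) (col (col x)) = (col ^^ Suc (Suc n)) x" by (simp add: funpow_swap1)
      finally show "(col ^^ Suc (Suc n)) x = \<psi> n (f x)" by simp
    qed
  qed
  then have "continuous_on (SS (Suc n)) (\<psi> (Suc n))" using eqS by simp
  moreover have "\<psi> (Suc n) x \<in> J" if "x \<in> SS (Suc n)" for x
  proof (cases "x \<in> L")
    case True
    then have "(col ^^ Suc n) x \<in> L" by (rule colL)
    then show ?thesis using colJ True by simp
  next
    case False
    then have "f x \<in> SS n" using that by auto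
    then show ?thesis using Suc False by auto
  qed
  ultimately show ?case by blast
qed

lemma psi_J: "x \<in> SS n \<Longrightarrow> \<psi> n x \<in> J" using psi_cont by blast

lemma Y_SS: "y \<in> Y \<Longrightarrow> y \<notin> SS n"
proof (induction n arbitrary: y)
  case 0
  then show ?case using YW by (auto simp: L_def)
next
  case (Suc n)
  then have "y \<notin> L" "f y \<in> Y" using YW fY by (auto simp: L_def)
  then show ?case using Suc.IH by auto
qed

lemma Y_AA: "Y \<subseteq> AA n" using Y_SS AA_SS_un YN' by blast

lemma Y_iter: "y \<in> Y \<Longrightarrow> (f ^^ n) y \<in> Y" by (induction n) (use fY in auto)

text \<open>For \<open>y\<close> in the closure of a landing piece and \<open>x\<close> outside
  \<open>Gam\<close> the difference \<open>x - y\<close> does not vanish. \<open>Om\<close> is the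
  connected part around \<open>p\<close> of such points \<open>x\<close>; over it logarithms
  comparing \<open>x - y\<close> with \<open>x - c\<close> are defined.\<close>

definition "Gam = (\<Union>c\<in>J. closure (C c))"
definition "Om = connected_component_set (- Gam) p"

lemma CN: "c \<in> J \<Longrightarrow> closure (C c) \<subseteq> N"
  by (rule closure_minimal[OF _ clN]) (use C in \<open>auto simp: L_def\<close>)

lemma GamN: "Gam \<subseteq> N" using CN by (auto simp: Gam_def)

lemma Gam_cW: "Gam \<inter> closure W = {}" using C by (auto simp: Gam_def)

lemma closedGam: "closed Gam" unfolding Gam_def using finJ by (intro closed_UN) auto

lemma pcW: "p \<in> closure W" using pY YW closure_subset by blast

lemma Om: "open Om" "connected Om" "Om \<inter> Gam = {}" "p \<in> Om"
proof -
  show "open Om" unfolding Om_def by (rule open_connected_component) (simp add: closedGam open_Compl)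
  show "connected Om" unfolding Om_def by (rule connected_connected_component)
  show "Om \<inter> Gam = {}" using connected_component_subset[of "- Gam" p] by (auto simp: Om_def)
  have "p \<in> - Gam" using pcW Gam_cW by blast
  then show "p \<in> Om" unfolding Om_def by (simp add: connected_component_refl)
qed

lemma Om_max: "connected Z \<Longrightarrow> Z \<inter> Gam = {} \<Longrightarrow> Z \<inter> closure W \<noteq> {} \<Longrightarrow> Z \<subseteq> Om"
proof -
  assume Z: "connected Z" "Z \<inter> Gam = {}" "Z \<inter> closure W \<noteq> {}"
  have "connected (Z \<union> closure W)"
    by (rule connected_Un[OF Z(1) connected_imp_connected_closure[OF conW] Z(3)])
  then have "Z \<union> closure W \<subseteq> Om" unfolding Om_def
    by (intro connected_component_maximal) (use pcW Z Gam_cW in auto)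
  then show "Z \<subseteq> Om" by blast
qed

lemma cW_Om: "closure W \<subseteq> Om"
  by (rule Om_max[OF connected_imp_connected_closure[OF conW]]) (use Gam_cW pcW in auto)

lemma hole_Om:
  assumes Z: "connected Z" "Z \<inter> N = {}" "closure Z \<inter> closure W \<noteq> {}"
  shows "Z \<subseteq> Om"
proof -
  obtain b where b: "b \<in> closure Z" "b \<in> closure W" using Z(3) by blast
  have "connected (insert b Z)"
    using connected_intermediate_closure[OF Z(1), of "insert b Z"] b(1) closure_subset[of Z] by blast
  moreover have "insert b Z \<inter> Gam = {}" using Z(2) GamN Gam_cW b(2) by blast
  ultimately have "insert b Z \<subseteq> Om" by (rule Om_max) (use b(2) in blast)
  then show ?thesis by blast
qed

text \<open>Over a hole that is not good, \<open>\<psi> n \<circ> r\<close> is constant, so only good holes contribute to the index.\<close>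
definition "good = {a \<in> A. r ` (V a - {a}) \<inter> closure W \<noteq> {}}"
definition "infgood \<longleftrightarrow> r ` Vinf \<inter> closure W \<noteq> {}"

lemma VN: "a \<in> A \<Longrightarrow> V a \<inter> N = {}" "Vinf \<inter> N = {}" using complN by blast+

lemma good_Om: "a \<in> good \<Longrightarrow> V a \<subseteq> Om"
proof -
  assume a: "a \<in> good"
  then obtain x where x: "x \<in> V a - {a}" "r x \<in> closure W" "a \<in> A" by (auto simp: good_def)
  then have "r x \<in> closure (V a)" using rV by blast
  then show ?thesis using hole_Om[of "V a"] V[OF x(3)] VN(1)[OF x(3)] x(2) by blast
qed

lemma infgood_Om: "infgood \<Longrightarrow> Vinf \<subseteq> Om"
proof -
  assume infgood
  then obtain x where x: "x \<in> Vinf" "r x \<in> closure W" by (auto simp: infgood_def)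
  then have "r x \<in> closure Vinf" using rVi by blast
  then show ?thesis using hole_Om[OF conVi VN(2)] x(2) by blast
qed

text \<open>The correction is available wherever it is called for: it enters only when
  \<open>r x\<close> lies in \<open>closure W\<close>, and a hole over which this happens touches
  \<open>closure W\<close> and belongs to \<open>Om\<close> entirely.\<close>

lemma r_cW_Om:
  assumes "x \<notin> A" "r x \<in> closure W"
  shows "x \<in> Om"
proof -
  consider "x \<in> N" | "x \<in> Vinf" | a where "a \<in> A" "x \<in> V a" using complN by blast
  then show ?thesis
  proof cases
    case 1
    then show ?thesis using rid assms cW_Om by auto
  next
    case 2
    then have infgood using assms by (auto simp: infgood_def)
    then show ?thesis using infgood_Om 2 by blast
  next
    case 3
    then have "a \<in> good" using assms by (auto simp: good_def)
    then show ?thesis using good_Om 3 by blast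
  qed
qed

text \<open>If \<open>r\<close> sends part of the outside region into \<open>closure W\<close>, the
  base point is taken far out: there it is outside \<open>N\<close>, hence missed by
  \<open>f\<close>, and cross ratios on the far circle are close to 1. The factor 100 is a margin
  for these estimates. Otherwise the base point is the point of \<open>W\<close> that the absence of
  a source provides.\<close>

lemma y0_exists: "\<exists>y0. y0 \<in> Om \<and> y0 \<notin> f ` closure W \<and> (infgood \<longrightarrow> y0 = p + of_real (100 * \<sigma>))"
proof (cases infgood)
  case True
  have "p + of_real (100 * \<sigma>) \<notin> ball p \<sigma>" using \<sigma> by (simp add: dist_norm)
  then have "p + of_real (100 * \<sigma>) \<in> Vinf" "p + of_real (100 * \<sigma>) \<notin> N" using far N\<sigma> by blast+
  then show ?thesis using infgood_Om[OF True] fW by blast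
next
  case False
  then show ?thesis using y0ex cW_Om closure_subset by blast
qed

end

section \<open>The corrected displacement function\<close>

lemma cross_ratio_near_1:
  fixes u v a b :: complex
  assumes "norm u = 100 * s" "norm v = 100 * s" "norm a < s" "norm b < s"
  shows "norm ((u - a) * (v - b) / ((u - b) * (v - a)) - 1) < 1/16" "u - b \<noteq> 0" "v - a \<noteq> 0"
proof -
  have s: "s > 0" using assms(3) norm_ge_zero[of a] by linarith
  have 1: "norm (u - b) \<ge> 99 * s" using norm_triangle_ineq2[of u b] assms by linarith
  have 2: "norm (v - a) \<ge> 99 * s" using norm_triangle_ineq2[of v a] assms by linarith
  have "norm (u - b) > 0" "norm (v - a) > 0" using 1 2 s by linarith+
  then show nz: "u - b \<noteq> 0" "v - a \<noteq> 0" by auto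
  have "(u - a) * (v - b) / ((u - b) * (v - a)) - 1 = (u - v) * (a - b) / ((u - b) * (v - a))"
  proof -
    have "(u - a) * (v - b) - (u - b) * (v - a) = (u - v) * (a - b)" by (simp add: algebra_simps)
    then show ?thesis using nz by (metis diff_divide_distrib divide_self no_zero_divisors)
  qed
  then have "norm ((u - a) * (v - b) / ((u - b) * (v - a)) - 1) = (norm (u - v) * norm (a - b)) / (norm (u - b) * norm (v - a))"
    by (simp add: norm_mult norm_divide)
  also have "\<dots> \<le> (200 * s * (2 * s)) / ((99 * s) * (99 * s))"
  proof (rule frac_le)
    have "norm (u - v) \<le> 200 * s" using norm_triangle_ineq4[of u v] assms by linarith
    moreover have "norm (a - b) \<le> 2 * s" using norm_triangle_ineq4[of a b] assms by linarith
    ultimately show "norm (u - v) * norm (a - b) \<le> 200 * s * (2 * s)" using s by (intro mult_mono) auto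
    show "99 * s * (99 * s) \<le> norm (u - b) * norm (v - a)" using 1 2 s by (intro mult_mono) auto
  qed (use s in auto)
  \<comment> \<open>The quotient is \<open>400 / 9801\<close>. A bound of 1/16 later gives principal
    logarithms of modulus at most 1/8.\<close>
  also have "\<dots> < 1/16" using s by simp
  finally show "norm ((u - a) * (v - b) / ((u - b) * (v - a)) - 1) < 1/16" .
qed

lemma norm_minus_1_nonpos: "norm (w - 1) < 1 \<Longrightarrow> w \<notin> \<real>\<^sub>\<le>\<^sub>0" for w :: complex
proof -
  assume "norm (w - 1) < 1"
  then have "\<bar>Re (w - 1)\<bar> < 1" using abs_Re_le_cmod le_less_trans by blast
  then show ?thesis by (auto simp: complex_nonpos_Reals_iff)
qed

text \<open>A tube argument over a compact set of parameters \<open>q\<close>; it serves to freeze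
  the variable \<open>x\<close> at a puncture \<open>a\<close> when the order there is
  computed.\<close>

lemma near_slice:
  fixes F :: "complex \<times> complex \<Rightarrow> complex"
  assumes "open S" "a \<in> S" "compact K" "continuous_on (S \<times> K) F" "\<And>q. q \<in> K \<Longrightarrow> F (a, q) = 1"
  shows "\<exists>e>0. ball a e \<subseteq> S \<and> (\<forall>x\<in>ball a e. \<forall>q\<in>K. norm (F (x, q) - 1) < 1)"
proof -
  obtain d where d: "d > 0" "cball a d \<subseteq> S" using assms(1,2) open_contains_cball by blast
  have "continuous_on (cball a d \<times> K) F" by (rule continuous_on_subset[OF assms(4)]) (use d in auto)
  then have "uniformly_continuous_on (cball a d \<times> K) F"
    using assms(3) by (intro compact_uniformly_continuous) (auto intro: compact_Times)
  then obtain e where e: "e > 0" "\<And>z z'. z \<in> cball a d \<times> K \<Longrightarrow> z' \<in> cball a d \<times> K \<Longrightarrow> dist z' z < e \<Longrightarrow> dist (F z') (F z) < 1"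
    unfolding uniformly_continuous_on_def by (metis zero_less_one)
  have "norm (F (x, q) - 1) < 1" if "x \<in> ball a (min d e)" "q \<in> K" for x q
  proof -
    have "dist (F (x, q)) (F (a, q)) < 1"
      by (rule e(2)) (use that d in \<open>auto simp: dist_Pair_Pair dist_commute\<close>)
    then show ?thesis using assms(5)[OF that(2)] by (simp add: dist_norm)
  qed
  then show ?thesis using d e(1) by (intro exI[of _ "min d e"]) auto
qed

locale pointed_block = coloured_block +
  fixes y0 :: complex
  assumes y0Om: "y0 \<in> Om" and y0f: "y0 \<notin> f ` closure W" and y0far: "infgood \<Longrightarrow> y0 = p + of_real (100 * \<sigma>)"
begin

lemma CGam: "c \<in> J \<Longrightarrow> C c \<subseteq> Gam" using closure_subset[of "C c"] by (auto simp: Gam_def)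

lemma JGam: "c \<in> J \<Longrightarrow> c \<in> Gam" using C[of c] CGam[of c] by blast

lemma y0J: "c \<in> J \<Longrightarrow> y0 \<noteq> c" using JGam y0Om Om(3) by blast

lemma JN: "c \<in> J \<Longrightarrow> c \<in> N" using JL by (auto simp: L_def)

text \<open>The right-hand side is a cross ratio: the quotient of the displacements from
  \<open>y\<close> and from \<open>c\<close>, both normalised at \<open>y0\<close>. It is 1 for
  \<open>x = y0\<close> and for \<open>y = c\<close>, as \<open>two_variable_log\<close> requires on
  each landing piece. A cut-off in \<open>y\<close> extends the logarithm by 0 to all of
  \<open>N\<close> without changing it on \<open>Bs\<close>.\<close>

lemma lam_exists:
  "\<exists>l. continuous_on (Om \<times> N) (\<lambda>(x,y). l x y) \<and>
     (\<forall>c\<in>J. \<forall>y\<in>Bs \<inter> C c. \<forall>x\<in>Om. exp (l x y) = (x - y) * (y0 - c) / ((x - c) * (y0 - y))) \<and>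
     (infgood \<longrightarrow> (\<forall>x\<in>sphere p (100 * \<sigma>). \<forall>y\<in>N. norm (l x y) \<le> 1/2))"
proof -
  define \<kappa> where "\<kappa> c x y = (x - y) * (y0 - c) / ((x - c) * (y0 - y))" for c x y
  have nOm: "x \<noteq> y" if "x \<in> Om" "y \<in> closure (C c)" "c \<in> J" for x y c
    using that Om(3) by (auto simp: Gam_def)
  have "\<exists>l. continuous_on (Om \<times> closure (C c)) (\<lambda>(x,y). l x y) \<and>
     (\<forall>x\<in>Om. \<forall>y\<in>closure (C c). exp (l x y) = \<kappa> c x y) \<and> (\<forall>y\<in>closure (C c). l y0 y = 0)" if c: "c \<in> J" for c
  proof (rule two_variable_log[OF Om(1,2)])
    have cc: "c \<in> closure (C c)" using C[OF c] closure_subset by blast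
    then show "c \<in> closure (C c)" .
    show "connected (closure (C c))" using C[OF c] connected_imp_connected_closure by blast
    show "continuous_on (Om \<times> closure (C c)) (\<lambda>(x, y). \<kappa> c x y)"
      unfolding \<kappa>_def case_prod_unfold
      by (intro continuous_intros) (use nOm[OF _ cc c] nOm[OF y0Om _ c] in auto)
    show "\<kappa> c x y \<noteq> 0" if "x \<in> Om" "y \<in> closure (C c)" for x y
      unfolding \<kappa>_def using nOm[OF that c] nOm[OF that(1) cc c] nOm[OF y0Om that(2) c] y0J[OF c] by auto
    show "y0 \<in> Om" by (rule y0Om)
    show "\<kappa> c y0 y = 1" if "y \<in> closure (C c)" for y
      unfolding \<kappa>_def using nOm[OF y0Om that c] y0J[OF c] by simp
    show "\<kappa> c x c = 1" if "x \<in> Om" for x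
      unfolding \<kappa>_def using nOm[OF that cc c] y0J[OF c] by simp
  qed
  then obtain l where l: "\<And>c. c \<in> J \<Longrightarrow> continuous_on (Om \<times> closure (C c)) (\<lambda>(x,y). l c x y)"
     "\<And>c x y. c \<in> J \<Longrightarrow> x \<in> Om \<Longrightarrow> y \<in> closure (C c) \<Longrightarrow> exp (l c x y) = \<kappa> c x y"
     "\<And>c y. c \<in> J \<Longrightarrow> y \<in> closure (C c) \<Longrightarrow> l c y0 y = 0" by metis
  have "\<exists>S. open S \<and> C c = N \<inter> S" if "c \<in> J" for c using C[OF that] by (auto simp: openin_open)
  then obtain S where S: "\<And>c. c \<in> J \<Longrightarrow> open (S c)" "\<And>c. c \<in> J \<Longrightarrow> C c = N \<inter> S c" by metis
  define E where "E = N - (\<Union>c\<in>J. C c)"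
  have "E = N - (\<Union>c\<in>J. S c)" using S(2) by (auto simp: E_def)
  then have "closed E" using clN S(1) by (auto intro!: closed_Diff)
  moreover have "closed Bs" using compact_Bs compact_imp_closed by blast
  moreover have "Bs \<inter> E = {}" using covJ by (auto simp: E_def)
  ultimately obtain t :: "complex \<Rightarrow> real" where t: "continuous_on UNIV t" "\<And>x. t x \<in> closed_segment 0 1"
     "\<And>x. x \<in> Bs \<Longrightarrow> t x = 0" "\<And>x. x \<in> E \<Longrightarrow> t x = 1"
    using Urysohn[of Bs E 0 "1::real"] by metis
  have t01: "0 \<le> t x" "t x \<le> 1" for x using t(2)[of x] by (auto simp: closed_segment_eq_real_ivl)
  define m where "m c x y = (if y \<in> C c then (1 - of_real (t y)) * l c x y else 0)" for c x y
  have bE: "y \<in> E" if c: "c \<in> J" and y: "y \<in> closure (C c)" "y \<notin> C c" for y c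
  proof -
    have "y \<notin> C d" if d: "d \<in> J" for d
    proof
      assume yd: "y \<in> C d"
      then have "d \<noteq> c" using y(2) by blast
      have "y \<in> S d" using yd S(2)[OF d] by blast
      then have "S d \<inter> C c \<noteq> {}" using y(1) S(1)[OF d] by (metis disjoint_iff open_Int_closure_eq_empty)
      then have "C d \<inter> C c \<noteq> {}" using S(2)[OF d] S(2)[OF c] by blast
      then show False using disjC[OF d c \<open>d \<noteq> c\<close>] by blast
    qed
    then show ?thesis using CN[OF c] y(1) by (auto simp: E_def)
  qed
  have mc: "continuous_on (Om \<times> N) (\<lambda>q. m c (fst q) (snd q))" if c: "c \<in> J" for c
  proof -
    have un: "(Om \<times> closure (C c)) \<union> (Om \<times> (N - C c)) = Om \<times> N"
      using CN[OF c] C[OF c] closure_subset[of "C c"] by (auto simp: L_def)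
    have "continuous_on ((Om \<times> closure (C c)) \<union> (Om \<times> (N - C c)))
       (\<lambda>q. if snd q \<in> C c then (1 - of_real (t (snd q))) * l c (fst q) (snd q) else 0)"
    proof (rule continuous_on_cases_local)
      have "(Om \<times> closure (C c)) = (Om \<times> N) \<inter> (UNIV \<times> closure (C c))" using CN[OF c] by auto
      then show "closedin (top_of_set ((Om \<times> closure (C c)) \<union> (Om \<times> (N - C c)))) (Om \<times> closure (C c))"
        unfolding un closedin_closed by (metis closed_Times closed_UNIV closed_closure)
      have "(Om \<times> (N - C c)) = (Om \<times> N) \<inter> (UNIV \<times> (- S c))" using S(2)[OF c] by auto
      then show "closedin (top_of_set ((Om \<times> closure (C c)) \<union> (Om \<times> (N - C c)))) (Om \<times> (N - C c))"
        unfolding un closedin_closed using S(1)[OF c] by (metis closed_Times closed_UNIV closed_Compl)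
      have "continuous_on (Om \<times> closure (C c)) (\<lambda>q. l c (fst q) (snd q))"
        using l(1)[OF c] by (simp add: case_prod_unfold)
      moreover have "continuous_on (Om \<times> closure (C c)) (\<lambda>q. t (snd q))"
        by (rule continuous_on_compose2[OF t(1)]) (auto intro!: continuous_intros)
      ultimately show "continuous_on (Om \<times> closure (C c)) (\<lambda>q. (1 - of_real (t (snd q))) * l c (fst q) (snd q))"
        by (intro continuous_intros)
      show "(1 - of_real (t (snd q))) * l c (fst q) (snd q) = 0"
        if "q \<in> Om \<times> closure (C c) \<and> snd q \<notin> C c \<or> q \<in> Om \<times> (N - C c) \<and> snd q \<in> C c" for q
        using that bE[OF c, of "snd q"] t(4)[of "snd q"] by auto
    qed auto
    then show ?thesis unfolding un m_def .
  qed
  define \<Lambda> where "\<Lambda> x y = (\<Sum>c\<in>J. m c x y)" for x y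
  have \<Lambda>c: "\<Lambda> x y = m c x y" if c: "c \<in> J" and y: "y \<in> C c" for c x y
  proof -
    have "m d x y = 0" if "d \<in> J - {c}" for d using disjC[of c d] that c y by (auto simp: m_def)
    then have "(\<Sum>d\<in>J - {c}. m d x y) = 0" by (intro sum.neutral) blast
    then show ?thesis unfolding \<Lambda>_def using sum.remove[OF finJ c, of "\<lambda>d. m d x y"] by simp
  qed
  have bound: "norm (\<Lambda> x y) \<le> 1/2" if inf: infgood and x: "x \<in> sphere p (100 * \<sigma>)" and y: "y \<in> N" for x y
  proof (cases "\<exists>c\<in>J. y \<in> C c")
    case False
    then have "\<Lambda> x y = 0" by (auto simp: \<Lambda>_def m_def)
    then show ?thesis by simp
  next
    case True
    then obtain c where c: "c \<in> J" "y \<in> C c" by blast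
    have sph: "sphere p (100 * \<sigma>) \<subseteq> Om" using infgood_Om[OF inf] far \<sigma> by force
    have ysph: "y0 \<in> sphere p (100 * \<sigma>)" using y0far[OF inf] \<sigma> by (simp add: dist_norm)
    have yc: "y \<in> closure (C c)" using c(2) closure_subset by blast
    have near: "norm (\<kappa> c z y - 1) < 1/16" if "z \<in> sphere p (100 * \<sigma>)" for z
    proof -
      have "norm ((z - p) - (y - p)) = norm (z - y)" by simp
      have "norm (((z - p) - (y - p)) * ((y0 - p) - (c - p)) / (((z - p) - (c - p)) * ((y0 - p) - (y - p))) - 1) < 1/16"
        by (rule cross_ratio_near_1(1)[of _ \<sigma>])
           (use that ysph subsetD[OF N\<sigma> y] subsetD[OF N\<sigma> JN[OF c(1)]] in \<open>auto simp: dist_norm norm_minus_commute\<close>)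
      then show ?thesis by (simp add: \<kappa>_def)
    qed
    \<comment> \<open>Both are logarithms of the same cross ratio along the connected far circle,
      and both are 0 at \<open>y0\<close>, which lies on that circle in this case.\<close>
    have "l c x y = Ln (\<kappa> c x y)"
    proof (rule exp_eq_imp_eq[where S = "sphere p (100 * \<sigma>)" and L = "\<lambda>z. l c z y" and M = "\<lambda>z. Ln (\<kappa> c z y)" and ?x0.0 = y0])
      show "connected (sphere p (100 * \<sigma>))" by (rule connected_sphere) simp
      have "continuous_on (sphere p (100 * \<sigma>)) (\<lambda>z. case (z, y) of (x, y) \<Rightarrow> l c x y)"
        by (rule continuous_on_compose2[OF l(1)[OF c(1)]]) (use sph yc in \<open>auto intro!: continuous_intros\<close>)
      then show "continuous_on (sphere p (100 * \<sigma>)) (\<lambda>z. l c z y)" by simp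
      have "continuous_on (sphere p (100 * \<sigma>)) (\<lambda>z. \<kappa> c z y)"
        unfolding \<kappa>_def by (intro continuous_intros)
          (use sph nOm[OF _ yc c(1)] nOm[OF y0Om yc c(1)] JGam[OF c(1)] Om(3) in auto)
      then show "continuous_on (sphere p (100 * \<sigma>)) (\<lambda>z. Ln (\<kappa> c z y))"
        by (rule continuous_on_Ln') (use near[THEN less_trans, THEN norm_minus_1_nonpos] in simp)
      show "exp (l c z y) = exp (Ln (\<kappa> c z y))" if "z \<in> sphere p (100 * \<sigma>)" for z
      proof -
        have "\<kappa> c z y \<notin> \<real>\<^sub>\<le>\<^sub>0" by (rule norm_minus_1_nonpos) (use near[OF that] in linarith)
        then have "\<kappa> c z y \<noteq> 0" by auto
        then show ?thesis using l(2)[OF c(1) _ yc, of z] sph that by auto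
      qed
      show "l c y0 y = Ln (\<kappa> c y0 y)"
        using l(3)[OF c(1) yc] nOm[OF y0Om yc c(1)] y0J[OF c(1)] by (simp add: \<kappa>_def)
    qed (use ysph x in auto)
    moreover have "norm (Ln (1 + (\<kappa> c x y - 1))) \<le> 2 * norm (\<kappa> c x y - 1)"
      by (rule norm_Ln_le) (use near[OF x] in linarith)
    ultimately have "norm (l c x y) \<le> 1/8" using near[OF x] by simp
    moreover have "norm (m c x y) \<le> norm (l c x y)"
    proof -
      have "norm (1 - complex_of_real (t y)) \<le> 1"
      proof -
        have "1 - complex_of_real (t y) = of_real (1 - t y)" by simp
        then have "norm (1 - complex_of_real (t y)) = \<bar>1 - t y\<bar>" by (simp only: norm_of_real)
        then show ?thesis using t01[of y] by simp
      qed
      then have "norm (1 - complex_of_real (t y)) * norm (l c x y) \<le> 1 * norm (l c x y)" by (intro mult_right_mono) auto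
      then show ?thesis using c(2) by (simp add: m_def norm_mult)
    qed
    ultimately show ?thesis using \<Lambda>c[OF c] by simp
  qed
  show ?thesis
  proof (intro exI[of _ \<Lambda>] conjI ballI impI)
    show "continuous_on (Om \<times> N) (\<lambda>(x, y). \<Lambda> x y)"
      unfolding \<Lambda>_def case_prod_unfold by (intro continuous_on_sum mc)
    show "exp (\<Lambda> x y) = (x - y) * (y0 - c) / ((x - c) * (y0 - y))" if "c \<in> J" "y \<in> Bs \<inter> C c" "x \<in> Om" for c y x
    proof -
      have yc: "y \<in> closure (C c)" using that(2) closure_subset by blast
      have "\<Lambda> x y = l c x y" using \<Lambda>c[OF that(1), of y] that(2) t(3)[of y] by (simp add: m_def)
      then show ?thesis using l(2)[OF that(1,3) yc] by (simp add: \<kappa>_def)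
    qed
  qed (use bound in blast)
qed

text \<open>The factor \<open>exp (- lam)\<close> makes the two cases in the definition of U agree where AA and SS overlap.\<close>
definition "lam = (SOME l. continuous_on (Om \<times> N) (\<lambda>(x,y). l x y) \<and>
     (\<forall>c\<in>J. \<forall>y\<in>Bs \<inter> C c. \<forall>x\<in>Om. exp (l x y) = (x - y) * (y0 - c) / ((x - c) * (y0 - y))) \<and>
     (infgood \<longrightarrow> (\<forall>x\<in>sphere p (100 * \<sigma>). \<forall>y\<in>N. norm (l x y) \<le> 1/2)))"

lemma lam_spec: "continuous_on (Om \<times> N) (\<lambda>(x,y). lam x y) \<and>
     (\<forall>c\<in>J. \<forall>y\<in>Bs \<inter> C c. \<forall>x\<in>Om. exp (lam x y) = (x - y) * (y0 - c) / ((x - c) * (y0 - y))) \<and>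
     (infgood \<longrightarrow> (\<forall>x\<in>sphere p (100 * \<sigma>). \<forall>y\<in>N. norm (lam x y) \<le> 1/2))"
  unfolding lam_def by (rule someI_ex[OF lam_exists])

lemma lam: "continuous_on (Om \<times> N) (\<lambda>(x,y). lam x y)"
  "\<And>c y x. c \<in> J \<Longrightarrow> y \<in> Bs \<Longrightarrow> y \<in> C c \<Longrightarrow> x \<in> Om \<Longrightarrow> exp (lam x y) = (x - y) * (y0 - c) / ((x - c) * (y0 - y))"
  "\<And>x y. infgood \<Longrightarrow> x \<in> sphere p (100 * \<sigma>) \<Longrightarrow> y \<in> N \<Longrightarrow> norm (lam x y) \<le> 1/2"
  subgoal using lam_spec by (rule conjunct1)
  subgoal using bspec[OF bspec[OF bspec[OF conjunct1[OF conjunct2[OF lam_spec]]]]] by simp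
  subgoal using bspec[OF bspec[OF mp[OF conjunct2[OF conjunct2[OF lam_spec]]]]] by simp
  done

text \<open>The variables \<open>x\<close> and \<open>q\<close> are kept apart although only
  \<open>q = r x\<close> enters \<open>uh\<close>: near a puncture \<open>a\<close> the point
  \<open>r x\<close> need not converge while \<open>x\<close> tends to \<open>a\<close>, and the
  order is found by freezing \<open>x\<close> at \<open>a\<close> and letting \<open>q\<close> range
  over \<open>N\<close>. The denominators normalise both displacements at \<open>y0\<close>, to
  match the cross ratio in \<open>lam\<close>.\<close>

definition "U n x q = (if q \<in> SS n then (x - \<psi> n q) / (y0 - \<psi> n q)
   else (x - (f ^^ Suc n) q) / (y0 - (f ^^ Suc n) q) * exp (- lam x ((f ^^ Suc n) q)))"

lemma U_AA:
  assumes "q \<in> AA n" "x \<in> Om"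
  shows "U n x q = (x - (f ^^ Suc n) q) / (y0 - (f ^^ Suc n) q) * exp (- lam x ((f ^^ Suc n) q))"
proof (cases "q \<in> SS n")
  case True
  let ?y = "(f ^^ Suc n) q" and ?c = "\<psi> n q"
  have y: "?y \<in> C ?c" "?y \<in> Bs" "?c \<in> J" using AA_SS[OF assms(1) True] by auto
  have "?y \<in> Gam" using CGam[OF y(3)] y(1) by (rule subsetD)
  then have nz: "x - ?y \<noteq> 0" "x - ?c \<noteq> 0" "y0 - ?y \<noteq> 0" "y0 - ?c \<noteq> 0"
    using assms(2) y0Om Om(3) JGam[OF y(3)] by auto
  have "exp (- lam x ?y) = ((x - ?c) * (y0 - ?y)) / ((x - ?y) * (y0 - ?c))"
    using lam(2)[OF y(3,2,1) assms(2)] by (simp only: exp_minus inverse_divide)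
  then have "(x - ?y) / (y0 - ?y) * exp (- lam x ?y) = (x - ?c) / (y0 - ?c)"
  proof -
    have "a / b * ((c * b) / (a * d)) = c / d" if "a \<noteq> 0" "b \<noteq> 0" for a b c d :: complex using that by (simp add: field_simps)
    from this[OF nz(1,3)] show ?thesis using \<open>exp (- lam x ?y) = _\<close> by (simp only:)
  qed
  then show ?thesis using True by (simp add: U_def del: funpow.simps)
qed (simp add: U_def del: funpow.simps)

lemma y0_fn: "q \<in> AA n \<Longrightarrow> y0 - (f ^^ Suc n) q \<noteq> 0"
  using AA_image[of q n] y0f by (simp only: eq_iff_diff_eq_0[symmetric]) blast

lemma U_cont: "continuous_on {(x,q). q \<in> N \<and> (q \<in> AA n \<longrightarrow> x \<in> Om)} (\<lambda>(x,q). U n x q)"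
proof -
  define D0 where "D0 = {(x,q). q \<in> SS n \<and> (q \<in> AA n \<longrightarrow> x \<in> Om)}"
  define D1 where "D1 = Om \<times> AA n"
  have un: "{(x,q). q \<in> N \<and> (q \<in> AA n \<longrightarrow> x \<in> Om)} = D0 \<union> D1" using AA_SS_un[of n] by (auto simp: D0_def D1_def)
  define g where "g = (\<lambda>q. (fst q - \<psi> n (snd q)) / (y0 - \<psi> n (snd q)))"
  define F where "F = f ^^ Suc n"
  define h where "h = (\<lambda>q. (fst q - F (snd q)) / (y0 - F (snd q)) * exp (- lam (fst q) (F (snd q))))"
  have "continuous_on (D0 \<union> D1) (\<lambda>q. if snd q \<in> SS n then g q else h q)"
  proof (rule continuous_on_cases_local)
    have "(D0 \<union> D1) \<inter> (UNIV \<times> SS n) = D0" by (auto simp: D0_def D1_def)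
    moreover have "closedin (top_of_set (D0 \<union> D1)) ((D0 \<union> D1) \<inter> (UNIV \<times> SS n))"
      by (rule closedin_closed_Int[OF closed_Times[OF closed_UNIV closedSS]])
    ultimately show "closedin (top_of_set (D0 \<union> D1)) D0" by (simp only:)
    have "(D0 \<union> D1) \<inter> (UNIV \<times> AA n) = D1" by (auto simp: D0_def D1_def)
    moreover have "closedin (top_of_set (D0 \<union> D1)) ((D0 \<union> D1) \<inter> (UNIV \<times> AA n))"
      by (rule closedin_closed_Int[OF closed_Times[OF closed_UNIV closedAA]])
    ultimately show "closedin (top_of_set (D0 \<union> D1)) D1" by (simp only:)
    have D0: "snd q \<in> SS n" if "q \<in> D0" for q using that by (auto simp: D0_def)
    have D1: "fst q \<in> Om" "snd q \<in> AA n" if "q \<in> D1" for q using that by (auto simp: D1_def)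
    have pc: "continuous_on D0 (\<lambda>q. \<psi> n (snd q))"
      by (rule continuous_on_compose2[OF conjunct1[OF psi_cont] continuous_on_snd[OF continuous_on_id]]) (use D0 in auto)
    have "y0 - \<psi> n q \<noteq> 0" if "q \<in> SS n" for q using y0J[OF psi_J[OF that]] by simp
    then show "continuous_on D0 g" unfolding g_def
      by (intro continuous_on_divide continuous_on_diff continuous_on_const continuous_on_fst continuous_on_id pc ballI) (use D0 in blast)
    have fn: "continuous_on D1 (\<lambda>q. F (snd q))"
      by (rule continuous_on_compose2[OF contfn[of n, folded F_def] continuous_on_snd[OF continuous_on_id]]) (use D1 in auto)
    have "continuous_on D1 (\<lambda>q. case (fst q, F (snd q)) of (x,y) \<Rightarrow> lam x y)"
    proof (rule continuous_on_compose2[OF lam(1)])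
      show "continuous_on D1 (\<lambda>q. (fst q, F (snd q)))" by (intro continuous_on_Pair continuous_on_fst continuous_on_id fn)
      show "(\<lambda>q. (fst q, F (snd q))) ` D1 \<subseteq> Om \<times> N" using D1 AA_N[of _ n, folded F_def] by (intro image_subsetI SigmaI) blast+
    qed
    then have "continuous_on D1 (\<lambda>q. lam (fst q) (F (snd q)))" by (simp only: prod.case)
    moreover have "y0 - F (snd q) \<noteq> 0" if "q \<in> D1" for q using y0_fn[OF D1(2)[OF that]] by (simp only: F_def not_False_eq_True)
    ultimately show "continuous_on D1 h" unfolding h_def
      by (intro continuous_on_mult continuous_on_divide continuous_on_diff continuous_on_exp continuous_on_minus continuous_on_const continuous_on_fst continuous_on_id fn ballI)
    show "g q = h q" if "q \<in> D0 \<and> snd q \<notin> SS n \<or> q \<in> D1 \<and> snd q \<in> SS n" for q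
    proof -
      have q: "snd q \<in> AA n" "fst q \<in> Om" "snd q \<in> SS n" using that D0 D1 by blast+
      show ?thesis using U_AA[OF q(1,2)] q(3) by (simp only: U_def g_def h_def F_def if_True)
    qed
  qed
  moreover have "(\<lambda>(x,q). U n x q) = (\<lambda>q. if snd q \<in> SS n then g q else h q)"
    by (simp only: U_def g_def h_def F_def case_prod_unfold)
  ultimately show ?thesis unfolding un by (simp only:)
qed

end

context pointed_block
begin

section \<open>The index formula\<close>

definition "uh n x = U n x (r x)"
definition "C0 n = {c \<in> J. (col ^^ Suc n) c = c}"

lemma uh_cont: "continuous_on (- A) (uh n)"
proof -
  have "continuous_on (- A) (\<lambda>x. case (x, r x) of (x, q) \<Rightarrow> U n x q)"
  proof (rule continuous_on_compose2[OF U_cont])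
    show "continuous_on (- A) (\<lambda>x. (x, r x))" by (intro continuous_on_Pair continuous_on_id rcont)
    show "(\<lambda>x. (x, r x)) ` (- A) \<subseteq> {(x, q). q \<in> N \<and> (q \<in> AA n \<longrightarrow> x \<in> Om)}"
    proof (rule image_subsetI)
      fix x assume "x \<in> - A"
      then show "(x, r x) \<in> {(x, q). q \<in> N \<and> (q \<in> AA n \<longrightarrow> x \<in> Om)}"
        using rN[of x] r_cW_Om[of x] AA_sub[of n] by auto
    qed
  qed
  then show ?thesis by (simp add: uh_def[abs_def])
qed

lemma uh_SS: "r x \<in> SS n \<Longrightarrow> uh n x = (x - \<psi> n (r x)) / (y0 - \<psi> n (r x))"
  by (simp add: uh_def U_def)

lemma uh_AA: "r x \<notin> SS n \<Longrightarrow> uh n x = (x - (f ^^ Suc n) (r x)) / (y0 - (f ^^ Suc n) (r x)) * exp (- lam x ((f ^^ Suc n) (r x)))"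
  by (simp add: uh_def U_def del: funpow.simps)

lemma not_SS: "q \<in> N \<Longrightarrow> q \<notin> SS n \<Longrightarrow> q \<in> AA n" using AA_SS_un[of n] by blast

lemma AA_fixed:
  assumes "x \<in> AA n" "(f ^^ Suc n) x = x"
  shows "x = p"
  by (rule per[of "Suc n"]) (use assms AA_iter[of x n] in \<open>auto simp del: funpow.simps\<close>)

text \<open>Iterates and colours both lie in \<open>N\<close>, where \<open>r\<close> is the
  identity. So a zero satisfies \<open>r x = x\<close>, and the retraction adds no zeros of its own.
  What remains is a periodic point of \<open>f\<close> with its orbit in \<open>closure W\<close>,
  thus \<open>p\<close>, or an element of \<open>J\<close> that returns to itself under
  \<open>col\<close>.\<close>

lemma uh_zero:
  assumes x: "x \<notin> A" and z: "uh n x = 0"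
  shows "x = p \<or> x \<in> C0 n"
proof (cases "r x \<in> SS n")
  case True
  have c: "\<psi> n (r x) \<in> J" by (rule psi_J[OF True])
  have "x = \<psi> n (r x)" using z y0J[OF c] unfolding uh_SS[OF True] by simp
  then have xJ: "x \<in> J" and rx: "r x = x" using c rid JN by auto
  have "x = (col ^^ Suc n) x" using psi_L[OF JL[OF xJ], of n] \<open>x = \<psi> n (r x)\<close> rx by (simp del: funpow.simps)
  then show ?thesis using xJ by (simp add: C0_def del: funpow.simps)
next
  case False
  have q: "r x \<in> AA n" by (rule not_SS[OF rN[OF x] False])
  have "x = (f ^^ Suc n) (r x)" using z y0_fn[OF q] unfolding uh_AA[OF False] by (simp del: funpow.simps)
  moreover have "(f ^^ Suc n) (r x) \<in> N" by (rule AA_N[OF q])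
  ultimately have "r x = x" "x = (f ^^ Suc n) x" using rid by metis+
  then show ?thesis using AA_fixed[of x n] q by simp
qed

lemma p_N: "p \<in> interior N" "p \<in> N" using pY YN YN' by auto

text \<open>Near \<open>p\<close> the function \<open>uh n\<close> is the displacement of
  \<open>f ^^ Suc n\<close> times a zero-free continuous factor, so the correction leaves the order
  unchanged.\<close>

lemma uh_order_p: "has_order (uh n) p (fp_index (f ^^ Suc n) p)"
proof -
  define F where "F = f ^^ Suc n"
  have "open (interior N \<inter> - SS n)" using closedSS by (simp add: open_Int open_Compl)
  moreover have "p \<in> interior N \<inter> - SS n" using p_N Y_SS[OF pY] by simp
  ultimately obtain e where e: "e > 0" "ball p e \<subseteq> interior N \<inter> - SS n" by (rule openE)
  have B: "z \<in> N" "z \<notin> SS n" "z \<in> AA n" "z \<in> Om" "r z = z" if "z \<in> ball p e" for z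
  proof -
    show zN: "z \<in> N" and zS: "z \<notin> SS n" using e(2) that interior_subset by blast+
    show zA: "z \<in> AA n" by (rule not_SS[OF zN zS])
    show "z \<in> Om" using zA AA_sub cW_Om by blast
    show "r z = z" by (rule rid[OF zN])
  qed
  have Fc: "continuous_on (ball p e) F"
    unfolding F_def by (rule continuous_on_subset[OF contfn]) (use B(3) in blast)
  define g where "g z = exp (- lam z (F z)) / (y0 - F z)" for z
  have "continuous_on (ball p e) (\<lambda>z. case (z, F z) of (x, y) \<Rightarrow> lam x y)"
  proof (rule continuous_on_compose2[OF lam(1)])
    show "continuous_on (ball p e) (\<lambda>z. (z, F z))" by (intro continuous_on_Pair continuous_on_id Fc)
    show "(\<lambda>z. (z, F z)) ` ball p e \<subseteq> Om \<times> N"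
      unfolding F_def by (intro image_subsetI SigmaI) (use B AA_N in blast)+
  qed
  then have lc: "continuous_on (ball p e) (\<lambda>z. lam z (F z))" by (simp only: prod.case)
  have nz: "y0 - F z \<noteq> 0" if "z \<in> ball p e" for z unfolding F_def by (rule y0_fn[OF B(3)[OF that]])
  have g: "has_order g p 0"
  proof (rule has_order_0I[OF e(1)])
    show "continuous_on (ball p e) g" unfolding g_def by (intro continuous_intros lc Fc) (use nz in blast)
    show "g z \<noteq> 0" if "z \<in> ball p e" for z using nz[OF that] by (simp add: g_def)
  qed
  have "\<exists>k. has_order (\<lambda>z. z - F z) p k"
  proof (rule has_order_exists[OF e(1)])
    show "continuous_on (ball p e - {p}) (\<lambda>z. z - F z)"
      by (intro continuous_intros continuous_on_subset[OF Fc]) auto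
    show "z - F z \<noteq> 0" if "z \<in> ball p e - {p}" for z
    proof
      assume "z - F z = 0"
      then have "(f ^^ Suc n) z = z" unfolding F_def by simp
      then show False using AA_fixed[of z n] B(3)[of z] that by blast
    qed
  qed
  then obtain k where k: "has_order (\<lambda>z. z - F z) p k" by blast
  have "has_order (uh n) p (k + 0)"
  proof (rule has_order_cong[OF has_order_mult[OF k g] e(1)])
    fix z assume "z \<in> ball p e - {p}"
    then have z: "z \<in> ball p e" by blast
    show "uh n z = (z - F z) * g z"
      using uh_AA[of z n] B(2,5)[OF z] unfolding g_def F_def by (simp del: funpow.simps)
  qed
  then show ?thesis using fp_index_eq_order[OF k] by (simp add: F_def del: funpow.simps)
qed

text \<open>Near \<open>c\<close> the point \<open>r z\<close> stays in the piece of
  \<open>c\<close>, on which \<open>\<psi> n\<close> has the constant value \<open>c\<close>; so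
  \<open>uh n\<close> is \<open>z - c\<close> up to a constant factor.\<close>

lemma uh_order_C0:
  assumes "c \<in> C0 n"
  shows "has_order (uh n) c 1"
proof -
  have c: "c \<in> J" "(col ^^ Suc n) c = c" using assms by (auto simp: C0_def simp del: funpow.simps)
  obtain S where S: "open S" "C c = N \<inter> S" using C[OF c(1)] by (auto simp: openin_open)
  have "open (- A \<inter> r -` S)" by (rule continuous_open_preimage[OF rcont opA S(1)])
  moreover have "c \<in> - A \<inter> r -` S" using JN[OF c(1)] AN rid[OF JN[OF c(1)]] C[OF c(1)] S(2) by auto
  ultimately obtain e where e: "e > 0" "ball c e \<subseteq> - A \<inter> r -` S" by (rule openE)
  have "has_order (uh n) c (1 + 0)"
  proof (rule has_order_cong[OF has_order_mult[OF has_order_1 has_order_0I[where h = "\<lambda>z. 1 / (y0 - c)"]] e(1)])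
    fix z assume "z \<in> ball c e - {c}"
    then have z: "z \<notin> A" "r z \<in> S" using e(2) by blast+
    then have rz: "r z \<in> C c" using rN[OF z(1)] S(2) by blast
    then have rL: "r z \<in> L" using C[OF c(1)] by blast
    have "\<psi> n (r z) = (col ^^ n) (col (r z))" using psi_L[OF rL, of n] by (simp add: funpow_swap1)
    also have "col (r z) = col c" by (rule col_const[OF c(1) rz])
    also have "(col ^^ n) (col c) = c" using c(2) by (simp add: funpow_swap1)
    finally have "\<psi> n (r z) = c" .
    then show "uh n z = (z - c) * (1 / (y0 - c))" using uh_SS[of z n] rL LSS by auto
  qed (use y0J[OF c(1)] in \<open>auto intro: zero_less_one\<close>)
  then show ?thesis by simp
qed

text \<open>Where \<open>r\<close> avoids \<open>closure W\<close>, the orbit counts as exited at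
  time 0 and the colour is locally constant. This handles the holes that are not good and, likewise,
  the outside region.\<close>

lemma psi_const:
  assumes Z: "connected Z" "Z \<inter> A = {}" "r ` Z \<inter> closure W = {}"
  shows "\<exists>c\<in>J. \<forall>x\<in>Z. r x \<in> SS n \<and> \<psi> n (r x) = c"
proof -
  have rS: "r x \<in> SS n" if "x \<in> Z" for x
  proof -
    have "r x \<in> N" "r x \<notin> closure W" using rN[of x] that Z by blast+
    then show ?thesis using N_un LSS by blast
  qed
  have "(\<lambda>x. \<psi> n (r x)) constant_on Z"
  proof (rule continuous_finite_range_constant[OF Z(1)])
    show "continuous_on Z (\<lambda>x. \<psi> n (r x))"
      by (rule continuous_on_compose2[OF conjunct1[OF psi_cont] continuous_on_subset[OF rcont]]) (use rS Z in auto)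
    show "finite ((\<lambda>x. \<psi> n (r x)) ` Z)" by (rule finite_subset[OF _ finJ]) (use psi_J rS in auto)
  qed
  then obtain d where d: "\<And>x. x \<in> Z \<Longrightarrow> \<psi> n (r x) = d" unfolding constant_on_def by blast
  show ?thesis
  proof (cases "Z = {}")
    case False
    then have "d \<in> J" using d psi_J rS by blast
    then show ?thesis using d rS by blast
  qed (use neJ in auto)
qed

lemma bad_const:
  assumes a: "a \<in> A - good"
  shows "\<exists>c\<in>J. \<forall>x\<in>V a - {a}. r x \<in> SS n \<and> \<psi> n (r x) = c"
proof (rule psi_const)
  have Va: "open (V a)" "connected (V a)" "V a \<inter> A = {a}" using V[of a] a by blast+
  show "connected (V a - {a})" by (rule connected_open_delete[OF Va(1,2)]) simp
  show "(V a - {a}) \<inter> A = {}" using Va(3) by blast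
  show "r ` (V a - {a}) \<inter> closure W = {}" using a by (auto simp: good_def)
qed

lemma uh_order_bad:
  assumes a: "a \<in> A - good"
  shows "has_order (uh n) a 0"
proof -
  obtain c where c: "c \<in> J" "\<And>x. x \<in> V a - {a} \<Longrightarrow> r x \<in> SS n \<and> \<psi> n (r x) = c" using bad_const[OF a] by blast
  have aA: "a \<in> A" using a by blast
  obtain e where e: "e > 0" "ball a e \<subseteq> V a" using V[OF aA] openE by metis
  show ?thesis
  proof (rule has_order_cong[OF has_order_0I[OF e(1), where h = "\<lambda>z. (z - c) / (y0 - c)"] e(1)])
    show "continuous_on (ball a e) (\<lambda>z. (z - c) / (y0 - c))" using y0J[OF c(1)] by (intro continuous_intros) auto
    show "(z - c) / (y0 - c) \<noteq> 0" if "z \<in> ball a e" for z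
    proof -
      have "z \<noteq> c" using that e(2) VN(1)[OF aA] JN[OF c(1)] by blast
      then show ?thesis using y0J[OF c(1)] by simp
    qed
    show "uh n z = (z - c) / (y0 - c)" if "z \<in> ball a e - {a}" for z
      using c(2)[of z] uh_SS[of z n] that e(2) by auto
  qed
qed

lemma sphere_far: "sphere p (100 * \<sigma>) \<subseteq> Vinf" using far \<sigma> by force

text \<open>Outside, \<open>uh n\<close> winds like \<open>z - p\<close>. If \<open>r\<close> sends
  no outside point into \<open>closure W\<close>, there is one colour \<open>c\<close> and
  \<open>uh n\<close> is \<open>z - c\<close> up to a constant. Otherwise the quotient of
  \<open>uh n\<close> by \<open>z - p\<close>, scaled by \<open>y0 - p\<close>, avoids the negative
  real axis: it is a cross ratio near 1 times the exponential of a small number.\<close>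

lemma uh_sphere:
  "\<exists>l. continuous_on (sphere p (100 * \<sigma>)) l \<and> (\<forall>z\<in>sphere p (100 * \<sigma>). uh n z = (z - p) powi 1 * exp (l z))"
proof (cases infgood)
  case False
  obtain c where c: "c \<in> J" "\<And>x. x \<in> Vinf \<Longrightarrow> r x \<in> SS n \<and> \<psi> n (r x) = c"
    using psi_const[OF conVi AVi, of n] False by (auto simp: infgood_def)
  have "c \<in> ball p (100 * \<sigma>)" using N\<sigma> JN[OF c(1)] \<sigma> by (auto dest!: subsetD)
  then obtain l where l: "continuous_on (sphere p (100 * \<sigma>)) l" "\<And>z. z \<in> sphere p (100 * \<sigma>) \<Longrightarrow> z - c = (z - p) * exp (l z)"
    using log_ratio_on_sphere by blast
  have y: "y0 - c \<noteq> 0" using y0J[OF c(1)] by simp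
  show ?thesis
  proof (intro exI[of _ "\<lambda>z. l z - Ln (y0 - c)"] conjI ballI)
    show "continuous_on (sphere p (100 * \<sigma>)) (\<lambda>z. l z - Ln (y0 - c))" by (intro continuous_on_diff l continuous_on_const)
    fix z assume z: "z \<in> sphere p (100 * \<sigma>)"
    then have "uh n z = (z - c) / (y0 - c)" using c(2)[of z] uh_SS[of z n] sphere_far by auto
    then show "uh n z = (z - p) powi 1 * exp (l z - Ln (y0 - c))" using l(2)[OF z] y by (simp add: exp_diff)
  qed
next
  case True
  have y0p: "norm (y0 - p) = 100 * \<sigma>" using y0far[OF True] \<sigma> by simp
  then have y0nz: "y0 - p \<noteq> 0" using \<sigma> by auto
  have Np: "norm (q - p) < \<sigma>" if "q \<in> N" for q using N\<sigma> that by (auto simp: dist_norm norm_minus_commute dest!: subsetD)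
  define R where "R z q = (z - q) * (y0 - p) / ((z - p) * (y0 - q))" for z q
  have R: "norm (R z q - 1) < 1/16" if "z \<in> sphere p (100 * \<sigma>)" "q \<in> N" for z q
  proof -
    have "norm (((z - p) - (q - p)) * ((y0 - p) - 0) / (((z - p) - 0) * ((y0 - p) - (q - p))) - 1) < 1/16"
      by (rule cross_ratio_near_1(1)[of _ \<sigma>]) (use that y0p Np[OF that(2)] \<sigma> in \<open>auto simp: dist_norm norm_minus_commute\<close>)
    then show ?thesis by (simp add: R_def)
  qed
  define E where "E z = uh n z * (y0 - p) / (z - p)" for z
  have np: "E z \<notin> \<real>\<^sub>\<le>\<^sub>0" if z: "z \<in> sphere p (100 * \<sigma>)" for z
  proof (cases "r z \<in> SS n")
    case True
    have "E z = R z (\<psi> n (r z))" unfolding E_def R_def uh_SS[OF True] by (simp add: field_simps)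
    moreover have "norm (R z (\<psi> n (r z)) - 1) < 1" using R[OF z JN[OF psi_J[OF True]]] by linarith
    ultimately show ?thesis using norm_minus_1_nonpos by simp
  next
    case False
    define y where "y = (f ^^ Suc n) (r z)"
    have "z \<notin> A" using z sphere_far AVi by blast
    then have y: "y \<in> N" unfolding y_def by (intro AA_N not_SS[OF rN False])
    have EzR: "E z = R z y * exp (- lam z y)" unfolding E_def R_def uh_AA[OF False] y_def[symmetric] by (simp add: field_simps)
    have "norm (R z y - 1) < 1" using R[OF z y] by linarith
    then have Rnp: "R z y \<notin> \<real>\<^sub>\<le>\<^sub>0" by (rule norm_minus_1_nonpos)
    then have "R z y \<noteq> 0" by auto
    then have EE: "E z = exp (Ln (R z y) - lam z y)" using EzR by (simp add: exp_diff exp_minus field_simps)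
    have "norm (Ln (1 + (R z y - 1))) \<le> 2 * norm (R z y - 1)" by (rule norm_Ln_le) (use R[OF z y] in linarith)
    then have "norm (Ln (R z y)) \<le> 1/8" using R[OF z y] by simp
    moreover have "norm (lam z y) \<le> 1/2" by (rule lam(3)[OF \<open>infgood\<close> z y])
    \<comment> \<open>The bounds 1/8 and 1/2 add up to less than 1, so the argument of
      \<open>E z\<close> stays within a right angle of 0 and its real part is positive.\<close>
    ultimately have "norm (Ln (R z y) - lam z y) \<le> 1" using norm_triangle_ineq4[of "Ln (R z y)" "lam z y"] by linarith
    then have "\<bar>Im (Ln (R z y) - lam z y)\<bar> \<le> 1" using abs_Im_le_cmod order_trans by blast
    then have "cos (Im (Ln (R z y) - lam z y)) > 0" using pi_gt3 by (intro cos_gt_zero_pi) linarith+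
    then have "Re (E z) > 0" unfolding EE Re_exp by simp
    then show ?thesis by (auto simp: complex_nonpos_Reals_iff)
  qed
  have zp: "z - p \<noteq> 0" if "z \<in> sphere p (100 * \<sigma>)" for z using that \<sigma> by auto
  have "continuous_on (sphere p (100 * \<sigma>)) (uh n)"
    by (rule continuous_on_subset[OF uh_cont]) (use sphere_far AVi in blast)
  then have Ec: "continuous_on (sphere p (100 * \<sigma>)) E" unfolding E_def by (intro continuous_intros) (use zp in auto)
  show ?thesis
  proof (intro exI[of _ "\<lambda>z. Ln (E z) - Ln (y0 - p)"] conjI ballI)
    show "continuous_on (sphere p (100 * \<sigma>)) (\<lambda>z. Ln (E z) - Ln (y0 - p))"
      by (intro continuous_on_diff continuous_on_Ln' Ec np continuous_on_const)
    fix z assume z: "z \<in> sphere p (100 * \<sigma>)"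
    have "E z \<noteq> 0" using np[OF z] by auto
    then have "(z - p) powi 1 * exp (Ln (E z) - Ln (y0 - p)) = (z - p) * (E z / (y0 - p))" using y0nz by (simp add: exp_diff)
    also have "\<dots> = uh n z" unfolding E_def using y0nz zp[OF z] by simp
    finally show "uh n z = (z - p) powi 1 * exp (Ln (E z) - Ln (y0 - p))" by simp
  qed
qed

lemma good_A: "a \<in> good \<Longrightarrow> a \<in> A" "a \<in> good \<Longrightarrow> a \<notin> N" "a \<in> good \<Longrightarrow> a \<in> Om"
  using AN good_Om[of a] V[of a] by (auto simp: good_def)

lemma U_good:
  assumes "a \<in> good"
  shows "q \<in> N \<Longrightarrow> U n a q \<noteq> 0" "continuous_on N (U n a)"
proof -
  note a = good_A[OF assms]
  show "U n a q \<noteq> 0" if q: "q \<in> N"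
  proof (cases "q \<in> SS n")
    case True
    have "\<psi> n q \<in> J" by (rule psi_J[OF True])
    then have "a \<noteq> \<psi> n q" "y0 \<noteq> \<psi> n q" using a(2) JN y0J by blast+
    then show ?thesis using True by (simp add: U_def)
  next
    case False
    have qA: "q \<in> AA n" by (rule not_SS[OF q False])
    have "a \<noteq> (f ^^ Suc n) q" using a(2) AA_N[OF qA] by metis
    then show ?thesis unfolding U_AA[OF qA a(3)] using y0_fn[OF qA] by (simp del: funpow.simps)
  qed
  have "continuous_on N (\<lambda>q. case (a, q) of (x, q) \<Rightarrow> U n x q)"
    by (rule continuous_on_compose2[OF U_cont]) (use a(3) in \<open>auto intro!: continuous_on_Pair continuous_on_const continuous_on_id\<close>)
  then show "continuous_on N (U n a)" by simp
qed

text \<open>One family of exponents serves two purposes. Those of \<open>q \<mapsto> U n a q\<close>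
  describe, on \<open>Y\<close>, the factor at \<open>a\<close> pulled back by the iterate, that is,
  a row of a matrix; and the diagonal exponent is the order of \<open>uh n\<close> at
  \<open>a\<close>, because \<open>U n x q / U n a q\<close> tends to 1 uniformly in
  \<open>q\<close> as \<open>x\<close> tends to \<open>a\<close>. Over holes that are not good, and
  over an outside region that is not, \<open>U n a (r z)\<close> is constant, which yields the two
  vanishing statements.\<close>

lemma good_rep:
  assumes ag: "a \<in> good"
  shows "\<exists>k. has_order (uh n) a (k a) \<and> (\<forall>b\<in>A - good. k b = 0) \<and> (\<not> infgood \<longrightarrow> (\<Sum>b\<in>A. k b) = 0) \<and>
    (\<exists>M. continuous_on Y M \<and> (\<forall>y\<in>Y. (a - (f ^^ Suc n) y) / (y0 - (f ^^ Suc n) y) = (\<Prod>b\<in>A. (y - b) powi k b) * exp (M y)))"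
proof -
  note a = good_A[OF ag]
  obtain k M where M: "continuous_on (-A) M" "\<And>z. z \<in> -A \<Longrightarrow> U n a (r z) = (\<Prod>b\<in>A. (z - b) powi k b) * exp (M z)"
    using power_int_rep[OF U_good(2,1)[OF ag], of n] by blast
  have ord: "has_order (\<lambda>z. U n a (r z)) b (k b)" if "b \<in> A" for b
    by (rule has_order_prod_exp[OF finA that M(1)]) (use M(2) in blast)
  define F where "F z = U n (fst z) (snd z) / U n a (snd z)" for z
  have "continuous_on (Om \<times> N) (\<lambda>z. U n (fst z) (snd z))"
    using continuous_on_subset[OF U_cont[of n], of "Om \<times> N"] by (simp add: case_prod_unfold subset_iff)
  moreover have "continuous_on (Om \<times> N) (\<lambda>z. U n a (snd z))"
    by (rule continuous_on_compose2[OF U_good(2)[OF ag] continuous_on_snd[OF continuous_on_id]]) auto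
  ultimately have Fc: "continuous_on (Om \<times> N) F"
    unfolding F_def by (intro continuous_on_divide) (use U_good(1)[OF ag] in auto)
  have "F (a, q) = 1" if "q \<in> N" for q using U_good(1)[OF ag that] by (simp add: F_def)
  then obtain e where e: "e > 0" "ball a e \<subseteq> Om" "\<And>x q. x \<in> ball a e \<Longrightarrow> q \<in> N \<Longrightarrow> norm (F (x, q) - 1) < 1"
    using near_slice[OF Om(1) a(3) compN Fc] by blast
  obtain d where d: "d > 0" "ball a d \<inter> (A - {a}) = {}" using finite_avoid_ball[of "A - {a}" a] finA by auto
  let ?B = "ball a (min d e) - {a}"
  have BA: "z \<notin> A" if "z \<in> ?B" for z using that d(2) by auto
  have "has_order (\<lambda>z. F (z, r z)) a 0"
    unfolding has_order_def
  proof (intro exI[of _ "min d e"] exI[of _ "\<lambda>z. Ln (F (z, r z))"] conjI ballI)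
    have rc: "continuous_on ?B r" by (rule continuous_on_subset[OF rcont]) (use BA in blast)
    have "continuous_on ?B (\<lambda>z. F (z, r z))"
    proof (rule continuous_on_compose2[OF Fc])
      show "continuous_on ?B (\<lambda>z. (z, r z))" by (intro continuous_on_Pair continuous_on_id rc)
      show "(\<lambda>z. (z, r z)) ` ?B \<subseteq> Om \<times> N"
      proof (intro image_subsetI SigmaI)
        fix z assume z: "z \<in> ?B"
        then show "z \<in> Om" using e(2) by auto
        show "r z \<in> N" by (rule rN[OF BA[OF z]])
      qed
    qed
    moreover have np: "F (z, r z) \<notin> \<real>\<^sub>\<le>\<^sub>0" if z: "z \<in> ?B" for z
      by (rule norm_minus_1_nonpos[OF e(3)[OF _ rN[OF BA[OF z]]]]) (use z in auto)
    ultimately show "continuous_on ?B (\<lambda>z. Ln (F (z, r z)))" by (rule continuous_on_Ln')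
    show "F (z, r z) = (z - a) powi 0 * exp (Ln (F (z, r z)))" if "z \<in> ?B" for z
    proof -
      have "F (z, r z) \<noteq> 0" using np[OF that] by auto
      then show ?thesis by simp
    qed
  qed (use d e in auto)
  then have "has_order (\<lambda>z. U n a (r z) * F (z, r z)) a (k a + 0)" by (rule has_order_mult[OF ord[OF a(1)]])
  then have o1: "has_order (uh n) a (k a + 0)"
  proof (rule has_order_cong)
    show "min d e > 0" using d e by simp
    fix z assume "z \<in> ball a (min d e) - {a}"
    then have "U n a (r z) \<noteq> 0" by (intro U_good(1)[OF ag] rN BA)
    then show "uh n z = U n a (r z) * F (z, r z)" by (simp add: F_def uh_def)
  qed
  have k0: "k b = 0" if b: "b \<in> A - good" for b
  proof -
    obtain c where c: "c \<in> J" "\<And>x. x \<in> V b - {b} \<Longrightarrow> r x \<in> SS n \<and> \<psi> n (r x) = c" using bad_const[OF b] by blast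
    have bA: "b \<in> A" using b by blast
    obtain e where e: "e > 0" "ball b e \<subseteq> V b" using V[OF bA] openE by metis
    have nz: "(a - c) / (y0 - c) \<noteq> 0" using y0J[OF c(1)] JN[OF c(1)] a(2) by auto
    have "has_order (\<lambda>z. U n a (r z)) b 0"
    proof (rule has_order_cong[OF has_order_0I[OF e(1), where h = "\<lambda>z. (a - c) / (y0 - c)"] e(1)])
      show "U n a (r z) = (a - c) / (y0 - c)" if "z \<in> ball b e - {b}" for z
        using c(2)[of z] that e(2) by (auto simp: U_def)
    qed (use nz in \<open>auto intro: continuous_on_const\<close>)
    then show ?thesis by (rule has_order_unique[OF ord[OF bA]])
  qed
  have s0: "(\<Sum>b\<in>A. k b) = 0" if ng: "\<not> infgood"
  proof -
    obtain c where c: "c \<in> J" "\<And>x. x \<in> Vinf \<Longrightarrow> r x \<in> SS n \<and> \<psi> n (r x) = c"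
      using psi_const[OF conVi AVi, of n] ng by (auto simp: infgood_def)
    have nz: "(a - c) / (y0 - c) \<noteq> 0" using y0J[OF c(1)] JN[OF c(1)] a(2) by auto
    have "0 = (\<Sum>b\<in>A. k b)"
    proof (rule sum_of_orders[OF finA])
      show "A \<subseteq> ball p (100 * \<sigma>)" using A\<sigma> \<sigma> by (force dest!: subsetD)
      show "100 * \<sigma> > 0" using \<sigma> by simp
      show "continuous_on (- A) (\<lambda>z. U n a (r z))"
        by (rule continuous_on_compose2[OF U_good(2)[OF ag] rcont]) (use rN in auto)
      show "U n a (r z) \<noteq> 0" if "z \<notin> A" for z by (rule U_good(1)[OF ag rN[OF that]])
      show "has_order (\<lambda>z. U n a (r z)) b (k b)" if "b \<in> A" for b by (rule ord[OF that])
      show "continuous_on (sphere p (100 * \<sigma>)) (\<lambda>z. Ln ((a - c) / (y0 - c)))" by (rule continuous_on_const)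
      show "U n a (r z) = (z - p) powi 0 * exp (Ln ((a - c) / (y0 - c)))" if "z \<in> sphere p (100 * \<sigma>)" for z
      proof -
        have "r z \<in> SS n" "\<psi> n (r z) = c" using c(2)[of z] that sphere_far by blast+
        then show ?thesis using nz by (simp add: U_def)
      qed
    qed
    then show ?thesis by simp
  qed
  define G where "G = f ^^ Suc n"
  have YA: "Y \<subseteq> - A" using AY by blast
  have "continuous_on Y (\<lambda>y. case (a, G y) of (x, y) \<Rightarrow> lam x y)"
  proof (rule continuous_on_compose2[OF lam(1)])
    have "continuous_on Y G" unfolding G_def by (rule continuous_on_subset[OF contfn Y_AA])
    then show "continuous_on Y (\<lambda>y. (a, G y))" by (intro continuous_on_Pair continuous_on_const)
    show "(\<lambda>y. (a, G y)) ` Y \<subseteq> Om \<times> N"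
    proof (intro image_subsetI SigmaI a)
      fix y assume "y \<in> Y"
      then show "G y \<in> N" unfolding G_def using Y_iter YN' by blast
    qed
  qed
  then have "continuous_on Y (\<lambda>y. lam a (G y))" by (simp only: prod.case)
  then have Mc: "continuous_on Y (\<lambda>y. M y + lam a (G y))" by (intro continuous_on_add continuous_on_subset[OF M(1) YA])
  have Me: "(a - G y) / (y0 - G y) = (\<Prod>b\<in>A. (y - b) powi k b) * exp (M y + lam a (G y))" if y: "y \<in> Y" for y
  proof -
    have yA: "y \<in> AA n" and ry: "r y = y" using y Y_AA rid YN' by blast+
    have "(\<Prod>b\<in>A. (y - b) powi k b) * exp (M y) = U n a y" using M(2)[of y] YA y ry by auto
    also have "\<dots> = (a - G y) / (y0 - G y) * exp (- lam a (G y))" unfolding G_def by (rule U_AA[OF yA a(3)])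
    finally have "(\<Prod>b\<in>A. (y - b) powi k b) * exp (M y) * exp (lam a (G y)) = (a - G y) / (y0 - G y)" by (simp add: exp_minus)
    then show ?thesis by (simp add: exp_add mult.assoc)
  qed
  show ?thesis
    unfolding G_def[symmetric]
    by (rule exI[of _ k]) (use o1 k0 s0 Mc Me in \<open>intro conjI ballI impI exI[of _ "\<lambda>y. M y + lam a (G y)"], simp_all\<close>)
qed

lemma finC0: "finite (C0 n)" using finJ by (simp add: C0_def)

text \<open>The argument principle applied to \<open>uh n\<close>, with total winding 1 from the far
  circle; each fixed colour counts 1, and punctures in holes that are not good count 0.\<close>

lemma index_formula:
  assumes k: "\<And>a. a \<in> good \<Longrightarrow> has_order (uh n) a (k a)"
  shows "fp_index (f ^^ Suc n) p = 1 - int (card (C0 n)) - (\<Sum>a\<in>good. k a)"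
proof -
  have gA: "good \<subseteq> A" by (auto simp: good_def)
  have C0J: "C0 n \<subseteq> J" by (auto simp: C0_def)
  have C0N: "C0 n \<subseteq> N" using C0J JN by blast
  have pA: "p \<notin> A" using p_N AN by blast
  have pC: "p \<notin> C0 n" using C0J JL pY YW by (auto simp: L_def)
  have AC: "A \<inter> C0 n = {}" using C0N AN by blast
  define \<kappa> where "\<kappa> x = (if x = p then fp_index (f ^^ Suc n) p else if x \<in> C0 n then 1 else if x \<in> good then k x else 0)" for x
  obtain l where l: "continuous_on (sphere p (100 * \<sigma>)) l" "\<And>z. z \<in> sphere p (100 * \<sigma>) \<Longrightarrow> uh n z = (z - p) powi 1 * exp (l z)"
    using uh_sphere by blast
  have "1 = (\<Sum>x\<in>insert p (A \<union> C0 n). \<kappa> x)"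
  proof (rule sum_of_orders[OF _ _ _ _ _ _ l])
    show "finite (insert p (A \<union> C0 n))" using finA finC0 by simp
    have "ball p \<sigma> \<subseteq> ball p (100 * \<sigma>)" using \<sigma> by (intro subset_ball) simp
    then show "insert p (A \<union> C0 n) \<subseteq> ball p (100 * \<sigma>)" using A\<sigma> C0N N\<sigma> \<sigma> by auto
    show "100 * \<sigma> > 0" using \<sigma> by simp
    show "continuous_on (- insert p (A \<union> C0 n)) (uh n)" by (rule continuous_on_subset[OF uh_cont]) auto
    show "uh n z \<noteq> 0" if "z \<notin> insert p (A \<union> C0 n)" for z using uh_zero[of z n] that by blast
    show "has_order (uh n) x (\<kappa> x)" if x: "x \<in> insert p (A \<union> C0 n)" for x
    proof (cases "x = p")
      case True
      then show ?thesis using uh_order_p by (simp add: \<kappa>_def)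
    next
      case False
      then consider "x \<in> C0 n" | "x \<in> good" "x \<notin> C0 n" | "x \<in> A - good" "x \<notin> C0 n" using x AC gA by blast
      then show ?thesis
      proof cases
        case 1
        then show ?thesis using False uh_order_C0 by (simp add: \<kappa>_def)
      next
        case 2
        then show ?thesis using False k by (simp add: \<kappa>_def)
      next
        case 3
        then show ?thesis using False uh_order_bad by (simp add: \<kappa>_def)
      qed
    qed
  qed
  also have "\<dots> = \<kappa> p + ((\<Sum>x\<in>A. \<kappa> x) + (\<Sum>x\<in>C0 n. \<kappa> x))"
    using finA finC0 pA pC AC by (simp add: sum.union_disjoint)
  also have "(\<Sum>x\<in>C0 n. \<kappa> x) = (\<Sum>x\<in>C0 n. 1)" by (rule sum.cong) (use pC in \<open>auto simp: \<kappa>_def\<close>)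
  also have "(\<Sum>x\<in>A. \<kappa> x) = (\<Sum>x\<in>good. k x)"
  proof (rule sum.mono_neutral_cong_right[OF finA gA])
    show "\<forall>i\<in>A - good. \<kappa> i = 0" using pA AC by (auto simp: \<kappa>_def)
    show "\<kappa> x = k x" if "x \<in> good" for x using that gA pA AC by (auto simp: \<kappa>_def)
  qed
  also have "\<kappa> p = fp_index (f ^^ Suc n) p" by (simp add: \<kappa>_def)
  finally show ?thesis by simp
qed

end

section \<open>Nilpotent integer matrices and periodic points\<close>

text \<open>\<open>mat_pow G B n\<close> is the power of exponent \<open>n + 1\<close>, in step with
  \<open>Mx n\<close>, which belongs to the iterate \<open>f ^^ Suc n\<close>.\<close>

primrec mat_pow :: "'i set \<Rightarrow> ('i \<Rightarrow> 'i \<Rightarrow> 'a::comm_ring_1) \<Rightarrow> nat \<Rightarrow> 'i \<Rightarrow> 'i \<Rightarrow> 'a" where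
  "mat_pow G B 0 = B"
| "mat_pow G B (Suc n) = (\<lambda>a b. \<Sum>c\<in>G. mat_pow G B n a c * B c b)"

text \<open>Induction on the size: a left null vector u with \<open>u\<^sub>i = 1\<close> splits off the index i without
  changing the trace.\<close>
lemma trace_nilpotent:
  fixes B :: "'i \<Rightarrow> 'i \<Rightarrow> 'a::field"
  assumes "finite G" "\<And>a b. a \<in> G \<Longrightarrow> b \<in> G \<Longrightarrow> mat_pow G B n a b = 0"
  shows "(\<Sum>a\<in>G. B a a) = 0"
  using assms
proof (induction "card G" arbitrary: G B rule: less_induct)
  case less
  \<comment> \<open>By minimality the power before the first vanishing one has a nonzero row, and
    multiplying this row by \<open>B\<close> gives 0. Scaled to be 1 at \<open>i\<close>, it is the
    left null vector \<open>u\<close>.\<close>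
  define m where "m = (LEAST n. \<forall>a\<in>G. \<forall>b\<in>G. mat_pow G B n a b = 0)"
  have mex: "\<exists>n. \<forall>a\<in>G. \<forall>b\<in>G. mat_pow G B n a b = 0" using less.prems(2) by blast
  then have m: "\<forall>a\<in>G. \<forall>b\<in>G. mat_pow G B m a b = 0" unfolding m_def by (rule LeastI_ex)
  show ?case
  proof (cases m)
    case 0
    then show ?thesis using m by (intro sum.neutral) auto
  next
    case (Suc m')
    have "\<not> (\<forall>a\<in>G. \<forall>b\<in>G. mat_pow G B m' a b = 0)"
      using not_less_Least[of m' "\<lambda>n. \<forall>a\<in>G. \<forall>b\<in>G. mat_pow G B n a b = 0"] Suc unfolding m_def by auto
    then obtain e i where e: "e \<in> G" "i \<in> G" "mat_pow G B m' e i \<noteq> 0" by blast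
    define u where "u c = mat_pow G B m' e c / mat_pow G B m' e i" for c
    have ui: "u i = 1" using e by (simp add: u_def)
    have uB: "(\<Sum>c\<in>G. u c * B c b) = 0" if "b \<in> G" for b
    proof -
      have "(\<Sum>c\<in>G. mat_pow G B m' e c * B c b) = 0" using m e(1) that Suc by auto
      then show ?thesis unfolding u_def by (simp add: sum_divide_distrib[symmetric])
    qed
    \<comment> \<open>Subtracting column \<open>i\<close> times \<open>u\<close> makes column
      \<open>i\<close> zero, since \<open>u i = 1\<close>. The trace changes by the
      \<open>i\<close>-th entry of the product of \<open>u\<close> with \<open>B\<close>, which is
      0.\<close>
    define B' where "B' a b = B a b - B a i * u b" for a b
    have pw: "mat_pow (G - {i}) B' k a b = mat_pow G B k a b - mat_pow G B k a i * u b" if "a \<in> G" "b \<in> G" for k a b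
      using that
    proof (induction k arbitrary: b)
      case 0
      then show ?case by (simp add: B'_def)
    next
      case (Suc k)
      let ?P = "mat_pow G B k a"
      have "mat_pow (G - {i}) B' (Suc k) a b = (\<Sum>c\<in>G - {i}. (?P c - ?P i * u c) * B' c b)"
        using Suc by simp
      also have "\<dots> = (\<Sum>c\<in>G. (?P c - ?P i * u c) * B' c b)"
        using sum.remove[OF less.prems(1) e(2), of "\<lambda>c. (?P c - ?P i * u c) * B' c b"] ui by simp
      also have "\<dots> = (\<Sum>c\<in>G. ?P c * B c b) - (\<Sum>c\<in>G. ?P c * B c i) * u b
          - ?P i * (\<Sum>c\<in>G. u c * B c b) + ?P i * u b * (\<Sum>c\<in>G. u c * B c i)"
        by (simp add: B'_def algebra_simps sum.distrib sum_subtractf sum_distrib_left sum_distrib_right)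
      also have "\<dots> = mat_pow G B (Suc k) a b - mat_pow G B (Suc k) a i * u b"
        using uB[OF Suc.prems(2)] uB[OF e(2)] by simp
      finally show ?case .
    qed
    have "(\<Sum>a\<in>G - {i}. B' a a) = 0"
    proof (rule less.hyps[of "G - {i}" B'])
      show "card (G - {i}) < card G" by (rule card_Diff1_less[OF less.prems(1) e(2)])
      show "mat_pow (G - {i}) B' n a b = 0" if "a \<in> G - {i}" "b \<in> G - {i}" for a b
        using pw[of a b n] that less.prems(2) e(2) by auto
    qed (use less.prems in auto)
    moreover have "(\<Sum>a\<in>G - {i}. B' a a) = (\<Sum>a\<in>G. B' a a)"
      using sum.remove[OF less.prems(1) e(2), of "\<lambda>a. B' a a"] ui by (simp add: B'_def)
    moreover have "(\<Sum>a\<in>G. B' a a) = (\<Sum>a\<in>G. B a a) - (\<Sum>c\<in>G. u c * B c i)"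
      by (simp add: B'_def sum_subtractf mult.commute)
    ultimately show ?thesis using uB[OF e(2)] by simp
  qed
qed

text \<open>The powers of each single \<open>M n\<close> occur again in the sequence, so every
  \<open>M n\<close> is nilpotent and its trace vanishes even for \<open>n < K\<close>. Real entries
  are used because \<open>trace_nilpotent\<close> divides.\<close>

lemma trace_eventually_zero:
  fixes M :: "nat \<Rightarrow> 'i \<Rightarrow> 'i \<Rightarrow> int"
  assumes fin: "finite G"
    and rec: "\<And>n a c. a \<in> G \<Longrightarrow> c \<in> G \<Longrightarrow> M (Suc n) a c = (\<Sum>b\<in>G. M n a b * M 0 b c)"
    and zero: "\<And>n a b. n \<ge> K \<Longrightarrow> a \<in> G \<Longrightarrow> b \<in> G \<Longrightarrow> M n a b = 0"
  shows "(\<Sum>a\<in>G. M n a a) = 0"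
proof -
  have mult: "M (Suc (n + m)) a c = (\<Sum>b\<in>G. M n a b * M m b c)" if "a \<in> G" "c \<in> G" for n m a c
    using that
  proof (induction m arbitrary: c)
    case 0
    then show ?case using rec by simp
  next
    case (Suc m)
    have "M (Suc (n + Suc m)) a c = (\<Sum>d\<in>G. M (Suc (n + m)) a d * M 0 d c)"
      using rec[OF Suc.prems, of "Suc (n + m)"] by simp
    also have "\<dots> = (\<Sum>d\<in>G. (\<Sum>b\<in>G. M n a b * M m b d) * M 0 d c)"
      using Suc by (intro sum.cong) auto
    also have "\<dots> = (\<Sum>d\<in>G. \<Sum>b\<in>G. M n a b * (M m b d * M 0 d c))"
      by (simp add: sum_distrib_right mult.assoc)
    also have "\<dots> = (\<Sum>b\<in>G. \<Sum>d\<in>G. M n a b * (M m b d * M 0 d c))" by (rule sum.swap)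
    also have "\<dots> = (\<Sum>b\<in>G. M n a b * M (Suc m) b c)"
      using rec[OF _ Suc.prems(2), of _ m] by (intro sum.cong) (auto simp: sum_distrib_left)
    finally show ?case .
  qed
  \<comment> \<open>Both sides are shifted by one: the power \<open>k + 1\<close> of the matrix with
    index \<open>n\<close>, itself a power \<open>n + 1\<close>, has index
    \<open>(n + 1) * (k + 1) - 1 = k + n * Suc k\<close>.\<close>
  have pw: "mat_pow G (\<lambda>a b. of_int (M n a b) :: real) k a b = of_int (M (k + n * Suc k) a b)" if "a \<in> G" "b \<in> G" for k a b
    using that
  proof (induction k arbitrary: b)
    case (Suc k)
    have "mat_pow G (\<lambda>a b. of_int (M n a b) :: real) (Suc k) a b = of_int (\<Sum>c\<in>G. M (k + n * Suc k) a c * M n c b)"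
      using Suc by simp
    also have "(\<Sum>c\<in>G. M (k + n * Suc k) a c * M n c b) = M (Suc (k + n * Suc k + n)) a b"
      using mult[OF Suc.prems] by simp
    also have "Suc (k + n * Suc k + n) = Suc k + n * Suc (Suc k)" by simp
    finally show ?case .
  qed simp
  have "(\<Sum>a\<in>G. of_int (M n a a) :: real) = 0"
    by (rule trace_nilpotent[OF fin, where n = K]) (use pw zero in auto)
  then show ?thesis by (metis of_int_sum of_int_eq_0_iff)
qed

text \<open>\<open>P k\<close> collects the points of least period \<open>k\<close>. It is
  partitioned into cycles of \<open>k\<close> points, which \<open>a k\<close> counts, and the
  \<open>n\<close>-th iterate fixes precisely the points whose least period divides
  \<open>n\<close>. A self-map of a finite nonempty set has a cycle, so \<open>F\<close> is
  nonempty.\<close>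

lemma card_fixed_points_iterates:
  fixes \<phi> :: "'i \<Rightarrow> 'i"
  assumes fin: "finite J" and ne: "J \<noteq> {}" and maps: "\<And>c. c \<in> J \<Longrightarrow> \<phi> c \<in> J"
  shows "\<exists>F a. finite F \<and> F \<noteq> {} \<and> 0 \<notin> F \<and> (\<forall>k\<in>F. a k > 0) \<and>
     (\<forall>n\<ge>1. card {c\<in>J. (\<phi> ^^ n) c = c} = (\<Sum>k\<in>{k\<in>F. k dvd n}. k * a k))"
proof -
  have it: "(\<phi> ^^ n) c \<in> J" if "c \<in> J" for n c using that maps by (induction n) auto
  define P where "P k = {c \<in> J. k \<ge> 1 \<and> (\<phi> ^^ k) c = c \<and> (\<forall>j. 1 \<le> j \<and> j < k \<longrightarrow> (\<phi> ^^ j) c \<noteq> c)}" for k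
  define orb where "orb k c = (\<lambda>i. (\<phi> ^^ i) c) ` {..<k}" for k c
  define F where "F = {k. P k \<noteq> {}}"
  define a where "a k = card (orb k ` P k)" for k
  have uniq: "k = l" if "c \<in> P k" "c \<in> P l" for c k l
    using that unfolding P_def by (cases k l rule: linorder_cases) auto
  have dvd: "(\<phi> ^^ n) c = c \<longleftrightarrow> k dvd n" if "c \<in> P k" for c k n
  proof -
    have k: "k \<ge> 1" "(\<phi> ^^ k) c = c" "\<And>j. 1 \<le> j \<Longrightarrow> j < k \<Longrightarrow> (\<phi> ^^ j) c \<noteq> c" using that by (auto simp: P_def)
    have "(\<phi> ^^ (n mod k)) c = (\<phi> ^^ n) c" by (rule funpow_mod_eq[OF k(2)])
    moreover have "n mod k < k" using k(1) by simp
    ultimately show ?thesis using k(3)[of "n mod k"] by (cases "n mod k = 0") (auto simp: mod_eq_0_iff_dvd)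
  qed
  have ex: "\<exists>k. c \<in> P k" if "c \<in> J" "n \<ge> 1" "(\<phi> ^^ n) c = c" for c n
  proof -
    let ?Q = "\<lambda>k. k \<ge> 1 \<and> (\<phi> ^^ k) c = c"
    have "?Q (LEAST k. ?Q k)" by (rule LeastI[of ?Q n]) (use that in auto)
    moreover have "\<forall>j. 1 \<le> j \<and> j < (LEAST k. ?Q k) \<longrightarrow> (\<phi> ^^ j) c \<noteq> c" using not_less_Least[of _ ?Q] by blast
    ultimately have "c \<in> P (LEAST k. ?Q k)" using that(1) by (simp add: P_def)
    then show ?thesis ..
  qed
  have PJ: "P k \<subseteq> J" for k by (auto simp: P_def)
  have finP: "finite (P k)" for k using PJ fin finite_subset by blast
  have inj: "inj_on (\<lambda>i. (\<phi> ^^ i) c) {..<k}" if c: "c \<in> P k" for c k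
  proof (rule linorder_inj_onI')
    fix i j assume ij: "i \<in> {..<k}" "j \<in> {..<k}" "i < j"
    show "(\<phi> ^^ i) c \<noteq> (\<phi> ^^ j) c"
    proof
      assume eq: "(\<phi> ^^ i) c = (\<phi> ^^ j) c"
      have "(\<phi> ^^ (k - j + i)) c = (\<phi> ^^ (k - j)) ((\<phi> ^^ i) c)" by (simp add: funpow_add)
      also have "\<dots> = (\<phi> ^^ (k - j)) ((\<phi> ^^ j) c)" by (simp only: eq)
      also have "\<dots> = (\<phi> ^^ (k - j + j)) c" by (simp only: funpow_add o_apply)
      also have "\<dots> = c" using ij c by (simp add: P_def)
      finally have "k dvd (k - j + i)" using dvd[OF c] by blast
      then show False using ij by (auto dest!: dvd_imp_le)
    qed
  qed
  have orbP: "(\<phi> ^^ i) c \<in> P k" if c: "c \<in> P k" for i c k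
  proof -
    have sh: "(\<phi> ^^ j) ((\<phi> ^^ i) c) = (\<phi> ^^ i) ((\<phi> ^^ j) c)" for i j c by (metis add.commute comp_apply funpow_add)
    have k: "k \<ge> 1" "(\<phi> ^^ k) c = c" using c by (auto simp: P_def)
    have "(\<phi> ^^ j) ((\<phi> ^^ i) c) \<noteq> (\<phi> ^^ i) c" if j: "1 \<le> j" "j < k" for j
    proof
      assume eq: "(\<phi> ^^ j) ((\<phi> ^^ i) c) = (\<phi> ^^ i) c"
      \<comment> \<open>On the cycle of \<open>c\<close> the iterate of exponent
        \<open>i * k - i\<close> undoes \<open>\<phi> ^^ i\<close>; hence a shorter period of the
        shifted point would be one of \<open>c\<close>.\<close>
      have id: "(\<phi> ^^ (i * k - i)) ((\<phi> ^^ i) c) = c"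
      proof -
        have "(\<phi> ^^ (i * k - i)) ((\<phi> ^^ i) c) = (\<phi> ^^ (i * k - i + i)) c" by (simp only: funpow_add o_apply)
        also have "i * k - i + i = i * k" using k(1) by simp
        also have "(\<phi> ^^ (i * k)) c = c" using dvd[OF c] by simp
        finally show ?thesis .
      qed
      have "(\<phi> ^^ j) c = c" using sh[of j "i * k - i" "(\<phi> ^^ i) c"] eq id by simp
      then show False using c j by (auto simp: P_def)
    qed
    moreover have "(\<phi> ^^ k) ((\<phi> ^^ i) c) = (\<phi> ^^ i) c" using sh[of k i c] k(2) by simp
    moreover have "(\<phi> ^^ i) c \<in> J" using it c PJ by blast
    ultimately show ?thesis using k(1) by (simp add: P_def)
  qed
  have orb_eq: "orb k d = orb k c" if c: "c \<in> P k" and d: "d \<in> orb k c" for c d k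
  proof (rule card_subset_eq)
    obtain i where i: "d = (\<phi> ^^ i) c" using d by (auto simp: orb_def)
    have k: "k \<ge> 1" "(\<phi> ^^ k) c = c" using c by (auto simp: P_def)
    show "orb k d \<subseteq> orb k c"
    proof
      fix x assume "x \<in> orb k d"
      then obtain j where "x = (\<phi> ^^ j) d" by (auto simp: orb_def)
      then have "x = (\<phi> ^^ (j + i)) c" using i by (simp add: funpow_add)
      then have "x = (\<phi> ^^ ((j + i) mod k)) c" using funpow_mod_eq[OF k(2)] by simp
      then show "x \<in> orb k c" using k(1) unfolding orb_def by (intro image_eqI) auto
    qed
    show "card (orb k d) = card (orb k c)"
      unfolding orb_def using inj[OF c] inj[OF orbP[OF c, of i]] i by (simp add: card_image)
  qed (simp add: orb_def)
  have cardP: "k * a k = card (P k)" for k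
  proof -
    have un: "\<Union> (orb k ` P k) = P k"
    proof
      show "\<Union> (orb k ` P k) \<subseteq> P k" using orbP by (auto simp: orb_def)
      have "c \<in> orb k c" if "c \<in> P k" for c using that unfolding orb_def P_def by (intro image_eqI[of _ _ 0]) auto
      then show "P k \<subseteq> \<Union> (orb k ` P k)" by blast
    qed
    have "k * card (orb k ` P k) = card (\<Union> (orb k ` P k))"
    proof (rule card_partition)
      show "finite (orb k ` P k)" using finP by blast
      show "finite (\<Union> (orb k ` P k))" using un finP by simp
      show "card c = k" if "c \<in> orb k ` P k" for c using that inj by (auto simp: orb_def card_image)
      show "c1 \<inter> c2 = {}" if "c1 \<in> orb k ` P k" "c2 \<in> orb k ` P k" "c1 \<noteq> c2" for c1 c2
        using that orb_eq by (metis disjoint_iff imageE)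
    qed
    then show ?thesis using un by (simp add: a_def)
  qed
  have finF: "finite F"
  proof (rule finite_subset)
    show "F \<subseteq> {..card J}"
    proof
      fix k assume "k \<in> F"
      then obtain c where c: "c \<in> P k" by (auto simp: F_def)
      have "k = card (orb k c)" unfolding orb_def using inj[OF c] by (simp add: card_image)
      also have "\<dots> \<le> card J" using c it PJ by (intro card_mono fin) (auto simp: orb_def)
      finally show "k \<in> {..card J}" by simp
    qed
  qed simp
  obtain c0 where c0: "c0 \<in> J" using ne by blast
  have "\<not> inj (\<lambda>i. (\<phi> ^^ i) c0)"
  proof
    assume "inj (\<lambda>i. (\<phi> ^^ i) c0)"
    moreover have "finite (range (\<lambda>i. (\<phi> ^^ i) c0))" by (rule finite_subset[OF _ fin]) (use it c0 in auto)
    ultimately show False using finite_imageD by fastforce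
  qed
  then obtain i j where "i \<noteq> j" "(\<phi> ^^ i) c0 = (\<phi> ^^ j) c0" by (auto simp: inj_def)
  then obtain i j where ij: "i < j" "(\<phi> ^^ i) c0 = (\<phi> ^^ j) c0" by (metis linorder_neqE_nat)
  have "(\<phi> ^^ (j - i)) ((\<phi> ^^ i) c0) = (\<phi> ^^ (j - i + i)) c0" by (simp only: funpow_add o_apply)
  then have "(\<phi> ^^ (j - i)) ((\<phi> ^^ i) c0) = (\<phi> ^^ i) c0" using ij by simp
  moreover have "j - i \<ge> 1" using ij(1) by simp
  ultimately obtain k where "(\<phi> ^^ i) c0 \<in> P k" using ex[OF it[OF c0]] by blast
  then have "F \<noteq> {}" by (auto simp: F_def)
  moreover have "0 \<notin> F" by (auto simp: F_def P_def)
  moreover have "a k > 0" if "k \<in> F" for k using that finP by (auto simp: F_def a_def card_gt_0_iff)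
  moreover have "card {c\<in>J. (\<phi> ^^ n) c = c} = (\<Sum>k\<in>{k\<in>F. k dvd n}. k * a k)" if n: "n \<ge> 1" for n
  proof -
    have "{c\<in>J. (\<phi> ^^ n) c = c} = (\<Union>k\<in>{k\<in>F. k dvd n}. P k)"
    proof (intro equalityI subsetI)
      fix c assume c: "c \<in> {c\<in>J. (\<phi> ^^ n) c = c}"
      then obtain k where k: "c \<in> P k" using ex[of c n] n by auto
      then have "k dvd n" using dvd[OF k] c by auto
      then show "c \<in> (\<Union>k\<in>{k\<in>F. k dvd n}. P k)" using k by (auto simp: F_def)
    next
      fix c assume "c \<in> (\<Union>k\<in>{k\<in>F. k dvd n}. P k)"
      then show "c \<in> {c\<in>J. (\<phi> ^^ n) c = c}" using dvd PJ by blast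
    qed
    then have "card {c\<in>J. (\<phi> ^^ n) c = c} = (\<Sum>k\<in>{k\<in>F. k dvd n}. card (P k))"
      using finF finP uniq by (simp only:) (rule card_UN_disjoint, auto)
    then show ?thesis by (simp add: cardP)
  qed
  ultimately show ?thesis using finF by (intro exI[of _ F] exI[of _ a] conjI ballI allI impI) auto
qed

lemma power_int_sum_exponents: "w \<noteq> 0 \<Longrightarrow> (\<Prod>b\<in>G. w powi m b) = w powi (\<Sum>b\<in>G. m b)" for w :: complex
  by (induction G rule: infinite_finite_induct) (auto simp: power_int_add)

lemma prod_power_int_distrib: "(\<Prod>c\<in>G. g c) powi m = (\<Prod>c\<in>G. g c powi m)" for g :: "'a \<Rightarrow> complex"
  by (induction G rule: infinite_finite_induct) (auto simp: power_int_mult_distrib)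

section \<open>Matrices of the iterates on winding numbers, and their nilpotency\<close>

context pointed_block
begin

text \<open>\<open>Mx n\<close> is the matrix of the (n+1)-st iterate of f on winding numbers around the holes.\<close>
definition "Mx n a = (SOME k. has_order (uh n) a (k a) \<and> (\<forall>b\<in>A - good. k b = 0) \<and> (\<not> infgood \<longrightarrow> (\<Sum>b\<in>A. k b) = 0) \<and>
    (\<exists>M. continuous_on Y M \<and> (\<forall>y\<in>Y. (a - (f ^^ Suc n) y) / (y0 - (f ^^ Suc n) y) = (\<Prod>b\<in>A. (y - b) powi k b) * exp (M y))))"

lemma Mx:
  assumes "a \<in> good"
  shows "has_order (uh n) a (Mx n a a)" "\<forall>b\<in>A - good. Mx n a b = 0" "\<not> infgood \<longrightarrow> (\<Sum>b\<in>A. Mx n a b) = 0"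
    "\<exists>M. continuous_on Y M \<and> (\<forall>y\<in>Y. (a - (f ^^ Suc n) y) / (y0 - (f ^^ Suc n) y) = (\<Prod>b\<in>A. (y - b) powi Mx n a b) * exp (M y))"
  using someI_ex[OF good_rep[OF assms, of n]] unfolding Mx_def[symmetric] by - (elim conjE, assumption)+

lemma gA: "good \<subseteq> A" by (auto simp: good_def)

lemma fingood: "finite good" using gA finA finite_subset by blast

lemma Y_fn: "y \<in> Y \<Longrightarrow> y0 - (f ^^ Suc n) y \<noteq> 0" using y0_fn Y_AA by blast

text \<open>Composing the exponent formula with \<open>f\<close> leaves powers of the denominator
  \<open>y0 - f y\<close>, which must be absorbed into a logarithm. Either the exponents add up to
  0, or \<open>y0\<close> is so far to the right that \<open>y0 - f y\<close> stays in the right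
  half-plane.\<close>

lemma y0_power_log:
  assumes m: "\<not> infgood \<Longrightarrow> (\<Sum>b\<in>good. m b) = 0"
  shows "\<exists>P. continuous_on Y P \<and> (\<forall>y\<in>Y. (\<Prod>b\<in>good. (- (y0 - f y)) powi m b) = exp (P y))"
proof -
  have nz: "y0 - f y \<noteq> 0" if "y \<in> Y" for y using Y_fn[OF that, of 0] by simp
  have fc: "continuous_on Y f" by (rule continuous_on_subset[OF contf YN'])
  show ?thesis
  proof (cases infgood)
    case False
    have "(\<Prod>b\<in>good. (- (y0 - f y)) powi m b) = exp 0" if "y \<in> Y" for y
      using power_int_sum_exponents[of "- (y0 - f y)" m good] nz[OF that] m[OF False] by simp
    then show ?thesis by (intro exI[of _ "\<lambda>_. 0"] conjI continuous_on_const ballI)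
  next
    case True
    have pos: "Re (y0 - f y) > 0" if "y \<in> Y" for y
    proof -
      have "f y \<in> ball p \<sigma>" using that fY YN' N\<sigma> by blast
      then have "norm (f y - p) < \<sigma>" by (simp add: dist_norm norm_minus_commute)
      then have "\<bar>Re (f y - p)\<bar> < \<sigma>" using abs_Re_le_cmod le_less_trans by blast
      then show ?thesis using y0far[OF True] \<sigma> by simp
    qed
    define P where "P y = (\<Sum>b\<in>good. of_int (m b) * (Ln (y0 - f y) + \<i> * of_real pi))" for y
    have "continuous_on Y (\<lambda>y. Ln (y0 - f y))"
      by (intro continuous_on_Ln' continuous_on_diff continuous_on_const fc) (use pos in \<open>force simp: complex_nonpos_Reals_iff\<close>)
    then have "continuous_on Y P" unfolding P_def
      by (intro continuous_on_sum continuous_on_mult continuous_on_add continuous_on_const)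
    moreover have "(\<Prod>b\<in>good. (- (y0 - f y)) powi m b) = exp (P y)" if "y \<in> Y" for y
    proof -
      have "exp (Ln (y0 - f y) + \<i> * of_real pi) = - (y0 - f y)"
        using nz[OF that] by (simp add: exp_add mult.commute)
      then have "(- (y0 - f y)) powi m b = exp (of_int (m b) * (Ln (y0 - f y) + \<i> * of_real pi))" for b
        by (simp only: exp_power_int[symmetric])
      then show ?thesis by (simp add: P_def exp_sum[OF fingood])
    qed
    ultimately show ?thesis by blast
  qed
qed

text \<open>The formula of the iterate \<open>Suc n\<close> is evaluated at \<open>f y\<close>,
  again a point of \<open>Y\<close>. Each factor \<open>f y - b\<close> is rewritten by the formula
  of \<open>f\<close> with \<open>b\<close> in place of \<open>a\<close>, up to a power of
  \<open>y0 - f y\<close>; only good \<open>b\<close> have a nonzero exponent. Uniqueness of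
  exponents on \<open>Y\<close> turns the identity of products into one of integers.\<close>

lemma Mx_Suc:
  assumes a: "a \<in> good" and c: "c \<in> A"
  shows "Mx (Suc n) a c = (\<Sum>b\<in>good. Mx n a b * Mx 0 b c)"
proof -
  let ?m = "Mx n a"
  obtain M1 where M1: "continuous_on Y M1" "\<And>y. y \<in> Y \<Longrightarrow> (a - (f ^^ Suc n) y) / (y0 - (f ^^ Suc n) y) = (\<Prod>b\<in>A. (y - b) powi ?m b) * exp (M1 y)"
    using Mx(4)[OF a, of n] by blast
  obtain M2 where M2: "continuous_on Y M2" "\<And>y. y \<in> Y \<Longrightarrow> (a - (f ^^ Suc (Suc n)) y) / (y0 - (f ^^ Suc (Suc n)) y) = (\<Prod>b\<in>A. (y - b) powi Mx (Suc n) a b) * exp (M2 y)"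
    using Mx(4)[OF a, of "Suc n"] by blast
  have "\<exists>M. continuous_on Y M \<and> (\<forall>y\<in>Y. (b - f y) / (y0 - f y) = (\<Prod>c\<in>A. (y - c) powi Mx 0 b c) * exp (M y))" if "b \<in> good" for b
    using Mx(4)[OF that, of 0] by simp
  then have "\<forall>b\<in>good. \<exists>M. continuous_on Y M \<and> (\<forall>y\<in>Y. (b - f y) / (y0 - f y) = (\<Prod>c\<in>A. (y - c) powi Mx 0 b c) * exp (M y))"
    by (rule ballI)
  from bchoice[OF this] obtain M0 where
    M0': "\<forall>b\<in>good. continuous_on Y (M0 b) \<and> (\<forall>y\<in>Y. (b - f y) / (y0 - f y) = (\<Prod>c\<in>A. (y - c) powi Mx 0 b c) * exp (M0 b y))"
    by (elim exE) (rule that)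
  have M0: "continuous_on Y (M0 b)" "y \<in> Y \<Longrightarrow> (b - f y) / (y0 - f y) = (\<Prod>c\<in>A. (y - c) powi Mx 0 b c) * exp (M0 b y)" if "b \<in> good" for b y
    using bspec[OF M0' that] by simp_all
  have "(\<Sum>b\<in>good. ?m b) = (\<Sum>b\<in>A. ?m b)"
    by (rule sum.mono_neutral_left[OF finA gA Mx(2)[OF a]])
  then obtain P where P: "continuous_on Y P" "\<And>y. y \<in> Y \<Longrightarrow> (\<Prod>b\<in>good. (- (y0 - f y)) powi ?m b) = exp (P y)"
    using y0_power_log[of ?m] Mx(3)[OF a, of n] by auto
  define R where "R c = (\<Sum>b\<in>good. ?m b * Mx 0 b c)" for c
  define Q where "Q y = P y + (\<Sum>b\<in>good. of_int (?m b) * M0 b y) + M1 (f y) - M2 y" for y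
  have fc: "continuous_on Y f" by (rule continuous_on_subset[OF contf YN'])
  have "Mx (Suc n) a c - R c = 0"
  proof (rule power_int_unique[OF _ _ c])
    show "continuous_on Y Q" unfolding Q_def
      by (intro continuous_on_diff continuous_on_add continuous_on_sum continuous_on_mult continuous_on_const P(1) M0(1) M2(1) continuous_on_compose2[OF M1(1) fc fY])
    fix y assume y: "y \<in> Y"
    have yc: "y - c \<noteq> 0" if "c \<in> A" for c using that y AY by auto
    have fy: "f y \<in> Y" using y fY by blast
    have nz: "y0 - f y \<noteq> 0" using Y_fn[OF y, of 0] by simp
    have fb: "(f y - b) powi ?m b = (- (y0 - f y)) powi ?m b * (\<Prod>c\<in>A. (y - c) powi (?m b * Mx 0 b c)) * exp (of_int (?m b) * M0 b y)" if b: "b \<in> good" for b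
    proof -
      have "f y - b = (- (y0 - f y)) * ((b - f y) / (y0 - f y))" using nz by (simp add: field_simps)
      also have "\<dots> = (- (y0 - f y)) * ((\<Prod>c\<in>A. (y - c) powi Mx 0 b c) * exp (M0 b y))" by (simp only: M0(2)[OF b y])
      finally have "(f y - b) powi ?m b = (- (y0 - f y)) powi ?m b * ((\<Prod>c\<in>A. (y - c) powi Mx 0 b c) powi ?m b * exp (M0 b y) powi ?m b)"
        by (simp only: power_int_mult_distrib)
      also have "(\<Prod>c\<in>A. (y - c) powi Mx 0 b c) powi ?m b = (\<Prod>c\<in>A. (y - c) powi (?m b * Mx 0 b c))"
        by (simp only: prod_power_int_distrib power_int_mult[symmetric] mult.commute)
      also have "exp (M0 b y) powi ?m b = exp (of_int (?m b) * M0 b y)" by (simp only: exp_power_int)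
      finally show ?thesis by (simp only: mult.assoc)
    qed
    have "(\<Prod>b\<in>A. (y - b) powi Mx (Suc n) a b) * exp (M2 y) = (a - (f ^^ Suc n) (f y)) / (y0 - (f ^^ Suc n) (f y))"
      unfolding M2(2)[OF y, symmetric] funpow_Suc_f ..
    also have "\<dots> = (\<Prod>b\<in>A. (f y - b) powi ?m b) * exp (M1 (f y))" by (rule M1(2)[OF fy])
    also have "(\<Prod>b\<in>A. (f y - b) powi ?m b) = (\<Prod>b\<in>good. (f y - b) powi ?m b)"
      by (rule prod.mono_neutral_right[OF finA gA]) (use Mx(2)[OF a, of n] in auto)
    also have "\<dots> = (\<Prod>b\<in>good. (- (y0 - f y)) powi ?m b * (\<Prod>c\<in>A. (y - c) powi (?m b * Mx 0 b c)) * exp (of_int (?m b) * M0 b y))"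
      by (rule prod.cong[OF refl fb])
    also have "\<dots> = exp (P y) * (\<Prod>b\<in>good. \<Prod>c\<in>A. (y - c) powi (?m b * Mx 0 b c)) * exp (\<Sum>b\<in>good. of_int (?m b) * M0 b y)"
      by (simp only: prod.distrib P(2)[OF y] exp_sum[OF fingood])
    also have "(\<Prod>b\<in>good. \<Prod>c\<in>A. (y - c) powi (?m b * Mx 0 b c)) = (\<Prod>c\<in>A. \<Prod>b\<in>good. (y - c) powi (?m b * Mx 0 b c))"
      by (rule prod.swap)
    also have "\<dots> = (\<Prod>c\<in>A. (y - c) powi R c)"
      unfolding R_def by (intro prod.cong refl power_int_sum_exponents yc)
    finally have "(\<Prod>b\<in>A. (y - b) powi Mx (Suc n) a b) * exp (M2 y)
       = exp (P y) * (\<Prod>c\<in>A. (y - c) powi R c) * exp (\<Sum>b\<in>good. of_int (?m b) * M0 b y) * exp (M1 (f y))" .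
    moreover have "(\<Prod>c\<in>A. (y - c) powi R c) \<noteq> 0" using yc finA by (auto simp: power_int_eq_0_iff)
    moreover have "(\<Prod>c\<in>A. (y - c) powi (Mx (Suc n) a c - R c)) = (\<Prod>c\<in>A. (y - c) powi Mx (Suc n) a c) / (\<Prod>c\<in>A. (y - c) powi R c)"
      unfolding prod_dividef[symmetric] by (intro prod.cong refl power_int_diff) (use yc in blast)
    ultimately show "(\<Prod>c\<in>A. (y - c) powi (Mx (Suc n) a c - R c)) = exp (Q y)"
      unfolding Q_def exp_diff exp_add by (simp only:) (simp add: nonzero_divide_eq_eq nonzero_eq_divide_eq mult_ac)
  qed
  then show ?thesis by (simp add: R_def)
qed

text \<open>Late iterates map all of \<open>Y\<close> into a disc around \<open>p\<close> that
  contains neither \<open>a\<close> nor \<open>y0\<close>. There \<open>(a - z) / (y0 - z)\<close>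
  has a logarithm, so uniqueness of exponents on \<open>Y\<close> makes all of them 0.\<close>

lemma Mx_eventually_zero: "\<exists>K. \<forall>n\<ge>K. \<forall>a\<in>good. \<forall>b\<in>A. Mx n a b = 0"
proof -
  have "p \<notin> A" using p_N AN by blast
  moreover have "p \<noteq> y0" using Y_fn[OF pY, of 0] fp by auto
  ultimately obtain e where e: "e > 0" "ball p e \<inter> insert y0 A = {}" using finite_avoid_ball[of "insert y0 A" p] finA by auto
  obtain K where K: "\<And>j y. j \<ge> K \<Longrightarrow> y \<in> Y \<Longrightarrow> dist ((f ^^ j) y) p < e" using attr[OF e(1)] by blast
  have "Mx n a b = 0" if n: "n \<ge> K" and a: "a \<in> good" and b: "b \<in> A" for n a b
  proof -
    have aA: "a \<in> A" using a gA by blast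
    obtain g where g: "continuous_on (ball p e) g" "\<And>z. z \<in> ball p e \<Longrightarrow> (a - z) / (y0 - z) = exp (g z)"
    proof (rule continuous_logarithm_on_ball)
      show "continuous_on (ball p e) (\<lambda>z. (a - z) / (y0 - z))" by (intro continuous_intros) (use e(2) in auto)
      show "(a - z) / (y0 - z) \<noteq> 0" if "z \<in> ball p e" for z using that e(2) aA by auto
    qed blast
    obtain M where M: "continuous_on Y M" "\<And>y. y \<in> Y \<Longrightarrow> (a - (f ^^ Suc n) y) / (y0 - (f ^^ Suc n) y) = (\<Prod>b\<in>A. (y - b) powi Mx n a b) * exp (M y)"
      using Mx(4)[OF a, of n] by blast
    have F: "(f ^^ Suc n) y \<in> ball p e" if "y \<in> Y" for y using K[of "Suc n" y] n that by (simp add: dist_commute del: funpow.simps)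
    show ?thesis
    proof (rule power_int_unique[OF _ _ b])
      have "continuous_on Y (\<lambda>y. g ((f ^^ Suc n) y))"
        by (rule continuous_on_compose2[OF g(1) continuous_on_subset[OF contfn Y_AA]]) (rule image_subsetI[OF F])
      then show "continuous_on Y (\<lambda>y. g ((f ^^ Suc n) y) - M y)" by (rule continuous_on_diff[OF _ M(1)])
      fix y assume y: "y \<in> Y"
      show "(\<Prod>b\<in>A. (y - b) powi Mx n a b) = exp (g ((f ^^ Suc n) y) - M y)"
        using M(2)[OF y] g(2)[OF F[OF y]] by (simp add: exp_diff del: funpow.simps)
    qed
  qed
  then show ?thesis by blast
qed

theorem index_of_iterates:
  assumes "m \<ge> 1"
  shows "fp_index (f ^^ m) p = 1 - int (card {c \<in> J. (col ^^ m) c = c})"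
proof -
  obtain n where m: "m = Suc n" using assms by (cases m) auto
  obtain K where K: "\<And>n a b. n \<ge> K \<Longrightarrow> a \<in> good \<Longrightarrow> b \<in> A \<Longrightarrow> Mx n a b = 0" using Mx_eventually_zero by blast
  have "(\<Sum>a\<in>good. Mx n a a) = 0"
  proof (rule trace_eventually_zero[OF fingood, where K = K and M = Mx])
    show "Mx (Suc n) a c = (\<Sum>b\<in>good. Mx n a b * Mx 0 b c)" if "a \<in> good" "c \<in> good" for n a c
      by (rule Mx_Suc[OF that(1) subsetD[OF gA that(2)]])
    show "Mx n a b = 0" if "K \<le> n" "a \<in> good" "b \<in> good" for n a b
      by (rule K[OF that(1,2) subsetD[OF gA that(3)]])
  qed
  moreover have "fp_index (f ^^ Suc n) p = 1 - int (card (C0 n)) - (\<Sum>a\<in>good. Mx n a a)" by (rule index_formula[OF Mx(1)])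
  ultimately show ?thesis unfolding m C0_def by (simp del: funpow.simps)
qed

end

theorem theorem1:
  fixes f :: "complex \<Rightarrow> complex" and U :: "complex set" and p :: complex
  assumes "open U" and "continuous_on U f"
    and "p \<in> U" and "f p = p"
    and "isolated_inv f U {p}"
    and "\<not> is_sink f U p" and "\<not> is_source f U p"
  shows "\<exists>F :: nat set. \<exists>a :: nat \<Rightarrow> nat. finite F \<and> F \<noteq> {} \<and> 0 \<notin> F \<and>
           (\<forall>k\<in>F. a k > 0) \<and>
           (\<forall>n\<ge>1. fp_index (f ^^ n) p = 1 - (\<Sum>k\<in>{k\<in>F. k dvd n}. int k * int (a k)))"
proof -
  obtain Y N A r V Vinf \<sigma> W where "planar_block f p Y N A r V Vinf \<sigma> W"
    using planar_block_exists[OF assms] by (elim exE) (rule that)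
  then interpret planar_block f p Y N A r V Vinf \<sigma> W .
  obtain J C col where "finite J \<and> J \<noteq> {} \<and> J \<subseteq> Bs \<and> Bs \<subseteq> (\<Union>c\<in>J. C c) \<and>
     (\<forall>c\<in>J. c \<in> C c \<and> connected (C c) \<and> openin (top_of_set N) (C c) \<and> closure (C c) \<inter> closure W = {} \<and> C c \<subseteq> L) \<and>
     (\<forall>c\<in>J. \<forall>d\<in>J. c \<noteq> d \<longrightarrow> C c \<inter> C d = {}) \<and>
     continuous_on L col \<and> col ` L \<subseteq> J \<and> (\<forall>x\<in>bd. f x \<in> C (col x))"
    using colouring_exists by (elim exE) (rule that)
  then have JC: "finite J" "J \<noteq> {}" "J \<subseteq> Bs" "Bs \<subseteq> (\<Union>c\<in>J. C c)"
     "\<forall>c\<in>J. c \<in> C c \<and> connected (C c) \<and> openin (top_of_set N) (C c) \<and> closure (C c) \<inter> closure W = {} \<and> C c \<subseteq> L"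
     "\<forall>c\<in>J. \<forall>d\<in>J. c \<noteq> d \<longrightarrow> C c \<inter> C d = {}"
     "continuous_on L col" "col ` L \<subseteq> J" "\<forall>x\<in>bd. f x \<in> C (col x)"
    by - (elim conjE, assumption)+
  interpret coloured_block f p Y N A r V Vinf \<sigma> W J C col
  proof unfold_locales
    show "c \<in> C c \<and> connected (C c) \<and> openin (top_of_set N) (C c) \<and> closure (C c) \<inter> closure W = {} \<and> C c \<subseteq> L" if "c \<in> J" for c
      by (rule bspec[OF JC(5) that])
    show "C c \<inter> C d = {}" if "c \<in> J" "d \<in> J" "c \<noteq> d" for c d using JC(6) that by blast
    show "col x \<in> J" if "x \<in> L" for x using JC(8) that by blast
    show "f x \<in> C (col x)" if "x \<in> bd" for x by (rule bspec[OF JC(9) that])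
  qed (rule JC)+
  obtain y0 where y0: "y0 \<in> Om" "y0 \<notin> f ` closure W" "infgood \<longrightarrow> y0 = p + of_real (100 * \<sigma>)" using y0_exists by blast
  interpret pointed_block f p Y N A r V Vinf \<sigma> W J C col y0
    by unfold_locales (use y0 in auto)
  have "\<exists>F a. finite F \<and> F \<noteq> {} \<and> 0 \<notin> F \<and> (\<forall>k\<in>F. a k > 0) \<and>
     (\<forall>n\<ge>1. card {c\<in>J. (col ^^ n) c = c} = (\<Sum>k\<in>{k\<in>F. k dvd n}. k * a k))"
    by (rule card_fixed_points_iterates[OF finJ neJ colJ[OF JL]])
  then obtain F a where "finite F \<and> F \<noteq> {} \<and> 0 \<notin> F \<and> (\<forall>k\<in>F. a k > 0) \<and>
     (\<forall>n\<ge>1. card {c\<in>J. (col ^^ n) c = c} = (\<Sum>k\<in>{k\<in>F. k dvd n}. k * a k))"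
    by (elim exE) (rule that)
  then have Fa: "finite F" "F \<noteq> {}" "0 \<notin> F" "\<forall>k\<in>F. a k > 0"
     "\<forall>n\<ge>1. card {c\<in>J. (col ^^ n) c = c} = (\<Sum>k\<in>{k\<in>F. k dvd n}. k * a k)"
    by - (elim conjE, assumption)+
  have "fp_index (f ^^ n) p = 1 - (\<Sum>k\<in>{k\<in>F. k dvd n}. int k * int (a k))" if "n \<ge> 1" for n
    using index_of_iterates[OF that] mp[OF spec[OF Fa(5)] that] by simp
  then show ?thesis using Fa(1-4) by (intro exI[of _ F] exI[of _ a] conjI allI impI)
qed

end
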